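(* For fixed $k$, and a $k$-NU graph $H$, there is a polynomial time algorithm (polynomial in the number $n_G$ of vertices of $G$) for finding the shortest path between $\phi$ and $\psi$ in $\mathrm{Hom}(G,H;p)$ for any instance $(G,p,\phi,\psi)$ of the $H$-extension reconfiguration problem $\mathrm{Recon}_{\mathrm{Ext}}(H)$.
   Context: Graphs are undirected, may have loops, and have no multiple edges. A homomorphism is an edge-preserving vertex map. $H^k$ is the $k$-fold categorical product: tuples are adjacent iff they are adjacent in every coordinate. For $k\ge 3$, $H$ is a $k$-NU graph if there is a homomorphism $f:H^k\to H$ such that $f(x_1,\dots,x_k)=x$ whenever at least $k-1$ of the $x_i$ are equal to $x$. $\mathrm{Hom}(G,H)$ is the graph whose vertices are the homomorphisms $G\to H$, with $\phi\sim\psi$ iff $\phi(u)\sim\psi(v)$ for all $u\sim v$ in $G$. An $H$-precolouring $p$ of $G$ is a map from a subset of $V(G)$ to $V(H)$. $\mathrm{Hom}(G,H;p)$ is the subgraph of $\mathrm{Hom}(G,H)$ induced by the homomorphisms extending $p$. The $H$-extension reconfiguration problem $\mathrm{Recon}_{\mathrm{Ext}}(H)$ has as instances the tuples $(G,p,\phi,\psi)$, where $G$ is a graph, $p$ is an $H$-precolouring of $G$, and $\phi,\psi$ are vertices of $\mathrm{Hom}(G,H;p)$; it asks whether $\phi$ and $\psi$ are in the same component of $\mathrm{Hom}(G,H;p)$. *)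

theory Defs
  imports
    "Graph_Theory.Graph_Theory"
    "HOL-Library.FuncSet"
    "HOL-Computational_Algebra.Polynomial"
begin

section \<open>Graphs, powers, near-unanimity\<close>

text \<open>
  Graphs are undirected, finite, without multiple edges and possibly with loops; they are
  represented by \<^locale>\<open>pair_pseudo_graph\<close>, i.e. by a finite vertex set with a symmetric
  adjacency relation \<^const>\<open>parcs\<close>.
\<close>

text \<open>Homomorphisms are extensional (\<^term>\<open>undefined\<close> outside the vertex set), so that
  distinct elements of \<open>homs G H\<close> are distinct as vertex maps.\<close>

definition homs :: "'a pair_pre_digraph \<Rightarrow> 'b pair_pre_digraph \<Rightarrow> ('a \<Rightarrow> 'b) set" where
  "homs G H = {f \<in> pverts G \<rightarrow>\<^sub>E pverts H. \<forall>(u, v) \<in> parcs G. (f u, f v) \<in> parcs H}"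

definition graph_power :: "'a pair_pre_digraph \<Rightarrow> nat \<Rightarrow> 'a list pair_pre_digraph" where
  "graph_power H k =
     (let V = {xs. length xs = k \<and> set xs \<subseteq> pverts H} in
       \<lparr> pverts = V,
         parcs = {(xs, ys) \<in> V \<times> V. \<forall>i<k. (xs ! i, ys ! i) \<in> parcs H} \<rparr>)"

definition NU_graph :: "nat \<Rightarrow> 'a pair_pre_digraph \<Rightarrow> bool" where
  "NU_graph k H \<longleftrightarrow> k \<ge> 3 \<and>
     (\<exists>f \<in> homs (graph_power H k) H. \<forall>xs \<in> pverts (graph_power H k). \<forall>x \<in> pverts H.
        card {i. i < k \<and> xs ! i = x} \<ge> k - 1 \<longrightarrow> f xs = x)"


section \<open>Hom-graphs and extension reconfiguration\<close>

definition Hom :: "'a pair_pre_digraph \<Rightarrow> 'b pair_pre_digraph \<Rightarrow> ('a \<Rightarrow> 'b) pair_pre_digraph" where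
  "Hom G H =
     \<lparr> pverts = homs G H,
       parcs = {(\<phi>, \<psi>) \<in> homs G H \<times> homs G H. \<forall>(u, v) \<in> parcs G. (\<phi> u, \<psi> v) \<in> parcs H} \<rparr>"

definition precolouring ::
    "'a pair_pre_digraph \<Rightarrow> 'b pair_pre_digraph \<Rightarrow> ('a \<rightharpoonup> 'b) \<Rightarrow> bool" where
  "precolouring G H p \<longleftrightarrow> dom p \<subseteq> pverts G \<and> ran p \<subseteq> pverts H"

definition Hom_ext ::
    "'a pair_pre_digraph \<Rightarrow> 'b pair_pre_digraph \<Rightarrow> ('a \<rightharpoonup> 'b) \<Rightarrow>
      ('a \<Rightarrow> 'b, ('a \<Rightarrow> 'b) \<times> ('a \<Rightarrow> 'b)) pre_digraph" where
  "Hom_ext G H p = with_proj (Hom G H) \<restriction> {\<phi> \<in> homs G H. \<forall>v \<in> dom p. p v = Some (\<phi> v)}"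

type_synonym ('a, 'b) recon_inst =
  "'a pair_pre_digraph \<times> ('a \<rightharpoonup> 'b) \<times> ('a \<Rightarrow> 'b) \<times> ('a \<Rightarrow> 'b)"

definition Recon_Ext :: "'b pair_pre_digraph \<Rightarrow> ('a, 'b) recon_inst set" where
  "Recon_Ext H = {(G, p, \<phi>, \<psi>). pair_pseudo_graph G \<and> precolouring G H p \<and>
     \<phi> \<in> verts (Hom_ext G H p) \<and> \<psi> \<in> verts (Hom_ext G H p)}"

definition path_between :: "('v, 'e) pre_digraph \<Rightarrow> 'v \<Rightarrow> 'v \<Rightarrow> 'v list \<Rightarrow> bool" where
  "path_between K x y xs \<longleftrightarrow> vpath xs K \<and> hd xs = x \<and> last xs = y"

definition shortest_path :: "('v, 'e) pre_digraph \<Rightarrow> 'v \<Rightarrow> 'v \<Rightarrow> 'v list \<Rightarrow> bool" where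
  "shortest_path K x y xs \<longleftrightarrow> path_between K x y xs \<and>
     (\<forall>ys. path_between K x y ys \<longrightarrow> vwalk_length xs \<le> vwalk_length ys)"

text \<open>The correct answers to an instance: any shortest path, or \<^const>\<open>None\<close> if the two
  homomorphisms lie in different components.\<close>

fun shortest_path_answers ::
    "'b pair_pre_digraph \<Rightarrow> ('a, 'b) recon_inst \<Rightarrow> ('a \<Rightarrow> 'b) list option set" where
  "shortest_path_answers H (G, p, \<phi>, \<psi>) =
     {Some xs | xs. shortest_path (Hom_ext G H p) \<phi> \<psi> xs} \<union>
     (if \<exists>xs. path_between (Hom_ext G H p) \<phi> \<psi> xs then {} else {None})"


section \<open>Polynomial-time algorithms\<close>

text \<open>
  The machine model is a first-order functional language over binary trees (pure Lisp without
  atoms other than nil), a deterministic model polynomially equivalent to Turing machines.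
  A program is a list of function bodies, called by their position in the list. Variables are
  de Bruijn indices into the list of values currently in scope: in a function body these are
  the arguments of the call, and the third branch of \<open>ECase\<close> pushes the left and right
  subtree of the scrutinee in front.

  The time \<open>t\<close> in \<open>eval P env e v t\<close> counts the expression nodes evaluated, each at unit cost.
  This is a fair measure because values can be represented by pointers into a shared heap:
  one evaluation step allocates at most one cell, copies a pointer, or inspects one cell, and
  trees cannot be compared as a whole, so \<open>t\<close> steps are simulated by a Turing machine in time
  polynomial in \<open>t\<close> and the size of the input.
\<close>

datatype tree = Leaf | Node tree tree

datatype exp =
    EVar nat
  | ELeaf
  | ENode exp exp
  | ECase exp exp exp
  | ECall nat "exp list"

type_synonym prog = "exp list"

inductive
  eval :: "prog \<Rightarrow> tree list \<Rightarrow> exp \<Rightarrow> tree \<Rightarrow> nat \<Rightarrow> bool" and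
  evals :: "prog \<Rightarrow> tree list \<Rightarrow> exp list \<Rightarrow> tree list \<Rightarrow> nat \<Rightarrow> bool"
  for P :: prog
where
  Var: "i < length env \<Longrightarrow> eval P env (EVar i) (env ! i) 1"
| Leaf: "eval P env ELeaf Leaf 1"
| Node: "\<lbrakk> eval P env e1 v1 t1; eval P env e2 v2 t2 \<rbrakk> \<Longrightarrow>
    eval P env (ENode e1 e2) (Node v1 v2) (Suc (t1 + t2))"
| CaseLeaf: "\<lbrakk> eval P env e Leaf t; eval P env e1 v t1 \<rbrakk> \<Longrightarrow>
    eval P env (ECase e e1 e2) v (Suc (t + t1))"
| CaseNode: "\<lbrakk> eval P env e (Node a b) t; eval P (a # b # env) e2 v t2 \<rbrakk> \<Longrightarrow>
    eval P env (ECase e e1 e2) v (Suc (t + t2))"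
| Call: "\<lbrakk> f < length P; evals P env es vs t; eval P vs (P ! f) v t' \<rbrakk> \<Longrightarrow>
    eval P env (ECall f es) v (Suc (t + t'))"
| Nil: "evals P env [] [] 0"
| Cons: "\<lbrakk> eval P env e v t; evals P env es vs t' \<rbrakk> \<Longrightarrow>
    evals P env (e # es) (v # vs) (t + t')"

inductive_cases eval_VarE: "eval P env (EVar i) v t"
inductive_cases eval_LeafE: "eval P env ELeaf v t"
inductive_cases eval_NodeE: "eval P env (ENode e1 e2) v t"
inductive_cases eval_CaseE: "eval P env (ECase e e1 e2) v t"
inductive_cases eval_CallE: "eval P env (ECall f es) v t"
inductive_cases evals_NilE: "evals P env [] vs t"
inductive_cases evals_ConsE: "evals P env (e # es) vs t"

lemma eval_deterministic:
  "eval P env e v t \<Longrightarrow> eval P env e v' t' \<Longrightarrow> v' = v \<and> t' = t"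
  and evals_deterministic:
  "evals P env es vs t \<Longrightarrow> evals P env es vs' t' \<Longrightarrow> vs' = vs \<and> t' = t"
proof (induction arbitrary: v' t' and vs' t' rule: eval_evals.inducts)
  case (Var i env) then show ?case by (auto elim: eval_VarE)
next
  case (Leaf env) then show ?case by (auto elim: eval_LeafE)
next
  case (Node env e1 v1 t1 e2 v2 t2)
  from Node.prems Node.IH show ?case by (elim eval_NodeE) blast
next
  case (CaseLeaf env e t e1 v t1 e2)
  from CaseLeaf.prems CaseLeaf.IH show ?case by (elim eval_CaseE) blast+
next
  case (CaseNode env e a b t e2 v t2 e1)
  from CaseNode.prems CaseNode.IH show ?case by (elim eval_CaseE) blast+
next
  case (Call f env es vs t v t')
  from Call.prems Call.IH show ?case by (elim eval_CallE) blast
next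
  case (Nil env) then show ?case by (auto elim: evals_NilE)
next
  case (Cons env e v t es vs t')
  from Cons.prems Cons.IH show ?case by (elim evals_ConsE) blast
qed

text \<open>
  A search problem is given by its instances \<open>I\<close>, their encoding as trees, the size parameter
  \<open>sz\<close> in which the running time is measured, the set of correct answers to each instance and
  the encoding of answers. Function \<open>0\<close> of a program is its entry point.
\<close>

definition poly_time_solvable ::
    "'i set \<Rightarrow> ('i \<Rightarrow> tree) \<Rightarrow> ('i \<Rightarrow> nat) \<Rightarrow> ('i \<Rightarrow> 'o set) \<Rightarrow> ('i \<Rightarrow> 'o \<Rightarrow> tree) \<Rightarrow> bool" where
  "poly_time_solvable I enc sz answers enc_out \<longleftrightarrow>
     (\<exists>(P :: prog) (q :: nat poly). \<forall>x \<in> I. \<exists>v t.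
        eval P [enc x] (ECall 0 [EVar 0]) v t \<and>
        v \<in> enc_out x ` answers x \<and> t \<le> poly q (sz x))"


section \<open>Encoding of instances and paths\<close>

fun enc_list :: "('x \<Rightarrow> tree) \<Rightarrow> 'x list \<Rightarrow> tree" where
  "enc_list f [] = Leaf"
| "enc_list f (x # xs) = Node (f x) (enc_list f xs)"

fun enc_option :: "('x \<Rightarrow> tree) \<Rightarrow> 'x option \<Rightarrow> tree" where
  "enc_option f None = Leaf"
| "enc_option f (Some x) = Node (f x) Leaf"

fun enc_bool :: "bool \<Rightarrow> tree" where
  "enc_bool False = Leaf"
| "enc_bool True = Node Leaf Leaf"

fun enc_nat :: "nat \<Rightarrow> tree" where
  "enc_nat 0 = Leaf"
| "enc_nat (Suc n) = Node Leaf (enc_nat n)"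

text \<open>
  As an input, \<open>G\<close> has vertices \<open>0, \<dots>, n - 1\<close> and is given by its adjacency matrix; partial and
  total maps on \<open>G\<close> are given by their lists of values. The vertices of the fixed graph \<open>H\<close> are
  named by numbers \<open>c x\<close>, written in unary. Hence the encoded instance has size \<open>O(n\<^sup>2)\<close>.
\<close>

definition numbered :: "(nat, 'b) recon_inst set" where
  "numbered = {(G, p, \<phi>, \<psi>). pverts G = {..<card (pverts G)}}"

fun num_verts :: "('a, 'b) recon_inst \<Rightarrow> nat" where
  "num_verts (G, p, \<phi>, \<psi>) = card (pverts G)"

definition enc_map :: "('b \<Rightarrow> nat) \<Rightarrow> nat \<Rightarrow> (nat \<Rightarrow> 'b) \<Rightarrow> tree" where
  "enc_map c n \<phi> = enc_list (\<lambda>v. enc_nat (c (\<phi> v))) [0..<n]"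

definition enc_precolouring :: "('b \<Rightarrow> nat) \<Rightarrow> nat \<Rightarrow> (nat \<rightharpoonup> 'b) \<Rightarrow> tree" where
  "enc_precolouring c n p = enc_list (\<lambda>v. enc_option (\<lambda>x. enc_nat (c x)) (p v)) [0..<n]"

definition enc_graph :: "nat \<Rightarrow> nat pair_pre_digraph \<Rightarrow> tree" where
  "enc_graph n G = enc_list (\<lambda>u. enc_list (\<lambda>v. enc_bool ((u, v) \<in> parcs G)) [0..<n]) [0..<n]"

fun enc_inst :: "('b \<Rightarrow> nat) \<Rightarrow> (nat, 'b) recon_inst \<Rightarrow> tree" where
  "enc_inst c (G, p, \<phi>, \<psi>) =
     (let n = card (pverts G) in
        Node (enc_graph n G)
          (Node (enc_precolouring c n p) (Node (enc_map c n \<phi>) (enc_map c n \<psi>))))"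

definition enc_answer ::
    "('b \<Rightarrow> nat) \<Rightarrow> (nat, 'b) recon_inst \<Rightarrow> (nat \<Rightarrow> 'b) list option \<Rightarrow> tree" where
  "enc_answer c x = enc_option (enc_list (enc_map c (num_verts x)))"

end

theory Submission
  imports Defs
begin

text \<open>
  Walks of length \<open>l\<close> from \<open>\<phi>\<close> to \<open>\<psi>\<close> in \<open>Hom(G, H; p)\<close> are the solutions of a constraint
  satisfaction problem over \<open>H\<close> with \<open>(l + 1) n\<close> variables and binary constraints, all of which
  are preserved by the near-unanimity operation \<open>f\<close>. By the theorem of Baker and Pixley a relation
  closed under \<open>f\<close> is determined by its projections to \<open>k - 1\<close> coordinates, so a polynomially long
  list of solutions that realises all these projections represents all solutions. Two rounds of
  applying \<open>f\<close> to all \<open>k\<close>-tuples of a representing list realise the projections to \<open>k + 1\<close>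
  coordinates, which is enough room to impose one more binary constraint; afterwards the list is
  pruned again. The same theorem bounds the length of a shortest path: the sets of homomorphisms
  reachable from \<open>\<phi>\<close> in \<open>i\<close> steps form an increasing chain of relations closed under \<open>f\<close>, and their
  \<open>k - 1\<close>-ary projections can grow only polynomially often. Hence it suffices to solve the problem
  for \<open>l = 0, 1, 2, \<dots>\<close> up to a polynomial bound.
\<close>

section \<open>Polynomial-time computation\<close>

text \<open>There may be exponentially many solutions, so only representing lists are ever stored.
  Two rounds of \<open>f\<close> raise the length of such a list to the power \<open>k ^ 2\<close>;
  pruning after every single constraint prevents these powers from piling up, because the pruned
  length depends on the number of variables alone. The chain of reached sets is increasing because
  every homomorphism is adjacent to itself in the Hom-graph, so a walk may pause. The first length
  with a solution belongs to a walk of minimal length, and such a walk repeats no vertex, hence is a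
  shortest path. For the machine, the obstacle is that trees cannot be compared in one step and that
  the program may not depend on the instance. Whatever depends on \<open>H\<close> and
  \<open>k\<close> only (the operation \<open>f\<close>, the edges of \<open>H\<close>, equality of
  \<open>(k - 1)\<close>-tuples) is a function on a finite set and is compiled into a fixed nest of
  case distinctions. Loops are justified through bounds on the values that really occur in
  them.\<close>

fun shift :: "nat \<Rightarrow> exp \<Rightarrow> exp" where
  "shift d (EVar i) = EVar i"
| "shift d ELeaf = ELeaf"
| "shift d (ENode a b) = ENode (shift d a) (shift d b)"
| "shift d (ECase a b c) = ECase (shift d a) (shift d b) (shift d c)"
| "shift d (ECall f es) = ECall (d + f) (map (shift d) es)"

text \<open>Calls are positional, so code can be moved behind \<open>Q\<close> once its call targets
  are raised by \<open>length Q\<close>; code appended as \<open>R\<close> is never called. Value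
  and time stay the same, which permits linking programs.\<close>

lemma eval_shift:
  "eval P env e v t \<Longrightarrow>
     eval (Q @ map (shift (length Q)) P @ R) env (shift (length Q) e) v t"
  "evals P env es vs t \<Longrightarrow>
     evals (Q @ map (shift (length Q)) P @ R) env (map (shift (length Q)) es) vs t"
proof (induction rule: eval_evals.inducts)
  case (Call f env es vs t v t')
  then show ?case
    by (auto intro!: eval_evals.Call simp: nth_append)
qed (auto intro: eval_evals.intros simp del: One_nat_def)

lemma shift_0 [simp]: "shift 0 = id"
proof
  show "shift 0 e = id e" for e
    by (induction e) (auto intro: map_idI)
qed

lemma eval_append: "eval P env e v t \<Longrightarrow> eval (P @ R) env e v t"
  using eval_shift(1)[where Q = "[]"] by simp

lemma eval_append_shift:
  "eval P env e v t \<Longrightarrow> eval (Q @ map (shift (length Q)) P) env (shift (length Q) e) v t"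
  using eval_shift(1)[where R = "[]"] by simp

lemma eval_Var': "i < length env \<Longrightarrow> env ! i = v \<Longrightarrow> eval P env (EVar i) v (Suc 0)"
  using eval_evals.Var[of i env] by auto

lemma eval_Leaf': "eval P env ELeaf Leaf (Suc 0)"
  using eval_evals.Leaf by simp

lemma eval_Call1:
  assumes "eval P env e v t" "f < length P" "eval P [v] (P ! f) w t'"
  shows "eval P env (ECall f [e]) w (Suc (t + t'))"
proof -
  have "evals P env [e] [v] (t + 0)"
    by (intro eval_evals.Cons eval_evals.Nil assms)
  then show ?thesis
    using assms by (auto intro: eval_evals.Call)
qed

definition pbounded :: "'x set \<Rightarrow> ('x \<Rightarrow> nat) \<Rightarrow> ('x \<Rightarrow> nat) \<Rightarrow> bool" where
  "pbounded X N g \<longleftrightarrow> (\<exists>q. \<forall>x\<in>X. g x \<le> poly q (N x))"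

lemma pbounded_le: "pbounded X N h \<Longrightarrow> (\<And>x. x \<in> X \<Longrightarrow> g x \<le> h x) \<Longrightarrow> pbounded X N g"
  unfolding pbounded_def by (meson le_trans)

lemma pbounded_poly: "pbounded X N (\<lambda>x. poly q (N x))"
  unfolding pbounded_def by auto

lemma pbounded_const: "pbounded X N (\<lambda>_. c)"
  unfolding pbounded_def by (rule exI[of _ "[:c:]"]) simp

lemma pbounded_size: "pbounded X N N"
  unfolding pbounded_def by (rule exI[of _ "[:0, 1:]"]) simp

lemma pbounded_add: "pbounded X N g \<Longrightarrow> pbounded X N h \<Longrightarrow> pbounded X N (\<lambda>x. g x + h x)"
  unfolding pbounded_def by (metis add_mono poly_add)

lemma pbounded_mult: "pbounded X N g \<Longrightarrow> pbounded X N h \<Longrightarrow> pbounded X N (\<lambda>x. g x * h x)"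
  unfolding pbounded_def by (metis mult_le_mono poly_mult)

lemma pbounded_Suc: "pbounded X N g \<Longrightarrow> pbounded X N (\<lambda>x. Suc (g x))"
  using pbounded_add[OF pbounded_const[where c = 1]] by simp

lemma pbounded_power: "pbounded X N g \<Longrightarrow> pbounded X N (\<lambda>x. g x ^ d)"
  by (induction d) (auto intro: pbounded_const pbounded_mult)

lemma pbounded_fst:
  "pbounded X N g \<Longrightarrow> (\<And>z. z \<in> Z \<Longrightarrow> fst z \<in> X) \<Longrightarrow> pbounded Z (\<lambda>z. N (fst z)) (\<lambda>z. g (fst z))"
  unfolding pbounded_def by blast

lemma pbounded_mono: "pbounded X N g \<Longrightarrow> Y \<subseteq> X \<Longrightarrow> pbounded Y N g"
  unfolding pbounded_def by blast

lemmas pbounded_intros =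
  pbounded_poly pbounded_const pbounded_size pbounded_add pbounded_mult pbounded_Suc pbounded_power

text \<open>
  Computations are families of runs indexed by \<open>x \<in> X\<close>, with input \<open>E x\<close> as the only variable in
  scope and output \<open>F x\<close>. Time is measured in the size \<open>N x\<close> of the index, not of the input tree;
  hence composing computations requires no bound on the size of intermediate results.
\<close>

definition runs ::
    "prog \<Rightarrow> exp \<Rightarrow> 'x set \<Rightarrow> ('x \<Rightarrow> nat) \<Rightarrow> ('x \<Rightarrow> tree) \<Rightarrow> ('x \<Rightarrow> tree) \<Rightarrow> bool" where
  "runs P e X N E F \<longleftrightarrow>
     (\<exists>t. pbounded X N t \<and> (\<forall>x\<in>X. eval P [E x] e (F x) (t x)))"

definition ptime ::
    "'x set \<Rightarrow> ('x \<Rightarrow> nat) \<Rightarrow> ('x \<Rightarrow> tree) \<Rightarrow> ('x \<Rightarrow> tree) \<Rightarrow> bool" where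
  "ptime X N E F \<longleftrightarrow> (\<exists>P e. runs P e X N E F)"

lemma runs_append: "runs P e X N E F \<Longrightarrow> runs (P @ R) e X N E F"
  unfolding runs_def by (blast intro: eval_append)

text \<open>Linking: \<open>P\<close> stays in front, so that computations already placed there keep
  running by \<open>runs_append\<close>, and only the new code is shifted.\<close>

lemma ptime_extend:
  assumes "ptime X N E F"
  obtains R e where "runs (P @ R) e X N E F"
  using assms unfolding ptime_def runs_def by (blast intro: eval_append_shift)

lemma runs_call:
  assumes "runs P e X N E F" "runs P b X N F G" "f < length P" "P ! f = b"
  shows "runs P (ECall f [e]) X N E G"
proof -
  obtain t1 where t1: "pbounded X N t1" "\<And>x. x \<in> X \<Longrightarrow> eval P [E x] e (F x) (t1 x)"
    using assms(1) unfolding runs_def by blast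
  obtain t2 where t2: "pbounded X N t2" "\<And>x. x \<in> X \<Longrightarrow> eval P [F x] b (G x) (t2 x)"
    using assms(2) unfolding runs_def by blast
  have "pbounded X N (\<lambda>x. Suc (t1 x + t2 x))"
    by (intro pbounded_intros t1 t2)
  moreover have "eval P [E x] (ECall f [e]) (G x) (Suc (t1 x + t2 x))" if "x \<in> X" for x
    using eval_Call1[OF t1(2)[OF that] assms(3)] t2(2)[OF that] assms(4) by simp
  ultimately show ?thesis
    unfolding runs_def by (intro exI[of _ "\<lambda>x. Suc (t1 x + t2 x)"]) simp
qed

text \<open>The second computation becomes a function body of its own: a call is what makes the
  intermediate value the sole variable in scope.\<close>

lemma ptime_trans:
  assumes "ptime X N E F" "ptime X N F G"
  shows "ptime X N E G"
proof -
  obtain P e where 1: "runs P e X N E F"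
    using assms(1) unfolding ptime_def by blast
  obtain R b where 2: "runs (P @ R) b X N F G"
    using assms(2) by (rule ptime_extend)
  have "runs ((P @ R) @ [b]) (ECall (length (P @ R)) [e]) X N E G"
    using runs_append[OF runs_append[OF 1]] runs_append[OF 2] by (rule runs_call) auto
  then show ?thesis
    unfolding ptime_def by blast
qed

lemma ptime_refl: "ptime X N E E"
proof -
  have "runs [] (EVar 0) X N E E"
    unfolding runs_def
    by (rule exI[of _ "\<lambda>_. 1"]) (use eval_evals.Var[of 0 "[E x]" for x] in \<open>auto intro: pbounded_const\<close>)
  then show ?thesis
    unfolding ptime_def by blast
qed

lemma ptime_Leaf: "ptime X N E (\<lambda>_. Leaf)"
proof -
  have "runs [] ELeaf X N E (\<lambda>_. Leaf)"
    unfolding runs_def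
    by (rule exI[of _ "\<lambda>_. 1"]) (auto intro: pbounded_const eval_evals.Leaf simp del: One_nat_def)
  then show ?thesis
    unfolding ptime_def by blast
qed

lemma ptime_Node:
  assumes "ptime X N E F" "ptime X N E G"
  shows "ptime X N E (\<lambda>x. Node (F x) (G x))"
proof -
  obtain P a where 1: "runs P a X N E F"
    using assms(1) unfolding ptime_def by blast
  obtain R b where 2: "runs (P @ R) b X N E G"
    using assms(2) by (rule ptime_extend)
  obtain t1 where t1: "pbounded X N t1" "\<And>x. x \<in> X \<Longrightarrow> eval (P @ R) [E x] a (F x) (t1 x)"
    using runs_append[OF 1] unfolding runs_def by blast
  obtain t2 where t2: "pbounded X N t2" "\<And>x. x \<in> X \<Longrightarrow> eval (P @ R) [E x] b (G x) (t2 x)"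
    using 2 unfolding runs_def by blast
  have "runs (P @ R) (ENode a b) X N E (\<lambda>x. Node (F x) (G x))"
    unfolding runs_def
    by (rule exI[of _ "\<lambda>x. Suc (t1 x + t2 x)"])
      (auto intro!: pbounded_intros eval_evals.Node t1 t2)
  then show ?thesis
    unfolding ptime_def by blast
qed

lemma ptime_const: "ptime X N E (\<lambda>_. v)"
  by (induction v) (auto intro: ptime_Leaf ptime_Node)

lemma ptime_mono: "ptime X N E F \<Longrightarrow> Y \<subseteq> X \<Longrightarrow> ptime Y N E F"
  unfolding ptime_def runs_def by (meson pbounded_mono subsetD)

lemma ptime_cong:
  "ptime X N E F \<Longrightarrow> (\<And>x. x \<in> X \<Longrightarrow> F x = G x) \<Longrightarrow> ptime X N E G"
  unfolding ptime_def runs_def by (metis (no_types, lifting))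

lemma ptime_fst:
  assumes "ptime X N E F" "\<And>z. z \<in> Z \<Longrightarrow> fst z \<in> X"
  shows "ptime Z (\<lambda>z. N (fst z)) (\<lambda>z. E (fst z)) (\<lambda>z. F (fst z))"
proof -
  obtain P e t where *: "pbounded X N t" "\<And>x. x \<in> X \<Longrightarrow> eval P [E x] e (F x) (t x)"
    using assms(1) unfolding ptime_def runs_def by blast
  have "pbounded Z (\<lambda>z. N (fst z)) (\<lambda>z. t (fst z))"
    using * assms(2) by (blast intro: pbounded_fst)
  then show ?thesis
    unfolding ptime_def runs_def using * assms(2)
    by (intro exI[of _ P] exI[of _ e] exI[of _ "\<lambda>z. t (fst z)"]) auto
qed

fun left :: "tree \<Rightarrow> tree" where
  "left Leaf = Leaf" | "left (Node a b) = a"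

fun right :: "tree \<Rightarrow> tree" where
  "right Leaf = Leaf" | "right (Node a b) = b"

lemma
  assumes "ptime X N E F"
  shows ptime_left: "ptime X N E (\<lambda>x. left (F x))"
    and ptime_right: "ptime X N E (\<lambda>x. right (F x))"
proof -
  let ?t = "Suc (Suc 0 + Suc 0)"
  have *: "eval P [v] (ECase (EVar 0) ELeaf (EVar 0)) (left v) ?t \<and>
      eval P [v] (ECase (EVar 0) ELeaf (EVar 1)) (right v) ?t" for P v
  proof (cases v)
    case Leaf
    show ?thesis
      unfolding Leaf left.simps right.simps
      by (intro conjI eval_evals.CaseLeaf eval_Leaf' eval_Var') auto
  next
    case (Node a b)
    have v: "eval P [v] (EVar 0) (Node a b) (Suc 0)"
      by (rule eval_Var') (auto simp: Node)
    show ?thesis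
      unfolding Node left.simps right.simps
      by (intro conjI eval_evals.CaseNode[OF v[unfolded Node]] eval_Var') auto
  qed
  have runsI: "ptime X N F G" if "\<And>x. eval [] [F x] e (G x) ?t" for e G
  proof -
    have "runs [] e X N F G"
      unfolding runs_def by (intro exI[of _ "\<lambda>_. ?t"] conjI pbounded_const ballI that)
    then show ?thesis
      unfolding ptime_def by blast
  qed
  show "ptime X N E (\<lambda>x. left (F x))" "ptime X N E (\<lambda>x. right (F x))"
    by (rule ptime_trans[OF assms runsI], use *[of "[]"] in blast)+
qed

text \<open>Each branch is analysed only on the indices that take it. \<open>ECase\<close> pushes
  two subtrees in front of the input, so the second branch is a separate function, called on
  \<open>EVar 2\<close> to restore the scope that its code expects.\<close>

lemma ptime_if_Leaf:
  assumes "ptime X N E C" "ptime {x \<in> X. C x = Leaf} N E F" "ptime {x \<in> X. C x \<noteq> Leaf} N E F"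
  shows "ptime X N E F"
proof -
  let ?X1 = "{x \<in> X. C x = Leaf}" and ?X2 = "{x \<in> X. C x \<noteq> Leaf}"
  obtain P1 c where c: "runs P1 c X N E C"
    using assms(1) unfolding ptime_def by blast
  obtain P2 a where a: "runs (P1 @ P2) a ?X1 N E F"
    using assms(2) by (rule ptime_extend)
  obtain P3 b where b: "runs ((P1 @ P2) @ P3) b ?X2 N E F"
    using assms(3) by (rule ptime_extend)
  define P where "P = ((P1 @ P2) @ P3) @ [b]"
  obtain tc where tc: "pbounded X N tc" "\<And>x. x \<in> X \<Longrightarrow> eval P [E x] c (C x) (tc x)"
    using runs_append[OF runs_append[OF runs_append[OF c]]] unfolding runs_def P_def by blast
  obtain ta where ta: "pbounded ?X1 N ta" "\<And>x. x \<in> ?X1 \<Longrightarrow> eval P [E x] a (F x) (ta x)"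
    using runs_append[OF runs_append[OF a]] unfolding runs_def P_def by blast
  obtain tb where tb: "pbounded ?X2 N tb" "\<And>x. x \<in> ?X2 \<Longrightarrow> eval P [E x] b (F x) (tb x)"
    using runs_append[OF b] unfolding runs_def P_def by blast
  have P: "length P - 1 < length P" "P ! (length P - 1) = b"
    unfolding P_def by auto
  define t where "t x = (if C x = Leaf then Suc (tc x + ta x) else Suc (tc x + Suc (Suc 0 + tb x)))" for x
  obtain qa qb where q: "\<And>x. x \<in> ?X1 \<Longrightarrow> ta x \<le> poly qa (N x)"
    "\<And>x. x \<in> ?X2 \<Longrightarrow> tb x \<le> poly qb (N x)"
    using ta(1) tb(1) unfolding pbounded_def by (elim exE) (rule that; blast)
  have "pbounded X N (\<lambda>x. tc x + poly qa (N x) + poly qb (N x) + 3)"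
    by (intro pbounded_intros tc)
  then have "pbounded X N t"
  proof (rule pbounded_le)
    fix x assume "x \<in> X"
    then show "t x \<le> tc x + poly qa (N x) + poly qb (N x) + 3"
      unfolding t_def using q(1)[of x] q(2)[of x] by auto
  qed
  moreover have "eval P [E x] (ECase c a (ECall (length P - 1) [EVar 2])) (F x) (t x)"
    if "x \<in> X" for x
  proof (cases "C x")
    case Leaf
    then have t: "t x = Suc (tc x + ta x)"
      by (simp add: t_def)
    show ?thesis
      unfolding t using tc(2)[OF that] ta(2)[of x] that Leaf
      by (intro eval_evals.CaseLeaf) simp_all
  next
    case (Node u v)
    then have t: "t x = Suc (tc x + Suc (Suc 0 + tb x))"
      by (simp add: t_def)
    have "eval P [u, v, E x] (EVar 2) (E x) (Suc 0)"
      by (rule eval_Var') auto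
    then have "eval P [u, v, E x] (ECall (length P - 1) [EVar 2]) (F x) (Suc (Suc 0 + tb x))"
      using P(1) by (rule eval_Call1) (use tb(2)[of x] that Node P in simp)
    then show ?thesis
      unfolding t using tc(2)[OF that, unfolded Node] by (intro eval_evals.CaseNode)
  qed
  ultimately show ?thesis
    unfolding ptime_def runs_def by blast
qed

text \<open>Bodies of loops and tabulations are computations indexed by pairs of an index and a
  local value; the input tree carries both, while time is still measured in the size of the original
  index, as \<open>N (fst z)\<close>.\<close>

abbreviation with_input :: "('x \<Rightarrow> tree) \<Rightarrow> ('a \<Rightarrow> tree) \<Rightarrow> 'x \<times> 'a \<Rightarrow> tree" where
  "with_input E ea \<equiv> \<lambda>z. Node (E (fst z)) (ea (snd z))"

lemma ptime_weaken:
  assumes "ptime X N E F" "\<And>z. z \<in> Z \<Longrightarrow> fst z \<in> X"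
  shows "ptime Z (\<lambda>z. N (fst z)) (with_input E ea) (\<lambda>z. F (fst z))"
proof (rule ptime_trans)
  show "ptime Z (\<lambda>z. N (fst z)) (with_input E ea) (\<lambda>z. E (fst z))"
    using ptime_left[OF ptime_refl[of Z _ "with_input E ea"]] by simp
qed (use assms in \<open>rule ptime_fst\<close>)

lemma ptime_snd: "ptime Z N (with_input E ea) (\<lambda>z. ea (snd z))"
  using ptime_right[OF ptime_refl[of Z _ "with_input E ea"]] by simp

text \<open>The loop body only has to be analysed on the states that really occur, namely the results of
  folding over the prefixes of the list; so a bound on the size of these results suffices.\<close>

lemma ptime_fold:
  fixes l :: "'x \<Rightarrow> 'a list" and s :: "'x \<Rightarrow> 's"
  assumes l: "ptime X N E (\<lambda>x. enc_list ea (l x))"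
    and s: "ptime X N E (\<lambda>x. es (s x))"
    and len: "pbounded X N (\<lambda>x. length (l x))"
    and step: "ptime {((x, a), r). x \<in> X \<and>
        (\<exists>i<length (l x). a = l x ! i \<and> r = fold (f x) (take i (l x)) (s x))}
      (\<lambda>z. N (fst (fst z))) (with_input (with_input E ea) es)
      (\<lambda>z. es (f (fst (fst z)) (snd (fst z)) (snd z)))"
      (is "ptime ?Z ?N ?E ?F")
  shows "ptime X N E (\<lambda>x. es (fold (f x) (l x) (s x)))"
proof -
  obtain P1 e1 where e1: "runs P1 e1 X N E (\<lambda>x. enc_list ea (l x))"
    using l unfolding ptime_def by blast
  obtain P2 e2 where e2: "runs (P1 @ P2) e2 X N E (\<lambda>x. es (s x))"
    using s by (rule ptime_extend)
  obtain P3 b where b: "runs ((P1 @ P2) @ P3) b ?Z ?N ?E ?F"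
    using step by (rule ptime_extend)
  define Q where "Q = (P1 @ P2) @ P3"
  define g where "g = length Q"
  \<comment> \<open>The arguments are the remaining list, the accumulator and the input. Inside
    \<open>ECase\<close> the head and tail of the list come first, so the accumulator is
    \<open>EVar 3\<close> and the input \<open>EVar 4\<close>; the body receives them nested as
    \<open>with_input (with_input E ea) es\<close>.\<close>
  define loop where "loop = ECase (EVar 0) (EVar 1)
    (ECall (Suc g) [EVar 1, ECall g [ENode (ENode (EVar 4) (EVar 0)) (EVar 3)], EVar 4])"
  define P where "P = Q @ [b, loop]"
  obtain t1 where t1: "pbounded X N t1"
    "\<And>x. x \<in> X \<Longrightarrow> eval P [E x] e1 (enc_list ea (l x)) (t1 x)"
    using runs_append[OF runs_append[OF runs_append[OF e1]]] unfolding runs_def P_def Q_def by blast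
  obtain t2 where t2: "pbounded X N t2" "\<And>x. x \<in> X \<Longrightarrow> eval P [E x] e2 (es (s x)) (t2 x)"
    using runs_append[OF runs_append[OF e2]] unfolding runs_def P_def Q_def by blast
  obtain t3 where t3: "pbounded ?Z ?N t3" "\<And>z. z \<in> ?Z \<Longrightarrow> eval P [?E z] b (?F z) (t3 z)"
    using runs_append[OF b] unfolding runs_def P_def Q_def by blast
  obtain q where q: "\<And>z. z \<in> ?Z \<Longrightarrow> t3 z \<le> poly q (?N z)"
    using t3(1) unfolding pbounded_def by blast
  have P: "g < length P" "Suc g < length P" "P ! g = b" "P ! Suc g = loop"
    unfolding P_def g_def by (auto simp: nth_append)
  \<comment> \<open>One pass costs 11 steps besides the body, and the final pass on the empty list
    costs 3.\<close>
  have loop: "\<exists>t \<le> (length (l x) - i) * (poly q (N x) + 11) + 3.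
      eval P [enc_list ea (drop i (l x)), es (fold (f x) (take i (l x)) (s x)), E x] loop
        (es (fold (f x) (l x) (s x))) t"
    if x: "x \<in> X" and "i \<le> length (l x)" for x i
    using \<open>i \<le> length (l x)\<close>
  proof (induction "length (l x) - i" arbitrary: i)
    case 0
    have "eval P [Leaf, es (fold (f x) (l x) (s x)), E x] loop (es (fold (f x) (l x) (s x))) (Suc (Suc 0 + Suc 0))"
      unfolding loop_def by (intro eval_evals.CaseLeaf eval_Var') simp_all
    then show ?case
      using 0 by (intro exI[of _ "Suc (Suc 0 + Suc 0)"]) auto
  next
    case (Suc d)
    then have i: "i < length (l x)" by simp
    let ?a = "l x ! i" and ?r = "fold (f x) (take i (l x)) (s x)"
    let ?r' = "fold (f x) (take (Suc i) (l x)) (s x)"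
    have drop: "drop i (l x) = ?a # drop (Suc i) (l x)"
      using i by (simp add: Cons_nth_drop_Suc)
    have r': "?r' = f x ?a ?r"
      using i by (simp add: take_Suc_conv_app_nth)
    have d: "d = length (l x) - Suc i"
      using Suc.hyps(2) by simp
    obtain t where t: "t \<le> (length (l x) - Suc i) * (poly q (N x) + 11) + 3"
      "eval P [enc_list ea (drop (Suc i) (l x)), es ?r', E x] loop (es (fold (f x) (l x) (s x))) t"
      using Suc.hyps(1)[OF d Suc_leI[OF i]] by blast
    let ?z = "((x, ?a), ?r)"
    have z: "?z \<in> ?Z"
      using x i by auto
    let ?env = "[ea ?a, enc_list ea (drop (Suc i) (l x)), enc_list ea (drop i (l x)), es ?r, E x]"
    have "eval P ?env (ENode (ENode (EVar 4) (EVar 0)) (EVar 3)) (?E ?z) (Suc (Suc (Suc 0 + Suc 0) + Suc 0))"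
      by (intro eval_evals.Node eval_Var') simp_all
    moreover have "eval P [?E ?z] b (es ?r') (t3 ?z)"
      using t3(2)[OF z] r' by simp
    ultimately have step: "eval P ?env (ECall g [ENode (ENode (EVar 4) (EVar 0)) (EVar 3)]) (es ?r')
        (Suc (Suc (Suc (Suc 0 + Suc 0) + Suc 0) + t3 ?z))"
      using P by (intro eval_Call1) simp_all
    have "evals P ?env [EVar 1, ECall g [ENode (ENode (EVar 4) (EVar 0)) (EVar 3)], EVar 4]
        [enc_list ea (drop (Suc i) (l x)), es ?r', E x]
        (Suc 0 + (Suc (Suc (Suc (Suc 0 + Suc 0) + Suc 0) + t3 ?z) + (Suc 0 + 0)))"
      by (intro eval_evals.Cons eval_evals.Nil step eval_Var') simp_all
    with P(2) have "eval P ?env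
        (ECall (Suc g) [EVar 1, ECall g [ENode (ENode (EVar 4) (EVar 0)) (EVar 3)], EVar 4])
        (es (fold (f x) (l x) (s x)))
        (Suc ((Suc 0 + (Suc (Suc (Suc (Suc 0 + Suc 0) + Suc 0) + t3 ?z) + (Suc 0 + 0))) + t))"
      by (rule eval_evals.Call) (use t(2) P(4) in simp)
    moreover have "eval P [enc_list ea (drop i (l x)), es ?r, E x] (EVar 0)
        (Node (ea ?a) (enc_list ea (drop (Suc i) (l x)))) (Suc 0)"
      by (rule eval_Var') (auto simp: drop)
    ultimately have "eval P [enc_list ea (drop i (l x)), es ?r, E x] loop (es (fold (f x) (l x) (s x)))
        (Suc (Suc 0 + Suc ((Suc 0 + (Suc (Suc (Suc (Suc 0 + Suc 0) + Suc 0) + t3 ?z) + (Suc 0 + 0))) + t)))"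
      unfolding loop_def by (rule eval_evals.CaseNode[rotated])
    moreover have "Suc (Suc 0 + Suc ((Suc 0 + (Suc (Suc (Suc (Suc 0 + Suc 0) + Suc 0) + t3 ?z) + (Suc 0 + 0))) + t))
        \<le> (length (l x) - i) * (poly q (N x) + 11) + 3"
    proof -
      have "length (l x) - i = Suc (length (l x) - Suc i)"
        using i by simp
      then show ?thesis
        using t(1) q[OF z] by simp
    qed
    ultimately show ?case
      by (intro exI conjI)
  qed
  have "\<exists>t \<le> length (l x) * (poly q (N x) + 11) + 3 + t1 x + t2 x + 2.
      eval P [E x] (ECall (Suc g) [e1, e2, EVar 0]) (es (fold (f x) (l x) (s x))) t"
    if x: "x \<in> X" for x
  proof -
    obtain t where t: "t \<le> length (l x) * (poly q (N x) + 11) + 3"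
      "eval P [enc_list ea (l x), es (s x), E x] loop (es (fold (f x) (l x) (s x))) t"
      using loop[OF x, of 0] by auto
    have "evals P [E x] [e1, e2, EVar 0] [enc_list ea (l x), es (s x), E x] (t1 x + (t2 x + (Suc 0 + 0)))"
      by (intro eval_evals.Cons eval_evals.Nil eval_Var' t1(2)[OF x] t2(2)[OF x]) simp_all
    with P(2) have "eval P [E x] (ECall (Suc g) [e1, e2, EVar 0]) (es (fold (f x) (l x) (s x)))
        (Suc (t1 x + (t2 x + (Suc 0 + 0)) + t))"
      by (rule eval_evals.Call) (use t(2) P(4) in simp)
    then show ?thesis
      using t(1) by (intro exI[of _ "Suc (t1 x + (t2 x + (Suc 0 + 0)) + t)"]) auto
  qed
  then obtain t where t: "\<And>x. x \<in> X \<Longrightarrow> t x \<le> length (l x) * (poly q (N x) + 11) + 3 + t1 x + t2 x + 2"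
    "\<And>x. x \<in> X \<Longrightarrow> eval P [E x] (ECall (Suc g) [e1, e2, EVar 0]) (es (fold (f x) (l x) (s x))) (t x)"
    by metis
  have "pbounded X N (\<lambda>x. length (l x) * (poly q (N x) + 11) + 3 + t1 x + t2 x + 2)"
    by (intro pbounded_intros len t1 t2)
  then have "pbounded X N t"
    using t(1) by (rule pbounded_le)
  with t(2) show ?thesis
    unfolding ptime_def runs_def by blast
qed

lemma ptime_weaken_snd:
  "ptime Z (\<lambda>z. N (fst z)) (with_input (with_input E ea) eb) (\<lambda>z. ea (snd (fst z)))"
  by (rule ptime_weaken[OF ptime_snd]) (rule UNIV_I)

lemma ptime_weaken2:
  assumes "ptime X N E F" "\<And>z. z \<in> Z \<Longrightarrow> fst (fst z) \<in> X"
  shows "ptime Z (\<lambda>z. N (fst (fst z))) (with_input (with_input E ea) eb) (\<lambda>z. F (fst (fst z)))"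
  by (rule ptime_weaken[OF ptime_weaken[OF assms(1), where Z = "{z. fst z \<in> X}"]])
    (use assms(2) in auto)

lemma pbounded_fst2:
  assumes "pbounded X N g" "\<And>z. z \<in> Z \<Longrightarrow> fst (fst z) \<in> X"
  shows "pbounded Z (\<lambda>z. N (fst (fst z))) (\<lambda>z. g (fst (fst z)))"
  using assms unfolding pbounded_def by blast

section \<open>Computing with encoded truth values, lists and unary numbers\<close>

lemma ptime_Cons:
  "ptime X N E (\<lambda>x. ea (a x)) \<Longrightarrow> ptime X N E (\<lambda>x. enc_list ea (l x)) \<Longrightarrow>
    ptime X N E (\<lambda>x. enc_list ea (a x # l x))"
  by (simp add: ptime_Node)

lemma ptime_Some:
  "ptime X N E (\<lambda>x. ea (a x)) \<Longrightarrow> ptime X N E (\<lambda>x. enc_option ea (Some (a x)))"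
  by (simp add: ptime_Node ptime_Leaf)

lemma ptime_if:
  assumes "ptime X N E (\<lambda>x. enc_bool (b x))"
    and "ptime {x \<in> X. b x} N E (\<lambda>x. ea (f x))" "ptime {x \<in> X. \<not> b x} N E (\<lambda>x. ea (g x))"
  shows "ptime X N E (\<lambda>x. ea (if b x then f x else g x))"
proof (rule ptime_if_Leaf[OF assms(1)])
  have eq: "enc_bool c = Leaf \<longleftrightarrow> \<not> c" for c
    by (cases c) auto
  show "ptime {x \<in> X. enc_bool (b x) = Leaf} N E (\<lambda>x. ea (if b x then f x else g x))"
    unfolding eq by (rule ptime_cong[OF assms(3)]) simp
  show "ptime {x \<in> X. enc_bool (b x) \<noteq> Leaf} N E (\<lambda>x. ea (if b x then f x else g x))"
    unfolding eq not_not by (rule ptime_cong[OF assms(2)]) simp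
qed

lemma ptime_conj:
  assumes "ptime X N E (\<lambda>x. enc_bool (b x))" "ptime X N E (\<lambda>x. enc_bool (c x))"
  shows "ptime X N E (\<lambda>x. enc_bool (b x \<and> c x))"
proof -
  have "ptime X N E (\<lambda>x. enc_bool (if b x then c x else False))"
    by (rule ptime_if[OF assms(1)]) (use assms(2) in \<open>auto intro: ptime_mono ptime_const\<close>)
  then show ?thesis
    by (rule ptime_cong) simp
qed

lemma ptime_not:
  assumes "ptime X N E (\<lambda>x. enc_bool (b x))"
  shows "ptime X N E (\<lambda>x. enc_bool (\<not> b x))"
proof -
  have "ptime X N E (\<lambda>x. enc_bool (if b x then False else True))"
    by (rule ptime_if[OF assms(1)]) (rule ptime_const)+
  then show ?thesis
    by (rule ptime_cong) simp
qed

lemma ptime_null: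
  assumes "ptime X N E (\<lambda>x. enc_list ea (l x))"
  shows "ptime X N E (\<lambda>x. enc_bool (l x = []))"
proof (rule ptime_if_Leaf[OF assms])
  have eq: "enc_list ea l = Leaf \<longleftrightarrow> l = []" for l
    by (cases l) auto
  show "ptime {x \<in> X. enc_list ea (l x) = Leaf} N E (\<lambda>x. enc_bool (l x = []))"
    "ptime {x \<in> X. enc_list ea (l x) \<noteq> Leaf} N E (\<lambda>x. enc_bool (l x = []))"
    unfolding eq by (rule ptime_cong[OF ptime_const], force)+
qed

lemma fold_Cons_map: "fold (\<lambda>a s. f a # s) xs s = rev (map f xs) @ s"
  by (induction xs arbitrary: s) auto

lemma fold_Cons_filter: "fold (\<lambda>a s. if p a then a # s else s) xs s = rev (filter p xs) @ s"
  by (induction xs arbitrary: s) auto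

lemma ptime_fold_Cons:
  assumes "ptime X N E (\<lambda>x. enc_list ea (l x))" "ptime X N E (\<lambda>x. enc_list ea (r x))"
    and "pbounded X N (\<lambda>x. length (l x))"
  shows "ptime X N E (\<lambda>x. enc_list ea (rev (l x) @ r x))"
proof -
  have "ptime X N E (\<lambda>x. enc_list ea (fold (\<lambda>a s. a # s) (l x) (r x)))"
    by (rule ptime_fold[OF assms(1) _ assms(3)], rule assms(2))
      (intro ptime_Cons ptime_weaken_snd ptime_snd)
  then show ?thesis
    by (simp add: fold_Cons_map)
qed

lemma ptime_rev:
  assumes "ptime X N E (\<lambda>x. enc_list ea (l x))" "pbounded X N (\<lambda>x. length (l x))"
  shows "ptime X N E (\<lambda>x. enc_list ea (rev (l x)))"
  using ptime_fold_Cons[OF assms(1) ptime_const[of X N E "enc_list ea []"] assms(2)] by simp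

lemma ptime_append:
  assumes "ptime X N E (\<lambda>x. enc_list ea (l x))" "ptime X N E (\<lambda>x. enc_list ea (r x))"
    and "pbounded X N (\<lambda>x. length (l x))"
  shows "ptime X N E (\<lambda>x. enc_list ea (l x @ r x))"
  using ptime_fold_Cons[OF ptime_rev[OF assms(1,3)] assms(2)] assms(3) by simp

lemma ptime_map:
  assumes "ptime X N E (\<lambda>x. enc_list ea (l x))" "pbounded X N (\<lambda>x. length (l x))"
    and h: "ptime {(x, a). x \<in> X \<and> a \<in> set (l x)} (\<lambda>z. N (fst z)) (with_input E ea)
      (\<lambda>z. eb (h (fst z) (snd z)))"
  shows "ptime X N E (\<lambda>x. enc_list eb (map (h x) (l x)))"
proof -
  have "ptime X N E (\<lambda>x. enc_list eb (fold (\<lambda>a s. h x a # s) (l x) []))"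
  proof (rule ptime_fold[OF assms(1) ptime_const assms(2)])
    show "ptime {((x, a), r). x \<in> X \<and>
        (\<exists>i<length (l x). a = l x ! i \<and> r = fold (\<lambda>a. (#) (h x a)) (take i (l x)) [])}
      (\<lambda>z. N (fst (fst z))) (with_input (with_input E ea) (enc_list eb))
      (\<lambda>z. enc_list eb (h (fst (fst z)) (snd (fst z)) # snd z))"
      by (intro ptime_Cons ptime_snd ptime_weaken[OF h]) auto
  qed
  then have "ptime X N E (\<lambda>x. enc_list eb (rev (map (h x) (l x))))"
    by (simp add: fold_Cons_map)
  from ptime_rev[OF this] assms(2) show ?thesis
    by simp
qed

lemma ptime_filter:
  assumes "ptime X N E (\<lambda>x. enc_list ea (l x))" "pbounded X N (\<lambda>x. length (l x))"
    and p: "ptime {(x, a). x \<in> X \<and> a \<in> set (l x)} (\<lambda>z. N (fst z)) (with_input E ea)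
      (\<lambda>z. enc_bool (p (fst z) (snd z)))"
  shows "ptime X N E (\<lambda>x. enc_list ea (filter (p x) (l x)))"
proof -
  have "ptime X N E (\<lambda>x. enc_list ea (fold (\<lambda>a s. if p x a then a # s else s) (l x) []))"
  proof (rule ptime_fold[OF assms(1) ptime_const assms(2)])
    show "ptime {((x, a), r). x \<in> X \<and> (\<exists>i<length (l x). a = l x ! i \<and>
        r = fold (\<lambda>a s. if p x a then a # s else s) (take i (l x)) [])}
      (\<lambda>z. N (fst (fst z))) (with_input (with_input E ea) (enc_list ea))
      (\<lambda>z. enc_list ea (if p (fst (fst z)) (snd (fst z)) then snd (fst z) # snd z else snd z))"
      by (intro ptime_if ptime_Cons ptime_snd ptime_weaken_snd ptime_weaken[OF p]) auto
  qed
  then have "ptime X N E (\<lambda>x. enc_list ea (rev (filter (p x) (l x))))"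
    by (simp add: fold_Cons_filter)
  from ptime_rev[OF this] pbounded_le[OF assms(2)] show ?thesis
    by simp
qed

lemma
  assumes "ptime X N E (\<lambda>x. enc_list ea (l x))" "pbounded X N (\<lambda>x. length (l x))"
    and p: "ptime {(x, a). x \<in> X \<and> a \<in> set (l x)} (\<lambda>z. N (fst z)) (with_input E ea)
      (\<lambda>z. enc_bool (p (fst z) (snd z)))"
  shows ptime_Bex: "ptime X N E (\<lambda>x. enc_bool (\<exists>a\<in>set (l x). p x a))"
    and ptime_Ball: "ptime X N E (\<lambda>x. enc_bool (\<forall>a\<in>set (l x). p x a))"
proof -
  have "ptime X N E (\<lambda>x. enc_bool (\<not> filter (p x) (l x) = []))"
    by (intro ptime_not ptime_null[where ea = ea] ptime_filter assms)
  then show "ptime X N E (\<lambda>x. enc_bool (\<exists>a\<in>set (l x). p x a))"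
    by (rule ptime_cong) (simp add: filter_empty_conv)
  have "ptime X N E (\<lambda>x. enc_bool (filter (\<lambda>a. \<not> p x a) (l x) = []))"
    by (intro ptime_not ptime_null[where ea = ea] ptime_filter assms)
  then show "ptime X N E (\<lambda>x. enc_bool (\<forall>a\<in>set (l x). p x a))"
    by (rule ptime_cong) (simp add: filter_empty_conv)
qed

lemma pbounded_length_concat:
  assumes "pbounded X N (\<lambda>x. length (l x))"
    and "pbounded {(x, ys). x \<in> X \<and> ys \<in> set (l x)} (\<lambda>z. N (fst z)) (\<lambda>z. length (snd z))"
  shows "pbounded X N (\<lambda>x. length (concat (l x)))"
proof -
  obtain q where q: "\<And>x ys. x \<in> X \<Longrightarrow> ys \<in> set (l x) \<Longrightarrow> length ys \<le> poly q (N x)"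
    using assms(2) unfolding pbounded_def by force
  have "pbounded X N (\<lambda>x. length (l x) * poly q (N x))"
    by (intro pbounded_intros assms)
  then show ?thesis
  proof (rule pbounded_le)
    fix x assume "x \<in> X"
    then have "sum_list (map length (l x)) \<le> sum_list (map (\<lambda>_. poly q (N x)) (l x))"
      using q by (intro sum_list_mono)
    then show "length (concat (l x)) \<le> length (l x) * poly q (N x)"
      by (simp add: length_concat sum_list_triv)
  qed
qed

lemma ptime_concat:
  assumes "ptime X N E (\<lambda>x. enc_list (enc_list ea) (l x))" "pbounded X N (\<lambda>x. length (l x))"
    and len: "pbounded {(x, ys). x \<in> X \<and> ys \<in> set (l x)} (\<lambda>z. N (fst z)) (\<lambda>z. length (snd z))"
  shows "ptime X N E (\<lambda>x. enc_list ea (concat (l x)))"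
proof -
  have "ptime X N E (\<lambda>x. enc_list ea (fold (\<lambda>ys s. rev ys @ s) (l x) []))"
  proof (rule ptime_fold[OF assms(1) ptime_const assms(2)])
    let ?Z = "{((x, a), r). x \<in> X \<and> (\<exists>i<length (l x). a = l x ! i \<and>
        r = fold (\<lambda>ys. (@) (rev ys)) (take i (l x)) [])}"
    have "pbounded ?Z (\<lambda>z. N (fst (fst z))) (\<lambda>z. length (snd (fst z)))"
      by (rule pbounded_fst[OF len]) auto
    then show "ptime ?Z
      (\<lambda>z. N (fst (fst z))) (with_input (with_input E (enc_list ea)) (enc_list ea))
      (\<lambda>z. enc_list ea (rev (snd (fst z)) @ snd z))"
      by (intro ptime_fold_Cons ptime_snd ptime_weaken_snd)
  qed
  moreover have "fold (\<lambda>ys s. rev ys @ s) xss s = rev (concat xss) @ s" for xss and s :: "'b list"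
    by (induction xss arbitrary: s) auto
  ultimately have "ptime X N E (\<lambda>x. enc_list ea (rev (concat (l x))))"
    by simp
  from ptime_rev[OF this] pbounded_length_concat[OF assms(2,3)] show ?thesis
    by simp
qed

lemma pbounded_length_concat_map:
  assumes "pbounded X N (\<lambda>x. length (l x))"
    and "pbounded {(x, a). x \<in> X \<and> a \<in> set (l x)} (\<lambda>z. N (fst z)) (\<lambda>z. length (h (fst z) (snd z)))"
  shows "pbounded X N (\<lambda>x. length (concat (map (h x) (l x))))"
  by (rule pbounded_length_concat) (use assms in \<open>auto simp: pbounded_def\<close>)

lemma ptime_concat_map:
  assumes "ptime X N E (\<lambda>x. enc_list ea (l x))" "pbounded X N (\<lambda>x. length (l x))"
    and "ptime {(x, a). x \<in> X \<and> a \<in> set (l x)} (\<lambda>z. N (fst z)) (with_input E ea)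
      (\<lambda>z. enc_list eb (h (fst z) (snd z)))"
    and "pbounded {(x, a). x \<in> X \<and> a \<in> set (l x)} (\<lambda>z. N (fst z)) (\<lambda>z. length (h (fst z) (snd z)))"
  shows "ptime X N E (\<lambda>x. enc_list eb (concat (map (h x) (l x))))"
  by (rule ptime_concat, rule ptime_map) (use assms in \<open>auto simp: pbounded_def\<close>)

text \<open>A unary number is a list of units, so the list operations provide arithmetic and a fold
  over it is bounded iteration.\<close>

lemma enc_nat_conv: "enc_nat n = enc_list (\<lambda>_. Leaf) (replicate n ())"
  by (induction n) auto

lemma ptime_Suc: "ptime X N E (\<lambda>x. enc_nat (n x)) \<Longrightarrow> ptime X N E (\<lambda>x. enc_nat (Suc (n x)))"
  by (simp add: ptime_Node ptime_Leaf)

lemma ptime_add: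
  assumes "ptime X N E (\<lambda>x. enc_nat (m x))" "ptime X N E (\<lambda>x. enc_nat (n x))" "pbounded X N m"
  shows "ptime X N E (\<lambda>x. enc_nat (m x + n x))"
  using assms unfolding enc_nat_conv replicate_add by (intro ptime_append) simp_all

lemma ptime_mult:
  assumes m: "ptime X N E (\<lambda>x. enc_nat (m x))" "pbounded X N m"
    and n: "ptime X N E (\<lambda>x. enc_nat (n x))" "pbounded X N n"
  shows "ptime X N E (\<lambda>x. enc_nat (m x * n x))"
proof -
  have "fold (\<lambda>_ s. b + s) (replicate a ()) s = a * b + s" for a b s :: nat
    by (induction a arbitrary: s) auto
  moreover have "ptime X N E (\<lambda>x. enc_nat (fold (\<lambda>_ s. n x + s) (replicate (m x) ()) 0))"
  proof (rule ptime_fold[where ea = "\<lambda>_. Leaf"])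
    show "ptime {((x, a), r). x \<in> X \<and> (\<exists>i<length (replicate (m x) ()).
        a = replicate (m x) () ! i \<and> r = fold (\<lambda>_. (+) (n x)) (take i (replicate (m x) ())) 0)}
      (\<lambda>z. N (fst (fst z))) (with_input (with_input E (\<lambda>_. Leaf)) enc_nat)
      (\<lambda>z. enc_nat (n (fst (fst z)) + snd z))"
      by (rule ptime_add[OF ptime_weaken2[OF n(1)] ptime_snd pbounded_fst2[OF n(2)]]) auto
  qed (use m in \<open>auto simp: enc_nat_conv ptime_Leaf\<close>)
  ultimately show ?thesis
    by simp
qed

lemma ptime_length:
  assumes "ptime X N E (\<lambda>x. enc_list ea (l x))" "pbounded X N (\<lambda>x. length (l x))"
  shows "ptime X N E (\<lambda>x. enc_nat (length (l x)))"
  using ptime_map[OF assms, where h = "\<lambda>_ _. ()" and eb = "\<lambda>_. Leaf", OF ptime_Leaf]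
  unfolding enc_nat_conv by (simp add: map_replicate_const)

text \<open>The accumulator is its own counter: its length is the next number to be pushed, which
  produces the list in reverse.\<close>

lemma ptime_upt:
  assumes "ptime X N E (\<lambda>x. enc_nat (n x))" "pbounded X N n"
  shows "ptime X N E (\<lambda>x. enc_list enc_nat [0..<n x])"
proof -
  have fold: "((\<lambda>s. length s # s) ^^ a) [] = rev [0..<a]" for a
    by (induction a) auto
  have "ptime X N E (\<lambda>x. enc_list enc_nat (fold (\<lambda>_ s. length s # s) (replicate (n x) ()) []))"
  proof (rule ptime_fold[where ea = "\<lambda>_. Leaf"])
    let ?Z = "{((x, a), r). x \<in> X \<and> (\<exists>i<length (replicate (n x) ()).
        a = replicate (n x) () ! i \<and>
        r = fold (\<lambda>_ s. length s # s) (take i (replicate (n x) ())) [])}"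
    have "pbounded ?Z (\<lambda>z. N (fst (fst z))) (\<lambda>z. n (fst (fst z)))"
      by (intro pbounded_fst2[OF assms(2)]) auto
    then have "pbounded ?Z (\<lambda>z. N (fst (fst z))) (\<lambda>z. length (snd z))"
      by (rule pbounded_le) (auto simp: fold)
    then show "ptime ?Z (\<lambda>z. N (fst (fst z)))
        (with_input (with_input E (\<lambda>_. Leaf)) (enc_list enc_nat))
        (\<lambda>z. enc_list enc_nat (length (snd z) # snd z))"
      by (intro ptime_Cons ptime_length[where ea = enc_nat] ptime_snd)
  qed (use assms ptime_const[of X N E "enc_list enc_nat []"] in \<open>auto simp: enc_nat_conv\<close>)
  then have "ptime X N E (\<lambda>x. enc_list enc_nat (rev [0..<n x]))"
    by (simp add: fold)
  from ptime_rev[OF this] assms(2) show ?thesis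
    by simp
qed

lemma ptime_nth:
  assumes "ptime X N E (\<lambda>x. enc_list ea (l x))"
    and i: "ptime X N E (\<lambda>x. enc_nat (i x))" "pbounded X N i"
    and less: "\<And>x. x \<in> X \<Longrightarrow> i x < length (l x)"
  shows "ptime X N E (\<lambda>x. ea (l x ! i x))"
proof -
  have tl: "enc_list ea (tl l) = right (enc_list ea l)" for l
    by (cases l) auto
  have fold: "fold (\<lambda>_. tl) (replicate n ()) l = drop n l" for n and l :: "'b list"
    by (induction n arbitrary: l) (auto simp: drop_Suc)
  have "ptime X N E (\<lambda>x. enc_list ea (fold (\<lambda>_. tl) (replicate (i x) ()) (l x)))"
  proof (rule ptime_fold[where ea = "\<lambda>_. Leaf"])
    show "ptime {((x, a), r). x \<in> X \<and> (\<exists>j<length (replicate (i x) ()).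
        a = replicate (i x) () ! j \<and> r = fold (\<lambda>_. tl) (take j (replicate (i x) ())) (l x))}
      (\<lambda>z. N (fst (fst z))) (with_input (with_input E (\<lambda>_. Leaf)) (enc_list ea))
      (\<lambda>z. enc_list ea (tl (snd z)))"
      unfolding tl by (intro ptime_right ptime_snd)
  qed (use assms in \<open>auto simp: enc_nat_conv\<close>)
  from ptime_left[OF this] show ?thesis
  proof (rule ptime_cong)
    fix x assume "x \<in> X"
    then show "left (enc_list ea (fold (\<lambda>_. tl) (replicate (i x) ()) (l x))) = ea (l x ! i x)"
      using less[of x] unfolding fold by (simp flip: Cons_nth_drop_Suc)
  qed
qed

lemma ptime_n_lists:
  assumes "ptime X N E (\<lambda>x. enc_list ea (l x))" "pbounded X N (\<lambda>x. length (l x))"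
  shows "ptime X N E (\<lambda>x. enc_list (enc_list ea) (List.n_lists d (l x)))"
proof (induction d)
  case 0
  then show ?case
    using ptime_const[of X N E "enc_list (enc_list ea) [[]]"] by simp
next
  case (Suc d)
  let ?l = "\<lambda>x. List.n_lists d (l x)"
  have len: "pbounded X N (\<lambda>x. length (?l x))"
    using pbounded_power[OF assms(2)] by (simp add: length_n_lists)
  let ?Z = "{(x, ys). x \<in> X \<and> ys \<in> set (?l x)}"
  have l: "ptime ?Z (\<lambda>z. N (fst z)) (with_input E (enc_list ea)) (\<lambda>z. enc_list ea (l (fst z)))"
    by (rule ptime_weaken[OF assms(1)]) auto
  have len': "pbounded ?Z (\<lambda>z. N (fst z)) (\<lambda>z. length (l (fst z)))"
    by (rule pbounded_fst[OF assms(2)]) auto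
  have "ptime ?Z (\<lambda>z. N (fst z)) (with_input E (enc_list ea))
      (\<lambda>z. enc_list (enc_list ea) (map (\<lambda>y. y # snd z) (l (fst z))))"
    by (rule ptime_map[OF l len']) (intro ptime_Cons ptime_snd ptime_weaken_snd)
  with Suc len show ?case
    unfolding n_lists.simps by (rule ptime_concat_map) (use len' in simp)
qed

lemma ptime_poly:
  assumes "ptime X N E (\<lambda>x. enc_nat (n x))" "pbounded X N n"
  shows "ptime X N E (\<lambda>x. enc_nat (poly q (n x)))"
proof -
  have "ptime X N E (\<lambda>x. enc_nat (poly q (n x))) \<and> pbounded X N (\<lambda>x. poly q (n x))"
  proof (induction q)
    case 0
    then show ?case
      by (simp add: ptime_Leaf pbounded_const)
  next
    case (pCons a q)
    then show ?case
      using assms by (auto intro!: ptime_add ptime_mult ptime_const pbounded_intros)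
  qed
  then show ?thesis ..
qed

section \<open>Arbitrary functions on a finite set of values\<close>

fun height :: "tree \<Rightarrow> nat" where
  "height Leaf = 0" | "height (Node a b) = Suc (max (height a) (height b))"

text \<open>Trees of bounded height are inspected completely by nested case distinctions: first the
  left subtree, then, for each of its values, the right one. On every final branch the inspected
  value is constant. The induction varies \<open>X\<close> because the second inspection runs on the
  indices with a given left subtree.\<close>

lemma ptime_cases_bounded:
  assumes "\<And>x. x \<in> X \<Longrightarrow> height (F x) \<le> d" "ptime X N E F"
    and "\<And>v. ptime {x \<in> X. F x = v} N E G"
  shows "ptime X N E G"
  using assms
proof (induction d arbitrary: X F)
  case 0
  have "F x = Leaf" if "x \<in> X" for x
    using "0.prems"(1)[OF that] by (cases "F x") auto
  then have "{x \<in> X. F x = Leaf} = X" by auto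
  then show ?case
    using "0.prems"(3)[of Leaf] by simp
next
  case (Suc d)
  show ?case
  proof (rule ptime_if_Leaf[OF Suc.prems(2) Suc.prems(3)])
    let ?Y = "{x \<in> X. F x \<noteq> Leaf}"
    have F: "ptime Y N E F" if "Y \<subseteq> X" for Y
      using Suc.prems(2) that by (rule ptime_mono)
    have d: "height (left (F x)) \<le> d" "height (right (F x)) \<le> d" if "x \<in> X" for x
      using Suc.prems(1)[OF that] by (cases "F x"; simp)+
    show "ptime ?Y N E G"
    proof (rule Suc.IH[where F = "\<lambda>x. left (F x)"])
      fix a
      show "ptime {x \<in> ?Y. left (F x) = a} N E G"
      proof (rule Suc.IH[where F = "\<lambda>x. right (F x)"])
        fix b
        have "{x \<in> {x \<in> ?Y. left (F x) = a}. right (F x) = b} = {x \<in> X. F x = Node a b}"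
        proof (intro set_eqI iffI)
          fix x assume "x \<in> {x \<in> {x \<in> ?Y. left (F x) = a}. right (F x) = b}"
          then show "x \<in> {x \<in> X. F x = Node a b}"
            by (cases "F x") auto
        qed auto
        then show "ptime {x \<in> {x \<in> ?Y. left (F x) = a}. right (F x) = b} N E G"
          using Suc.prems(3)[of "Node a b"] by simp
      qed (use d in \<open>auto intro: ptime_right F\<close>)
    qed (use d in \<open>auto intro: ptime_left F\<close>)
  qed
qed

text \<open>The values of \<open>g\<close> on the fixed finite set \<open>A\<close> become constants
  of the program, so \<open>g\<close> may be arbitrary. In this way \<open>f\<close> and the edges
  of \<open>H\<close> enter the algorithm.\<close>

lemma ptime_finite:
  assumes "ptime X N E (\<lambda>x. ea (v x))" "\<And>x. x \<in> X \<Longrightarrow> v x \<in> A" "finite A" "inj_on ea A"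
  shows "ptime X N E (\<lambda>x. g (v x))"
proof (rule ptime_cases_bounded[OF _ assms(1)])
  show "height (ea (v x)) \<le> Max (height ` ea ` A)" if "x \<in> X" for x
    using that assms(2,3) by (intro Max_ge) auto
  \<comment> \<open>On this branch \<open>v x\<close> is the unique element of \<open>A\<close>
    encoded by \<open>t\<close>, so a constant is returned.\<close>
  show "ptime {x \<in> X. ea (v x) = t} N E (\<lambda>x. g (v x))" for t
    by (rule ptime_cong[OF ptime_const[of _ _ _ "g (inv_into A ea t)"]])
      (use assms(2,4) in \<open>auto simp: inv_into_f_f\<close>)
qed

section \<open>Binary constraints preserved by a near-unanimity operation\<close>

text \<open>\<open>None\<close> marks an edge constraint. \<open>Some (Some a)\<close> fixes a value
  and \<open>Some None\<close> is void; thus \<open>Some (p v)\<close> expresses a precolouring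
  directly, and one constraint can be written for every vertex and every pair of vertices without
  selecting the coloured vertices or the edges first.\<close>

fun satisfies :: "('b \<times> 'b) set \<Rightarrow> 'b list \<Rightarrow> nat \<times> nat \<times> 'b option option \<Rightarrow> bool" where
  "satisfies A t (i, j, None) \<longleftrightarrow> (t ! i, t ! j) \<in> A"
| "satisfies A t (i, j, Some None) \<longleftrightarrow> True"
| "satisfies A t (i, j, Some (Some a)) \<longleftrightarrow> t ! i = a"

text \<open>The near-unanimity law names the exceptional position \<open>j\<close> instead of
  counting equal entries: in the Baker-Pixley step \<open>j\<close> is the one vector that may err
  at a given coordinate. With all entries equal any \<open>j\<close> serves, so \<open>f\<close> is
  idempotent.\<close>

locale nu_polymorphism =
  fixes V :: "'b set" and A :: "('b \<times> 'b) set" and k :: nat and f :: "'b list \<Rightarrow> 'b"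
  assumes finite_V: "finite V"
    and k: "k \<ge> 3"
    and f_in: "length xs = k \<Longrightarrow> set xs \<subseteq> V \<Longrightarrow> f xs \<in> V"
    and near_unanimous: "length xs = k \<Longrightarrow> set xs \<subseteq> V \<Longrightarrow> x \<in> V \<Longrightarrow> j < k \<Longrightarrow>
      (\<And>i. i < k \<Longrightarrow> i \<noteq> j \<Longrightarrow> xs ! i = x) \<Longrightarrow> f xs = x"
    and preserves: "length xs = k \<Longrightarrow> set xs \<subseteq> V \<Longrightarrow> length ys = k \<Longrightarrow> set ys \<subseteq> V \<Longrightarrow>
      (\<And>i. i < k \<Longrightarrow> (xs ! i, ys ! i) \<in> A) \<Longrightarrow> (f xs, f ys) \<in> A"
begin

definition vecs :: "nat \<Rightarrow> 'b list set" where
  "vecs m = {t. length t = m \<and> set t \<subseteq> V}"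

lemma vecs_nth: "t \<in> vecs m \<Longrightarrow> i < m \<Longrightarrow> t ! i \<in> V"
  unfolding vecs_def by auto

definition pointwise :: "nat \<Rightarrow> 'b list list \<Rightarrow> 'b list" where
  "pointwise m ts = map (\<lambda>i. f (map (\<lambda>t. t ! i) ts)) [0..<m]"

definition closed :: "nat \<Rightarrow> 'b list set \<Rightarrow> bool" where
  "closed m R \<longleftrightarrow> R \<subseteq> vecs m \<and> (\<forall>ts. length ts = k \<and> set ts \<subseteq> R \<longrightarrow> pointwise m ts \<in> R)"

text \<open>Sets of at most \<open>d\<close> coordinates, rather than exactly \<open>d\<close>,
  cover the case \<open>m < d\<close> as well; and the empty set of coordinates forces
  \<open>T\<close> to be nonempty whenever \<open>R\<close> is.\<close>

definition represents :: "nat \<Rightarrow> nat \<Rightarrow> 'b list set \<Rightarrow> 'b list set \<Rightarrow> bool" where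
  "represents d m T R \<longleftrightarrow> T \<subseteq> R \<and>
     (\<forall>r\<in>R. \<forall>S\<subseteq>{..<m}. card S \<le> d \<longrightarrow> (\<exists>t\<in>T. \<forall>i\<in>S. t ! i = r ! i))"

lemma represents_mono:
  "represents d m T R \<Longrightarrow> T \<subseteq> T' \<Longrightarrow> T' \<subseteq> R \<Longrightarrow> represents d m T' R"
  unfolding represents_def by (meson subsetD)

lemma represents_nonempty:
  assumes "represents d m T R" "R \<noteq> {}"
  shows "T \<noteq> {}"
proof -
  obtain r where "r \<in> R"
    using assms(2) by blast
  then have "\<exists>t\<in>T. \<forall>i\<in>{}. t ! i = r ! i"
    using assms(1) unfolding represents_def by (metis card.empty empty_subsetI zero_le)
  then show ?thesis
    by blast
qed

lemma pointwise_nth [simp]: "i < m \<Longrightarrow> pointwise m ts ! i = f (map (\<lambda>t. t ! i) ts)"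
  unfolding pointwise_def by simp

lemma map_nth_vecs: "set ts \<subseteq> vecs m \<Longrightarrow> i < m \<Longrightarrow> set (map (\<lambda>t. t ! i) ts) \<subseteq> V"
  using vecs_nth by auto

lemma pointwise_vecs:
  assumes "length ts = k" "set ts \<subseteq> vecs m"
  shows "pointwise m ts \<in> vecs m"
proof -
  have "f (map (\<lambda>t. t ! i) ts) \<in> V" if "i < m" for i
    using assms map_nth_vecs[OF _ that] by (intro f_in) auto
  then show ?thesis
    unfolding vecs_def pointwise_def by auto
qed

text \<open>The extension step of the Baker--Pixley theorem: the \<open>k\<close> vectors that agree with \<open>r\<close> off
  one of \<open>k\<close> chosen elements of \<open>S\<close> outvote each other's errors.\<close>

lemma represents_Suc:
  assumes R: "closed m R" and T: "represents d m T R" and d: "k - 1 \<le> d"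
  shows "represents (Suc d) m (pointwise m ` {ts. length ts = k \<and> set ts \<subseteq> T}) R"
proof -
  have sub: "T \<subseteq> R" "R \<subseteq> vecs m"
    using R T unfolding represents_def closed_def by auto
  have "\<exists>ts. length ts = k \<and> set ts \<subseteq> T \<and> (\<forall>i\<in>S. pointwise m ts ! i = r ! i)"
    if r: "r \<in> R" and S: "S \<subseteq> {..<m}" "card S \<le> Suc d" for r S
  proof -
    have rV: "r ! i \<in> V" if "i \<in> S" for i
      using r S that sub(2) vecs_nth by blast
    have fin: "finite S"
      using S(1) finite_subset by blast
    have rep: "\<exists>t\<in>T. \<forall>i\<in>S'. t ! i = r ! i" if "S' \<subseteq> S" "card S' \<le> d" for S'
      using T r that S(1) unfolding represents_def by (meson order_trans)
    show ?thesis
    proof (cases "card S \<le> d")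
      case True
      then obtain t where t: "t \<in> T" "\<And>i. i \<in> S \<Longrightarrow> t ! i = r ! i"
        using rep[of S] by blast
      \<comment> \<open>The new set consists of values of \<open>f\<close> only; \<open>t\<close>
        itself is recovered on \<open>S\<close> by applying \<open>f\<close> to \<open>k\<close>
        copies of it.\<close>
      have "pointwise m (replicate k t) ! i = r ! i" if "i \<in> S" for i
      proof -
        have "f (map (\<lambda>t. t ! i) (replicate k t)) = r ! i"
          using t(2)[OF that] rV[OF that] k by (intro near_unanimous[where j = 0]) auto
        then show ?thesis
          using that S(1) by (subst pointwise_nth) auto
      qed
      then show ?thesis
        using t(1) by (intro exI[of _ "replicate k t"]) auto
    next
      case False
      then have "k \<le> card S"
        using d by simp
      then obtain S' where S': "S' \<subseteq> S" "card S' = k" "finite S'"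
        by (rule obtain_subset_with_card_n)
      then obtain js where js: "set js = S'" "distinct js" "length js = k"
        using finite_distinct_list distinct_card by metis
      have "\<exists>t\<in>T. \<forall>i\<in>S - {js ! a}. t ! i = r ! i" if "a < k" for a
      proof (rule rep)
        have "js ! a \<in> S"
          using that js S'(1) nth_mem by blast
        then show "card (S - {js ! a}) \<le> d"
          using S(2) fin by simp
      qed auto
      then obtain t where t: "\<And>a. a < k \<Longrightarrow> t a \<in> T"
        "\<And>a i. a < k \<Longrightarrow> i \<in> S \<Longrightarrow> i \<noteq> js ! a \<Longrightarrow> t a ! i = r ! i"
        by (metis Diff_iff singletonD)
      let ?ts = "map t [0..<k]"
      have ts: "set ?ts \<subseteq> T"
        using t(1) by auto
      have "pointwise m ?ts ! i = r ! i" if i: "i \<in> S" for i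
      proof -
        \<comment> \<open>Since \<open>js\<close> is distinct, at most one of the \<open>k\<close>
          vectors was allowed to differ from \<open>r\<close> at \<open>i\<close>. If
          \<open>i\<close> is not listed at all, the exceptional position 0 is arbitrary.\<close>
        obtain j where j: "j < k" "\<And>a. a < k \<Longrightarrow> a \<noteq> j \<Longrightarrow> i \<noteq> js ! a"
        proof (cases "i \<in> set js")
          case True
          then obtain j where "j < k" "js ! j = i"
            using js(3) by (auto simp: in_set_conv_nth)
          then show ?thesis
            using that js(2,3) by (auto simp: nth_eq_iff_index_eq)
        next
          case False
          then show ?thesis
            using that[of 0] js(3) k nth_mem by fastforce
        qed
        have "i < m"
          using i S(1) by auto
        then have "set (map (\<lambda>t. t ! i) ?ts) \<subseteq> V"
          using ts sub by (intro map_nth_vecs) auto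
        then have "f (map (\<lambda>t. t ! i) ?ts) = r ! i"
          using j t(2) i rV[OF i] by (intro near_unanimous[where j = j]) auto
        then show ?thesis
          using \<open>i < m\<close> by simp
      qed
      then show ?thesis
        using ts by (intro exI[of _ ?ts]) auto
    qed
  qed
  moreover have "pointwise m ts \<in> R" if "length ts = k" "set ts \<subseteq> T" for ts
    using that R sub(1) unfolding closed_def by blast
  ultimately show ?thesis
    unfolding represents_def by (auto; blast)
qed

section \<open>Projections to \<open>k - 1\<close> coordinates and pruning\<close>

definition keys :: "nat \<Rightarrow> 'b list set \<Rightarrow> (nat list \<times> 'b list) set" where
  "keys m T = {(is, map ((!) t) is) | is t. is \<in> set (List.n_lists (k - 1) [0..<m]) \<and> t \<in> T}"

lemma
  assumes "T \<subseteq> vecs m"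
  shows finite_keys: "finite (keys m T)"
    and card_keys: "card (keys m T) \<le> m ^ (k - 1) * card V ^ (k - 1)"
proof -
  let ?I = "{is. set is \<subseteq> {..<m} \<and> length is = k - 1}" and ?X = "{xs. set xs \<subseteq> V \<and> length xs = k - 1}"
  have sub: "keys m T \<subseteq> ?I \<times> ?X"
  proof
    fix y assume "y \<in> keys m T"
    then obtain js t where y: "y = (js, map ((!) t) js)" "t \<in> T"
      and "js \<in> set (List.n_lists (k - 1) [0..<m])"
      unfolding keys_def by blast
    then have js: "js \<in> ?I"
      by (auto simp: set_n_lists)
    have "t \<in> vecs m"
      using y(2) assms by blast
    then have "set (map ((!) t) js) \<subseteq> V"
      using js vecs_nth by auto
    then show "y \<in> ?I \<times> ?X"
      using js y(1) by simp
  qed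
  have fin: "finite (?I \<times> ?X)"
    using finite_V by (intro finite_cartesian_product finite_lists_length_eq) auto
  have "card (?I \<times> ?X) = m ^ (k - 1) * card V ^ (k - 1)"
    using finite_V by (simp add: card_cartesian_product card_lists_length_eq)
  then show "finite (keys m T)" "card (keys m T) \<le> m ^ (k - 1) * card V ^ (k - 1)"
    using finite_subset[OF sub fin] card_mono[OF fin sub] by auto
qed

text \<open>Keys use lists of exactly \<open>k - 1\<close> coordinates. Smaller sets are reached by
  repeating an element, which leaves the empty set to be treated separately.\<close>

lemma index_list:
  assumes "S \<subseteq> {..<m}" "card S \<le> k - 1" "S \<noteq> {}"
  obtains js where "js \<in> set (List.n_lists (k - 1) [0..<m])" "set js = S"
proof -
  have "finite S"
    using assms(1) finite_subset by blast
  then obtain xs where xs: "set xs = S" "length xs = card S"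
    using finite_distinct_list distinct_card by metis
  let ?js = "xs @ replicate (k - 1 - card S) (hd xs)"
  have "xs \<noteq> []"
    using xs assms(3) by auto
  then have "set ?js = S"
    using xs(1) hd_in_set by (auto split: if_splits)
  moreover from this have "?js \<in> set (List.n_lists (k - 1) [0..<m])"
    unfolding set_n_lists using xs(2) assms(1,2) by auto
  ultimately show ?thesis
    using that by blast
qed

text \<open>Nonemptiness of \<open>T\<close> is stated apart from the inclusion of keys: for
  \<open>m = 0\<close> there are no lists of coordinates, and \<open>keys\<close> cannot tell the
  empty set from the set containing the empty vector.\<close>

lemma represents_mono_keys:
  assumes "T \<subseteq> R" "T \<noteq> {}" "keys m R \<subseteq> keys m T"
  shows "represents (k - 1) m T R"
  unfolding represents_def
proof (intro conjI ballI allI impI assms(1))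
  fix r S assume r: "r \<in> R" and S: "S \<subseteq> {..<m}" "card S \<le> k - 1"
  show "\<exists>t\<in>T. \<forall>i\<in>S. t ! i = r ! i"
  proof (cases "S = {}")
    case True
    then show ?thesis
      using assms(2) by auto
  next
    case False
    then obtain js where js: "js \<in> set (List.n_lists (k - 1) [0..<m])" "set js = S"
      using S index_list by blast
    then have "(js, map ((!) r) js) \<in> keys m T"
      using r assms(3) unfolding keys_def by blast
    then obtain t where "t \<in> T" "map ((!) r) js = map ((!) t) js"
      unfolding keys_def by blast
    then show ?thesis
      using js(2) by (intro bexI[of _ t]) auto
  qed
qed

text \<open>The uniqueness half of the Baker-Pixley theorem. As \<open>R\<close> is itself closed,
  \<open>represents_Suc\<close> can be iterated without leaving it, until the number of controlled
  coordinates reaches \<open>m\<close>; agreement on all coordinates is equality.\<close>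

lemma closed_eq_if_keys:
  assumes R: "closed m R" and R': "closed m R'" and "R \<subseteq> R'" "R \<noteq> {}" "keys m R' \<subseteq> keys m R"
  shows "R = R'"
proof -
  have "represents (k - 1 + d) m R R'" for d
  proof (induction d)
    case 0
    then show ?case
      using represents_mono_keys assms by simp
  next
    case (Suc d)
    have "pointwise m ` {ts. length ts = k \<and> set ts \<subseteq> R} \<subseteq> R"
      using R unfolding closed_def by auto
    with represents_Suc[OF R' Suc.IH le_add1] have "represents (Suc (k - 1 + d)) m R R'"
      using \<open>R \<subseteq> R'\<close> by (rule represents_mono)
    then show ?case
      by (simp only: add_Suc_right)
  qed
  then have *: "represents (k - 1 + m) m R R'" .
  have "r \<in> R" if r: "r \<in> R'" for r
  proof -
    have "card {..<m} \<le> k - 1 + m"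
      by simp
    then obtain t where "t \<in> R" "\<forall>i\<in>{..<m}. t ! i = r ! i"
      using * r unfolding represents_def by blast
    moreover have "length t = m" "length r = m"
      using r \<open>t \<in> R\<close> R R' unfolding closed_def vecs_def by auto
    ultimately show ?thesis
      by (metis lessThan_iff nth_equalityI)
  qed
  with \<open>R \<subseteq> R'\<close> show ?thesis by auto
qed

text \<open>Every vector is fresh for the empty list. Otherwise, for \<open>m = 0\<close>, where no
  coordinate lists exist, pruning would turn a nonempty list into the empty one and report an
  unsolvable problem; this occurs for the graph without vertices.\<close>

definition fresh :: "nat \<Rightarrow> 'b list list \<Rightarrow> 'b list \<Rightarrow> bool" where
  "fresh m T t \<longleftrightarrow> \<not> (T \<noteq> [] \<and> (\<forall>is\<in>set (List.n_lists (k - 1) [0..<m]).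
     \<exists>t'\<in>set T. map ((!) t') is = map ((!) t) is))"

definition prune :: "nat \<Rightarrow> 'b list list \<Rightarrow> 'b list list" where
  "prune m U = fold (\<lambda>t T. if fresh m T t then t # T else T) U []"

lemma prune_subset: "set (prune m U) \<subseteq> set U"
proof -
  have "set (fold (\<lambda>t T. if fresh m T t then t # T else T) U T) \<subseteq> set U \<union> set T" for T
  proof (induction U arbitrary: T)
    case (Cons t U)
    show ?case
      using Cons.IH[of T] Cons.IH[of "t # T"] by auto
  qed simp
  from this[of "[]"] show ?thesis
    unfolding prune_def by simp
qed

text \<open>A vector is dropped only when all its projections are already realised by the
  accumulator, and the accumulator never loses elements.\<close>

lemma keys_prune: "keys m (set U) \<subseteq> keys m (set (prune m U))"
  and prune_Nil: "prune m U = [] \<longleftrightarrow> U = []"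
proof -
  let ?p = "\<lambda>U T. fold (\<lambda>t T. if fresh m T t then t # T else T) U T"
  have mono: "set T \<subseteq> set (?p U T)" for U T
  proof (induction U arbitrary: T)
    case (Cons t U)
    show ?case
      using Cons.IH[of T] Cons.IH[of "t # T"] by auto
  qed simp
  have "keys m (set U) \<subseteq> keys m (set (?p U T))" for T
  proof (induction U arbitrary: T)
    case (Cons t U)
    let ?T = "if fresh m T t then t # T else T"
    have "keys m {t} \<subseteq> keys m (set ?T)"
    proof
      fix y assume "y \<in> keys m {t}"
      then obtain js where js: "y = (js, map ((!) t) js)" "js \<in> set (List.n_lists (k - 1) [0..<m])"
        unfolding keys_def by blast
      have "\<exists>t'\<in>set ?T. map ((!) t') js = map ((!) t) js"
        using js(2) unfolding fresh_def by auto
      then obtain t' where "t' \<in> set ?T" "y = (js, map ((!) t') js)"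
        using js(1) by auto
      then show "y \<in> keys m (set ?T)"
        using js(2) unfolding keys_def by blast
    qed
    also have "\<dots> \<subseteq> keys m (set (?p U ?T))"
      using mono unfolding keys_def by blast
    finally have "keys m {t} \<subseteq> keys m (set (?p U ?T))" .
    moreover have "keys m (set (t # U)) = keys m {t} \<union> keys m (set U)"
      unfolding keys_def by auto
    ultimately show ?case
      using Cons.IH[of ?T] by simp
  qed (simp add: keys_def)
  then show "keys m (set U) \<subseteq> keys m (set (prune m U))"
    unfolding prune_def .
  show "prune m U = [] \<longleftrightarrow> U = []"
    using mono[of "[hd U]" "tl U"] by (cases U) (auto simp: prune_def fresh_def)
qed

lemma represents_prune:
  assumes "represents (k - 1) m (set U) R"
  shows "represents (k - 1) m (set (prune m U)) R"
proof (cases "R = {}")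
  case True
  then show ?thesis
    using assms prune_subset[of m U] by (auto simp: represents_def)
next
  case False
  with assms have "set U \<noteq> {}"
    by (rule represents_nonempty)
  moreover have "keys m R \<subseteq> keys m (set U)"
  proof
    fix y assume "y \<in> keys m R"
    then obtain js r where y: "y = (js, map ((!) r) js)" "r \<in> R"
      and js: "js \<in> set (List.n_lists (k - 1) [0..<m])"
      unfolding keys_def by blast
    have "set js \<subseteq> {..<m}" "card (set js) \<le> k - 1"
      using js card_length[of js] by (auto simp: set_n_lists)
    then obtain t where t: "t \<in> set U" "\<forall>i\<in>set js. t ! i = r ! i"
      using assms y(2) unfolding represents_def by blast
    then have "y = (js, map ((!) t) js)"
      using y(1) by simp
    then show "y \<in> keys m (set U)"
      using t(1) js unfolding keys_def by blast
  qed
  moreover have "set U \<subseteq> R"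
    using assms unfolding represents_def by blast
  ultimately show ?thesis
    using prune_subset[of m U] keys_prune[of m U] prune_Nil[of m U]
    by (intro represents_mono_keys) auto
qed

definition size_bound :: "nat \<Rightarrow> nat" where
  "size_bound m = Suc (m ^ (k - 1) * card V ^ (k - 1))"

text \<open>Every vector kept after the first contributes a key that was missing before, so the
  length exceeds the number of keys by at most one, however long \<open>U\<close> is. The additional
  one in \<open>size_bound\<close> pays for the first vector.\<close>

lemma length_prune:
  assumes "set U \<subseteq> vecs m"
  shows "length (prune m U) \<le> size_bound m"
proof -
  let ?p = "\<lambda>U T. fold (\<lambda>t T. if fresh m T t then t # T else T) U T"
  have "length (?p U T) \<le> Suc (card (keys m (set (?p U T))))"
    if "set T \<subseteq> vecs m" "set U \<subseteq> vecs m" "length T \<le> Suc (card (keys m (set T)))" for T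
    using that
  proof (induction U arbitrary: T)
    case (Cons t U)
    let ?T = "if fresh m T t then t # T else T"
    have sub: "set ?T \<subseteq> vecs m"
      using Cons.prems by auto
    have "length ?T \<le> Suc (card (keys m (set ?T)))"
    proof (cases "fresh m T t \<and> T \<noteq> []")
      case True
      then obtain js where js: "js \<in> set (List.n_lists (k - 1) [0..<m])"
        "\<And>t'. t' \<in> set T \<Longrightarrow> map ((!) t') js \<noteq> map ((!) t) js"
        unfolding fresh_def by blast
      have "(js, map ((!) t) js) \<notin> keys m (set T)"
      proof
        assume "(js, map ((!) t) js) \<in> keys m (set T)"
        then obtain t' where "t' \<in> set T" "map ((!) t') js = map ((!) t) js"
          unfolding keys_def by auto
        then show False
          using js(2) by blast
      qed
      moreover have "(js, map ((!) t) js) \<in> keys m (set ?T)"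
        using True js(1) unfolding keys_def by auto
      moreover have "keys m (set T) \<subseteq> keys m (set ?T)"
        unfolding keys_def by auto
      ultimately have "card (keys m (set T)) < card (keys m (set ?T))"
        using finite_keys[OF sub] by (intro psubset_card_mono) blast+
      then show ?thesis
        using True Cons.prems(3) by simp
    next
      case False
      then show ?thesis
        using Cons.prems(3) by auto
    qed
    then show ?case
      using Cons.IH[OF sub] Cons.prems(2) by simp
  qed simp
  from this[of "[]"] have "length (prune m U) \<le> Suc (card (keys m (set (prune m U))))"
    using assms unfolding prune_def by simp
  also have "\<dots> \<le> size_bound m"
    unfolding size_bound_def using assms prune_subset card_keys by (meson Suc_le_mono order_trans)
  finally show ?thesis .
qed

section \<open>Imposing the constraints one at a time\<close>

definition combinations :: "nat \<Rightarrow> 'b list list \<Rightarrow> 'b list list" where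
  "combinations m T = map (pointwise m) (List.n_lists k T)"

lemma set_combinations:
  "set (combinations m T) = pointwise m ` {ts. length ts = k \<and> set ts \<subseteq> set T}"
  unfolding combinations_def by (simp add: set_n_lists)

lemma combinations_vecs: "set T \<subseteq> vecs m \<Longrightarrow> set (combinations m T) \<subseteq> vecs m"
  unfolding set_combinations using pointwise_vecs by auto

definition add_constraint ::
    "nat \<Rightarrow> nat \<times> nat \<times> 'b option option \<Rightarrow> 'b list list \<Rightarrow> 'b list list" where
  "add_constraint m con T =
     prune m (filter (\<lambda>t. satisfies A t con) (combinations m (combinations m T)))"

text \<open>A representing list for the problem without constraints. The set of all vectors is
  exponentially large, so it is built coordinate by coordinate with pruning in between; new
  coordinates are put in front, where \<open>#\<close> is cheap.\<close>

definition vector_list :: "'b list \<Rightarrow> nat \<Rightarrow> 'b list list" where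
  "vector_list hs m =
     fold (\<lambda>j T. prune (Suc j) (concat (map (\<lambda>h. map ((#) h) T) hs))) [0..<m] [[]]"

definition solve ::
    "'b list \<Rightarrow> nat \<Rightarrow> (nat \<times> nat \<times> 'b option option) list \<Rightarrow> 'b list list" where
  "solve hs m cs = fold (add_constraint m) cs (vector_list hs m)"

definition solutions :: "nat \<Rightarrow> (nat \<times> nat \<times> 'b option option) list \<Rightarrow> 'b list set" where
  "solutions m cs = {t \<in> vecs m. \<forall>con\<in>set cs. satisfies A t con}"

lemma extend_vecs:
  assumes "set T \<subseteq> vecs m" "set hs \<subseteq> V"
  shows "set (concat (map (\<lambda>h. map ((#) h) T) hs)) \<subseteq> vecs (Suc m)"
proof
  fix y assume "y \<in> set (concat (map (\<lambda>h. map ((#) h) T) hs))"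
  then obtain h t where "y = h # t" "h \<in> V" "t \<in> vecs m"
    using assms by auto
  then show "y \<in> vecs (Suc m)"
    unfolding vecs_def by simp
qed

lemma vector_list_subset: "set hs \<subseteq> V \<Longrightarrow> set (vector_list hs m) \<subseteq> vecs m"
proof (induction m)
  case (Suc m)
  then have "set (concat (map (\<lambda>h. map ((#) h) (vector_list hs m)) hs)) \<subseteq> vecs (Suc m)"
    by (intro extend_vecs)
  from order_trans[OF prune_subset this] show ?case
    unfolding vector_list_def by simp
qed (simp add: vector_list_def vecs_def)

lemma represents_vector_list:
  assumes "set hs = V"
  shows "represents (k - 1) m (set (vector_list hs m)) (vecs m)"
proof (induction m)
  case 0
  then show ?case
    by (auto simp: vector_list_def vecs_def represents_def)
next
  case (Suc m)
  let ?T = "vector_list hs m"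
  let ?U = "concat (map (\<lambda>h. map ((#) h) ?T) hs)"
  have "represents (k - 1) (Suc m) (set ?U) (vecs (Suc m))"
    unfolding represents_def
  proof (intro conjI ballI allI impI)
    show "set ?U \<subseteq> vecs (Suc m)"
      using vector_list_subset[of hs m] assms by (intro extend_vecs) auto
    fix r S assume r: "r \<in> vecs (Suc m)" and S: "S \<subseteq> {..<Suc m}" "card S \<le> k - 1"
    obtain h r' where r': "r = h # r'" "h \<in> V" "r' \<in> vecs m"
      using r unfolding vecs_def by (cases r) auto
    \<comment> \<open>The old coordinates moved up by one when \<open>h\<close> was put in front;
      position 0 is taken care of by the choice of \<open>h\<close>.\<close>
    let ?S = "{i. Suc i \<in> S}"
    have "card ?S = card (Suc ` ?S)"
      by (simp add: card_image)
    also have "\<dots> \<le> card S"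
      using S(1) by (intro card_mono) (auto intro: finite_subset)
    finally have "?S \<subseteq> {..<m}" "card ?S \<le> k - 1"
      using S by auto
    then obtain t where t: "t \<in> set ?T" "\<forall>i\<in>?S. t ! i = r' ! i"
      using Suc.IH r'(3) unfolding represents_def by blast
    have "(h # t) ! i = r ! i" if "i \<in> S" for i
      using that t(2) r'(1) by (cases i) auto
    then show "\<exists>t\<in>set ?U. \<forall>i\<in>S. t ! i = r ! i"
      using t(1) r'(2) assms by (intro bexI[of _ "h # t"]) auto
  qed
  then show ?case
    using represents_prune unfolding vector_list_def by simp
qed

text \<open>Edge constraints are kept because \<open>f\<close> is a polymorphism, fixed values
  because \<open>f\<close> is idempotent.\<close>

lemma satisfies_pointwise:
  assumes ts: "length ts = k" "set ts \<subseteq> vecs m" "\<And>t. t \<in> set ts \<Longrightarrow> satisfies A t (i, j, c)"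
    and ij: "i < m" "j < m"
  shows "satisfies A (pointwise m ts) (i, j, c)"
proof (cases c)
  case None
  have "(f (map (\<lambda>t. t ! i) ts), f (map (\<lambda>t. t ! j) ts)) \<in> A"
    using ts(1,3) None nth_mem by (intro preserves map_nth_vecs[OF ts(2)] ij) fastforce+
  then show ?thesis
    using None ij by simp
next
  case (Some b)
  show ?thesis
  proof (cases b)
    case (Some a)
    have eq: "t ! i = a" if "t \<in> set ts" for t
      using ts(3)[OF that] \<open>c = Some b\<close> Some by simp
    \<comment> \<open>The constraint alone does not place \<open>a\<close> in \<open>V\<close>; one
      of the vectors that take this value does.\<close>
    have "ts \<noteq> []"
      using ts(1) k by auto
    then have "a \<in> V"
      using eq[OF hd_in_set] vecs_nth[OF subsetD[OF ts(2) hd_in_set] ij(1)] by simp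
    then have "f (map (\<lambda>t. t ! i) ts) = a"
      using ts(1) eq k map_nth_vecs[OF ts(2) ij(1)]
      by (intro near_unanimous[where j = 0]) auto
    then show ?thesis
      using \<open>c = Some b\<close> Some ij by simp
  qed (simp add: \<open>c = Some b\<close>)
qed

lemma closed_solutions:
  assumes "\<forall>(i, j, c)\<in>set cs. i < m \<and> j < m"
  shows "closed m (solutions m cs)"
  unfolding closed_def
proof (intro conjI allI impI)
  fix ts assume ts: "length ts = k \<and> set ts \<subseteq> solutions m cs"
  then have "set ts \<subseteq> vecs m"
    unfolding solutions_def by auto
  moreover have "satisfies A (pointwise m ts) (i, j, c)" if "(i, j, c) \<in> set cs" for i j c
    using ts that assms by (intro satisfies_pointwise) (auto simp: solutions_def)
  ultimately show "pointwise m ts \<in> solutions m cs"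
    using ts pointwise_vecs unfolding solutions_def by auto
qed (auto simp: solutions_def)

lemma represents_solve:
  assumes hs: "set hs = V" and "\<forall>(i, j, c)\<in>set cs. i < m \<and> j < m"
  shows "represents (k - 1) m (set (solve hs m cs)) (solutions m cs)"
  using assms(2)
proof (induction cs rule: rev_induct)
  case Nil
  then show ?case
    using represents_vector_list[OF hs] unfolding solve_def solutions_def by simp
next
  case (snoc con cs)
  obtain i j c where con: "con = (i, j, c)"
    by (cases con) auto
  let ?R = "solutions m cs" and ?T = "solve hs m cs"
  have R: "closed m ?R"
    using snoc.prems by (intro closed_solutions) auto
  have "represents (k - 1) m (set ?T) ?R"
    using snoc by auto
  then have "represents (Suc (k - 1)) m (set (combinations m ?T)) ?R"
    unfolding set_combinations by (rule represents_Suc[OF R]) simp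
  then have rep: "represents (Suc (Suc (k - 1))) m (set (combinations m (combinations m ?T))) ?R"
    unfolding set_combinations[of m "combinations m ?T"] by (rule represents_Suc[OF R]) simp
  have "represents (k - 1) m
      (set (filter (\<lambda>t. satisfies A t con) (combinations m (combinations m ?T))))
      (solutions m (cs @ [con]))"
    unfolding represents_def
  proof (intro conjI ballI allI impI)
    show "set (filter (\<lambda>t. satisfies A t con) (combinations m (combinations m ?T)))
        \<subseteq> solutions m (cs @ [con])"
      using rep unfolding represents_def solutions_def by auto
    fix r S assume r: "r \<in> solutions m (cs @ [con])" and S: "S \<subseteq> {..<m}" "card S \<le> k - 1"
    have "insert i (insert j S) \<subseteq> {..<m}"
      using S(1) snoc.prems con by auto
    moreover have "card (insert i (insert j S)) \<le> Suc (Suc (k - 1))"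
      using S(2) finite_subset[OF S(1)] by (simp add: card_insert_if)
    moreover have "r \<in> ?R"
      using r unfolding solutions_def by auto
    ultimately obtain t where t: "t \<in> set (combinations m (combinations m ?T))"
      "\<forall>l\<in>insert i (insert j S). t ! l = r ! l"
      using rep unfolding represents_def by blast
    \<comment> \<open>The vector \<open>t\<close> agrees with \<open>r\<close> not only on
      \<open>S\<close> but also on both variables of the new constraint, so it satisfies the
      constraint as \<open>r\<close> does and survives the filter. This is why
      \<open>k - 1 + 2\<close> coordinates are needed.\<close>
    have "satisfies A r con"
      using r unfolding solutions_def by auto
    then have "satisfies A t con"
      using t(2) unfolding con by (cases c; cases "the c") auto
    then show "\<exists>t\<in>set (filter (\<lambda>t. satisfies A t con) (combinations m (combinations m ?T))).
        \<forall>i\<in>S. t ! i = r ! i"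
      using t by auto
  qed
  then show ?case
    using represents_prune unfolding solve_def add_constraint_def by simp
qed

lemma solve_subset:
  assumes "set hs = V" "\<forall>(i, j, c)\<in>set cs. i < m \<and> j < m"
  shows "set (solve hs m cs) \<subseteq> solutions m cs"
  using represents_solve[OF assms] unfolding represents_def by auto

lemma solve_Nil_iff:
  assumes "set hs = V" "\<forall>(i, j, c)\<in>set cs. i < m \<and> j < m"
  shows "solve hs m cs = [] \<longleftrightarrow> solutions m cs = {}"
proof
  assume "solve hs m cs = []"
  then show "solutions m cs = {}"
    using represents_nonempty[OF represents_solve[OF assms]] by auto
qed (use solve_subset[OF assms] in auto)

lemma length_vector_list:
  assumes "set hs \<subseteq> V"
  shows "length (vector_list hs m) \<le> size_bound m"
proof (cases m)
  case (Suc n)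
  have "set (concat (map (\<lambda>h. map ((#) h) (vector_list hs n)) hs)) \<subseteq> vecs (Suc n)"
    using vector_list_subset[OF assms, of n] assms by (rule extend_vecs)
  then show ?thesis
    using length_prune unfolding vector_list_def Suc by simp
qed (simp add: vector_list_def size_bound_def)

lemma solve_vecs: "set hs \<subseteq> V \<Longrightarrow> set (solve hs m cs) \<subseteq> vecs m"
proof (induction cs rule: rev_induct)
  case (snoc con cs)
  then have "set (combinations m (combinations m (solve hs m cs))) \<subseteq> vecs m"
    by (intro combinations_vecs) simp
  then have "set (filter (\<lambda>t. satisfies A t con)
      (combinations m (combinations m (solve hs m cs)))) \<subseteq> vecs m"
    by auto
  from order_trans[OF prune_subset this] show ?case
    unfolding solve_def add_constraint_def by simp
qed (simp add: solve_def vector_list_subset)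

text \<open>The last operation is a pruning whatever the number of constraints. Hence the bound
  holds uniformly for all prefixes of \<open>cs\<close>, that is, for all states of the fold in
  \<open>solve\<close>.\<close>

lemma length_solve:
  assumes "set hs \<subseteq> V"
  shows "length (solve hs m cs) \<le> size_bound m"
proof (cases cs rule: rev_cases)
  case (snoc cs' con)
  have "set (combinations m (combinations m (solve hs m cs'))) \<subseteq> vecs m"
    using solve_vecs[OF assms] by (intro combinations_vecs)
  then have "set (filter (\<lambda>t. satisfies A t con)
      (combinations m (combinations m (solve hs m cs')))) \<subseteq> vecs m"
    by auto
  from length_prune[OF this] show ?thesis
    unfolding snoc solve_def add_constraint_def by simp
qed (simp add: solve_def length_vector_list[OF assms])

end

section \<open>Walks in Hom-graphs\<close>

lemma set_vwalk_arcs: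
  "set (vwalk_arcs xs) = {(xs ! i, xs ! Suc i) | i. Suc i < length xs}"
proof (induction xs rule: vwalk_arcs.induct)
  case (3 x y xs)
  have "{((x # y # xs) ! i, (x # y # xs) ! Suc i) | i. Suc i < length (x # y # xs)} =
      insert (x, y) {((y # xs) ! i, (y # xs) ! Suc i) | i. Suc i < length (y # xs)}"
  proof (intro set_eqI iffI)
    fix e assume "e \<in> {((x # y # xs) ! i, (x # y # xs) ! Suc i) | i. Suc i < length (x # y # xs)}"
    then obtain i where i: "e = ((x # y # xs) ! i, (x # y # xs) ! Suc i)" "Suc i < length (x # y # xs)"
      by blast
    then show "e \<in> insert (x, y) {((y # xs) ! i, (y # xs) ! Suc i) | i. Suc i < length (y # xs)}"
      by (cases i) auto
  next
    fix e assume "e \<in> insert (x, y) {((y # xs) ! i, (y # xs) ! Suc i) | i. Suc i < length (y # xs)}"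
    then consider "e = (x, y)" |
      i where "e = ((y # xs) ! i, (y # xs) ! Suc i)" "Suc i < length (y # xs)"
      by blast
    then show "e \<in> {((x # y # xs) ! i, (x # y # xs) ! Suc i) | i. Suc i < length (x # y # xs)}"
    proof cases
      case 1
      then show ?thesis by (intro CollectI exI[of _ 0]) simp
    next
      case (2 i)
      then show ?thesis by (intro CollectI exI[of _ "Suc i"]) simp
    qed
  qed
  with 3 show ?case by simp
qed auto

lemma vwalk_iff_nth:
  "vwalk xs K \<longleftrightarrow> xs \<noteq> [] \<and> set xs \<subseteq> verts K \<and>
     (\<forall>i. Suc i < length xs \<longrightarrow> (xs ! i, xs ! Suc i) \<in> arcs_ends K)"
  unfolding vwalk_def set_vwalk_arcs by blast

text \<open>Meant for walks of minimal length: the path extracted from such a walk cannot be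
  shorter, so the walk was a path already.\<close>

lemma length_vwalk_to_vpath: "length (vwalk_to_vpath xs) \<le> length xs"
  and length_vwalk_to_vpath_eq: "length (vwalk_to_vpath xs) = length xs \<Longrightarrow> distinct xs"
proof -
  have "length (vwalk_to_vpath xs) \<le> length xs \<and>
    (length (vwalk_to_vpath xs) = length xs \<longrightarrow> distinct xs)"
  proof (induction xs rule: vwalk_to_vpath.induct)
    case (2 x xs)
    show ?case
    proof (cases "x \<in> set xs")
      case True
      then have "length (vwalk_to_vpath (x # xs)) \<le> length xs"
        using 2(1) length_dropWhile_le[of "\<lambda>y. y \<noteq> x" xs] by (auto intro: order_trans)
      then show ?thesis
        by simp
    next
      case False
      then show ?thesis
        using 2(2) by simp
    qed
  qed simp
  then show "length (vwalk_to_vpath xs) \<le> length xs"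
    "length (vwalk_to_vpath xs) = length xs \<Longrightarrow> distinct xs"
    by auto
qed

lemma verts_Hom_ext: "verts (Hom_ext G H p) = {g \<in> homs G H. \<forall>v\<in>dom p. p v = Some (g v)}"
  unfolding Hom_ext_def by simp

lemma arcs_ends_Hom_ext:
  "arcs_ends (Hom_ext G H p) = {(g, h). g \<in> verts (Hom_ext G H p) \<and> h \<in> verts (Hom_ext G H p) \<and>
     (\<forall>(u, v)\<in>parcs G. (g u, h v) \<in> parcs H)}"
proof -
  have "arcs_ends (with_proj D \<restriction> S) = {(g, h). g \<in> S \<and> h \<in> S \<and> (g, h) \<in> parcs D}"
    for D :: "('a \<Rightarrow> 'b) pair_pre_digraph" and S
    unfolding arcs_ends_conv by (auto simp: image_iff)
  then show ?thesis
    unfolding verts_Hom_ext unfolding Hom_ext_def Hom_def by auto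
qed

text \<open>With \<open>g l\<close> the solutions of length \<open>l\<close>, the head of the
  concatenation belongs to the least solvable length.\<close>

lemma hd_concat_map:
  assumes "concat (map g [0..<m]) \<noteq> []"
  obtains l where "l < m" "g l \<noteq> []" "\<And>j. j < l \<Longrightarrow> g j = []" "hd (concat (map g [0..<m])) = hd (g l)"
proof -
  have "\<exists>l<m. g l \<noteq> [] \<and> (\<forall>j<l. g j = []) \<and> hd (concat (map g [0..<m])) = hd (g l)"
    using assms
  proof (induction m)
    case (Suc m)
    show ?case
    proof (cases "concat (map g [0..<m]) = []")
      case True
      then have eq: "concat (map g [0..<Suc m]) = g m"
        by simp
      show ?thesis
        using True Suc.prems unfolding eq by (intro exI[of _ m]) auto
    next
      case False
      with Suc.IH obtain l where "l < m" "g l \<noteq> []" "\<forall>j<l. g j = []"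
        "hd (concat (map g [0..<m])) = hd (g l)"
        by blast
      with False show ?thesis
        by (intro exI[of _ l]) auto
    qed
  qed simp
  then show ?thesis
    using that by blast
qed

lemma
  shows ball_map_upt: "(\<forall>c\<in>set (map g [0..<m]). P c) \<longleftrightarrow> (\<forall>v<m. P (g v))"
    and ball_concat_map_upt: "(\<forall>c\<in>set (concat (map h [0..<m])). P c) \<longleftrightarrow> (\<forall>v<m. \<forall>c\<in>set (h v). P c)"
  by auto

lemma length_grid: "length (concat (map (\<lambda>u. map (h u) [0..<n]) [0..<n])) = n * n"
  by (simp add: length_concat o_def sum_list_triv)

section \<open>Writing a walk as one vector\<close>

lemma block_index_less:
  assumes "j < (l::nat)" "v < n"
  shows "j * n + v < l * n"
proof -
  have "j * n + v < Suc j * n"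
    using assms(2) by simp
  also have "\<dots> \<le> l * n"
    using assms(1) by (intro mult_right_mono) auto
  finally show ?thesis .
qed

text \<open>Variable \<open>j * n + v\<close> of the constraint problem stands for the value of the
  \<open>j\<close>-th homomorphism of the walk at the vertex \<open>v\<close>.\<close>

definition block :: "nat \<Rightarrow> 'b list \<Rightarrow> nat \<Rightarrow> 'b list" where
  "block n t j = map (\<lambda>v. t ! (j * n + v)) [0..<n]"

definition adjacency :: "nat pair_pre_digraph \<Rightarrow> nat \<Rightarrow> nat \<Rightarrow> 'b option option" where
  "adjacency G u v = (if (u, v) \<in> parcs G then None else Some None)"

definition extension_constraints ::
    "nat \<Rightarrow> nat pair_pre_digraph \<Rightarrow> (nat \<rightharpoonup> 'b) \<Rightarrow> nat \<Rightarrow> (nat \<times> nat \<times> 'b option option) list" where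
  "extension_constraints n G p j =
     map (\<lambda>v. (j * n + v, j * n + v, Some (p v))) [0..<n] @
     concat (map (\<lambda>u. map (\<lambda>v. (j * n + u, j * n + v, adjacency G u v)) [0..<n]) [0..<n])"

definition step_constraints ::
    "nat \<Rightarrow> nat pair_pre_digraph \<Rightarrow> nat \<Rightarrow> (nat \<times> nat \<times> 'b option option) list" where
  "step_constraints n G j =
     concat (map (\<lambda>u. map (\<lambda>v. (j * n + u, Suc j * n + v, adjacency G u v)) [0..<n]) [0..<n])"

definition value_constraints ::
    "nat \<Rightarrow> (nat \<Rightarrow> 'b) \<Rightarrow> nat \<Rightarrow> (nat \<times> nat \<times> 'b option option) list" where
  "value_constraints n g j = map (\<lambda>v. (j * n + v, j * n + v, Some (Some (g v)))) [0..<n]"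

definition walk_constraints ::
    "nat \<Rightarrow> nat pair_pre_digraph \<Rightarrow> (nat \<rightharpoonup> 'b) \<Rightarrow> (nat \<Rightarrow> 'b) \<Rightarrow> (nat \<Rightarrow> 'b) \<Rightarrow> nat \<Rightarrow>
      (nat \<times> nat \<times> 'b option option) list" where
  "walk_constraints n G p \<phi> \<psi> l =
     value_constraints n \<phi> 0 @ value_constraints n \<psi> l @
     concat (map (extension_constraints n G p) [0..<Suc l]) @
     concat (map (step_constraints n G) [0..<l])"

lemma block_nth: "v < n \<Longrightarrow> block n t j ! v = t ! (j * n + v)"
  unfolding block_def by simp

section \<open>Homomorphisms as vectors over \<open>H\<close>\<close>

locale recon_instance = nu_polymorphism "pverts H" "parcs H" k f
  for H :: "'b pair_pre_digraph" and k f +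
  fixes G :: "nat pair_pre_digraph" and p \<phi> \<psi> n
  assumes verts_G: "pverts G = {..<n}"
    and arcs_G: "parcs G \<subseteq> {..<n} \<times> {..<n}"
    and dom_p: "dom p \<subseteq> {..<n}"
    and \<phi>: "\<phi> \<in> verts (Hom_ext G H p)" and \<psi>: "\<psi> \<in> verts (Hom_ext G H p)"
begin

definition adj :: "'b list \<Rightarrow> 'b list \<Rightarrow> bool" where
  "adj r s \<longleftrightarrow> (\<forall>(u, v)\<in>parcs G. (r ! u, s ! v) \<in> parcs H)"

definition extensions :: "'b list set" where
  "extensions = {s \<in> vecs n. adj s s \<and> (\<forall>v a. p v = Some a \<longrightarrow> s ! v = a)}"

definition vector_of :: "(nat \<Rightarrow> 'b) \<Rightarrow> 'b list" where
  "vector_of g = map g [0..<n]"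

text \<open>The restriction supplies the extensional function that \<open>homs\<close> asks for, so
  that \<open>hom_of\<close> and \<open>vector_of\<close> are mutually inverse on the vertices of
  the Hom-graph and the vectors in \<open>extensions\<close>.\<close>

definition hom_of :: "'b list \<Rightarrow> nat \<Rightarrow> 'b" where
  "hom_of s = restrict ((!) s) {..<n}"

lemma vector_of_nth [simp]: "v < n \<Longrightarrow> vector_of g ! v = g v"
  unfolding vector_of_def by simp

lemma arcs_less: "(u, v) \<in> parcs G \<Longrightarrow> u < n \<and> v < n"
  using arcs_G by auto

lemma vector_of_extensions:
  assumes "g \<in> verts (Hom_ext G H p)"
  shows "vector_of g \<in> extensions"
proof -
  have g: "g \<in> {..<n} \<rightarrow>\<^sub>E pverts H" "\<And>u v. (u, v) \<in> parcs G \<Longrightarrow> (g u, g v) \<in> parcs H"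
    "\<And>v. v \<in> dom p \<Longrightarrow> p v = Some (g v)"
    using assms unfolding verts_Hom_ext homs_def verts_G by blast+
  have "g v \<in> pverts H" if "v < n" for v
    using that by (intro PiE_mem[OF g(1)]) simp
  then have "vector_of g \<in> vecs n"
    unfolding vecs_def vector_of_def by auto
  moreover have "(vector_of g ! u, vector_of g ! v) \<in> parcs H" if "(u, v) \<in> parcs G" for u v
    using g(2)[OF that] arcs_less[OF that] by simp
  then have "adj (vector_of g) (vector_of g)"
    unfolding adj_def by blast
  moreover have "vector_of g ! v = a" if "p v = Some a" for v a
  proof -
    have "v < n"
      using that dom_p by auto
    then show ?thesis
      using that g(3)[of v] by (simp add: domI)
  qed
  ultimately show ?thesis
    unfolding extensions_def by simp
qed

lemma hom_of_verts:
  assumes "s \<in> extensions"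
  shows "hom_of s \<in> verts (Hom_ext G H p)"
proof -
  have s: "s \<in> vecs n" "\<And>u v. (u, v) \<in> parcs G \<Longrightarrow> (s ! u, s ! v) \<in> parcs H"
    "\<And>v a. p v = Some a \<Longrightarrow> s ! v = a"
    using assms unfolding extensions_def adj_def by auto
  have "(hom_of s u, hom_of s v) \<in> parcs H" if "(u, v) \<in> parcs G" for u v
    using s(2)[OF that] arcs_less[OF that] unfolding hom_of_def by simp
  moreover have "hom_of s \<in> {..<n} \<rightarrow>\<^sub>E pverts H"
    using vecs_nth[OF s(1)] unfolding hom_of_def by auto
  moreover have "p v = Some (hom_of s v)" if "v \<in> dom p" for v
  proof -
    have "v < n"
      using that dom_p by auto
    then show ?thesis
      using that s(3)[of v] unfolding hom_of_def by auto
  qed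
  ultimately show ?thesis
    unfolding verts_Hom_ext homs_def verts_G by auto
qed

lemma hom_of_vector_of:
  assumes "g \<in> verts (Hom_ext G H p)"
  shows "hom_of (vector_of g) = g"
proof -
  have g: "g \<in> {..<n} \<rightarrow>\<^sub>E pverts H"
    using assms unfolding verts_Hom_ext homs_def verts_G by blast
  have "hom_of (vector_of g) v = g v" for v
    using PiE_arb[OF g, of v] unfolding hom_of_def by (cases "v < n") simp_all
  then show ?thesis
    by blast
qed

lemma arcs_ends_hom_of:
  assumes "r \<in> extensions" "s \<in> extensions"
  shows "(hom_of r, hom_of s) \<in> arcs_ends (Hom_ext G H p) \<longleftrightarrow> adj r s"
proof -
  have "(\<forall>(u, v)\<in>parcs G. (hom_of r u, hom_of s v) \<in> parcs H) \<longleftrightarrow> adj r s"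
    unfolding adj_def using arcs_G by (intro ball_cong refl) (auto simp: hom_of_def)
  then show ?thesis
    unfolding arcs_ends_Hom_ext using assms[THEN hom_of_verts] by simp
qed

text \<open>The length is exact and vertices may repeat. The final vector is a parameter, so that
  the same notion serves the constraint problem, where it comes from \<open>\<psi>\<close>, and the
  reached sets, where it is arbitrary.\<close>

definition walk :: "(nat \<Rightarrow> 'b list) \<Rightarrow> nat \<Rightarrow> 'b list \<Rightarrow> bool" where
  "walk w l s \<longleftrightarrow> w 0 = vector_of \<phi> \<and> w l = s \<and> (\<forall>j\<le>l. w j \<in> extensions) \<and> (\<forall>j<l. adj (w j) (w (Suc j)))"

lemma walk_vwalk:
  assumes w: "walk w l (vector_of \<psi>)"
  defines "xs \<equiv> map (\<lambda>j. hom_of (w j)) [0..<Suc l]"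
  shows "vwalk xs (Hom_ext G H p) \<and> hd xs = \<phi> \<and> last xs = \<psi>"
proof -
  have ext: "w j \<in> extensions" if "j \<le> l" for j
    using w that unfolding walk_def by auto
  have len: "length xs = Suc l" and nth: "\<And>j. j \<le> l \<Longrightarrow> xs ! j = hom_of (w j)"
    unfolding xs_def by (auto simp del: upt_Suc)
  have "(xs ! j, xs ! Suc j) \<in> arcs_ends (Hom_ext G H p)" if "Suc j < length xs" for j
    using that w ext[of j] ext[of "Suc j"] arcs_ends_hom_of[of "w j" "w (Suc j)"] nth len
    unfolding walk_def by auto
  moreover have "set xs \<subseteq> verts (Hom_ext G H p)"
    using ext hom_of_verts unfolding xs_def by auto
  moreover have "xs \<noteq> []"
    using len by auto
  moreover from this have "hd xs = \<phi>" "last xs = \<psi>"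
    using w nth[of 0] nth[of l] len hom_of_vector_of[OF \<phi>] hom_of_vector_of[OF \<psi>] unfolding walk_def
    by (simp_all add: hd_conv_nth last_conv_nth)
  ultimately show ?thesis
    unfolding vwalk_iff_nth by blast
qed

lemma walk_iff_vwalk:
  "(\<exists>w. walk w l (vector_of \<psi>)) \<longleftrightarrow>
     (\<exists>xs. vwalk xs (Hom_ext G H p) \<and> hd xs = \<phi> \<and> last xs = \<psi> \<and> length xs = Suc l)"
proof
  assume "\<exists>xs. vwalk xs (Hom_ext G H p) \<and> hd xs = \<phi> \<and> last xs = \<psi> \<and> length xs = Suc l"
  then obtain xs where xs: "vwalk xs (Hom_ext G H p)" "hd xs = \<phi>" "last xs = \<psi>" "length xs = Suc l"
    by blast
  have verts: "xs ! j \<in> verts (Hom_ext G H p)" if "j \<le> l" for j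
    using xs(1,4) that unfolding vwalk_iff_nth by auto
  have "xs \<noteq> []"
    using xs(4) by auto
  then have "vector_of (xs ! 0) = vector_of \<phi>" "vector_of (xs ! l) = vector_of \<psi>"
    using xs(2-4) by (auto simp: hd_conv_nth last_conv_nth)
  moreover have "adj (vector_of (xs ! j)) (vector_of (xs ! Suc j))" if "j < l" for j
  proof -
    have "(xs ! j, xs ! Suc j) \<in> arcs_ends (Hom_ext G H p)"
      using xs(1,4) that unfolding vwalk_iff_nth by auto
    then show ?thesis
      using arcs_ends_hom_of[of "vector_of (xs ! j)" "vector_of (xs ! Suc j)"] that
        verts[of j] verts[of "Suc j"] by (simp add: hom_of_vector_of vector_of_extensions)
  qed
  ultimately have "walk (\<lambda>j. vector_of (xs ! j)) l (vector_of \<psi>)"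
    unfolding walk_def using verts vector_of_extensions by auto
  then show "\<exists>w. walk w l (vector_of \<psi>)"
    by blast
next
  assume "\<exists>w. walk w l (vector_of \<psi>)"
  then obtain w where w: "walk w l (vector_of \<psi>)" ..
  then show "\<exists>xs. vwalk xs (Hom_ext G H p) \<and> hd xs = \<phi> \<and> last xs = \<psi> \<and> length xs = Suc l"
    using walk_vwalk by (intro exI[of _ "map (\<lambda>j. hom_of (w j)) [0..<Suc l]"]) (simp del: upt_Suc)
qed

lemma walk_constraints_index:
  "\<forall>(i, j, c)\<in>set (walk_constraints n G p \<phi> \<psi> l). i < Suc l * n \<and> j < Suc l * n"
proof -
  have "j * n + v < Suc l * n" if "j \<le> l" "v < n" for j v
    using that block_index_less[of j "Suc l" v n] by simp
  moreover have "v < Suc l * n" if "v < n" for v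
    using block_index_less[of 0 "Suc l" v n] that by (simp del: mult_Suc)
  ultimately show ?thesis
    unfolding walk_constraints_def value_constraints_def extension_constraints_def step_constraints_def
    by (auto simp: less_Suc_eq_le simp del: mult_Suc upt_Suc)
qed

lemma satisfies_adjacency:
  "(\<forall>u<n. \<forall>v<n. satisfies (parcs H) t (i + u, j + v, adjacency G u v)) \<longleftrightarrow>
     (\<forall>(u, v)\<in>parcs G. (t ! (i + u), t ! (j + v)) \<in> parcs H)"
  using arcs_G by (auto simp: adjacency_def)

lemma satisfies_walk_constraints:
  assumes t: "t \<in> vecs (Suc l * n)"
  shows "(\<forall>con\<in>set (walk_constraints n G p \<phi> \<psi> l). satisfies (parcs H) t con) \<longleftrightarrow>
    walk (block n t) l (vector_of \<psi>)"
proof -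
  have block_vecs: "block n t j \<in> vecs n" if "j \<le> l" for j
    using vecs_nth[OF t block_index_less[of j "Suc l"]] that unfolding block_def vecs_def by auto
  have val: "(\<forall>con\<in>set (value_constraints n g j). satisfies (parcs H) t con) \<longleftrightarrow>
      block n t j = vector_of g" for g j
    unfolding value_constraints_def block_def vector_of_def by auto
  have step: "(\<forall>con\<in>set (step_constraints n G j). satisfies (parcs H) t con) \<longleftrightarrow>
      adj (block n t j) (block n t (Suc j))" for j
  proof -
    have "(\<forall>con\<in>set (step_constraints n G j). satisfies (parcs H) t con) \<longleftrightarrow>
        (\<forall>u<n. \<forall>v<n. satisfies (parcs H) t (j * n + u, Suc j * n + v, adjacency G u v))"
      unfolding step_constraints_def ball_map_upt ball_concat_map_upt ..
    also have "\<dots> \<longleftrightarrow> adj (block n t j) (block n t (Suc j))"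
      unfolding satisfies_adjacency adj_def using arcs_G
      by (intro ball_cong refl) (auto simp: block_nth simp del: mult_Suc)
    finally show ?thesis .
  qed
  have ext: "(\<forall>con\<in>set (extension_constraints n G p j). satisfies (parcs H) t con) \<longleftrightarrow>
      block n t j \<in> extensions" if "j \<le> l" for j
  proof -
    have "(\<forall>con\<in>set (extension_constraints n G p j). satisfies (parcs H) t con) \<longleftrightarrow>
        (\<forall>v<n. satisfies (parcs H) t (j * n + v, j * n + v, Some (p v))) \<and>
        (\<forall>u<n. \<forall>v<n. satisfies (parcs H) t (j * n + u, j * n + v, adjacency G u v))"
      unfolding extension_constraints_def set_append ball_Un ball_map_upt ball_concat_map_upt ..
    moreover have "(\<forall>u<n. \<forall>v<n. satisfies (parcs H) t (j * n + u, j * n + v, adjacency G u v)) \<longleftrightarrow>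
        adj (block n t j) (block n t j)"
      unfolding satisfies_adjacency adj_def using arcs_G
      by (intro ball_cong refl) (auto simp: block_nth)
    moreover have "(\<forall>v<n. satisfies (parcs H) t (j * n + v, j * n + v, Some (p v))) \<longleftrightarrow>
        (\<forall>v a. p v = Some a \<longrightarrow> block n t j ! v = a)" (is "?L \<longleftrightarrow> ?R")
    proof
      assume ?L
      show ?R
      proof (intro allI impI)
        fix v a assume "p v = Some a"
        moreover from this have "v < n"
          using dom_p by auto
        ultimately show "block n t j ! v = a"
          using \<open>?L\<close>[rule_format, of v] by (simp add: block_nth)
      qed
    next
      assume ?R
      show ?L
      proof (intro allI impI)
        fix v assume "v < n"
        then show "satisfies (parcs H) t (j * n + v, j * n + v, Some (p v))"
          using \<open>?R\<close>[rule_format, of v] by (cases "p v") (auto simp: block_nth)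
      qed
    qed
    ultimately show ?thesis
      using block_vecs[OF that] unfolding extensions_def by auto
  qed
  have "(\<forall>con\<in>set (walk_constraints n G p \<phi> \<psi> l). satisfies (parcs H) t con) \<longleftrightarrow>
      (\<forall>con\<in>set (value_constraints n \<phi> 0). satisfies (parcs H) t con) \<and>
      (\<forall>con\<in>set (value_constraints n \<psi> l). satisfies (parcs H) t con) \<and>
      (\<forall>j\<le>l. \<forall>con\<in>set (extension_constraints n G p j). satisfies (parcs H) t con) \<and>
      (\<forall>j<l. \<forall>con\<in>set (step_constraints n G j). satisfies (parcs H) t con)"
    unfolding walk_constraints_def set_append ball_Un ball_concat_map_upt less_Suc_eq_le ..
  then show ?thesis
    unfolding val step walk_def using ext by simp
qed

lemma solutions_nonempty_iff:
  "solutions (Suc l * n) (walk_constraints n G p \<phi> \<psi> l) \<noteq> {} \<longleftrightarrow> (\<exists>w. walk w l (vector_of \<psi>))"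
proof
  assume "solutions (Suc l * n) (walk_constraints n G p \<phi> \<psi> l) \<noteq> {}"
  then show "\<exists>w. walk w l (vector_of \<psi>)"
    using satisfies_walk_constraints unfolding solutions_def by blast
next
  assume "\<exists>w. walk w l (vector_of \<psi>)"
  then obtain w where w: "walk w l (vector_of \<psi>)" ..
  \<comment> \<open>The vectors of the walk written one after the other; \<open>block\<close> cuts
    them out again.\<close>
  let ?t = "map (\<lambda>i. w (i div n) ! (i mod n)) [0..<Suc l * n]"
  have w_vecs: "w j \<in> vecs n" if "j \<le> l" for j
    using w that unfolding walk_def extensions_def by auto
  have "w (i div n) ! (i mod n) \<in> pverts H" if i: "i < Suc l * n" for i
  proof -
    have "n > 0" "i div n \<le> l"
      using i by (auto simp: less_mult_imp_div_less less_Suc_eq_le[symmetric] simp del: mult_Suc intro: gr0I)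
    then show ?thesis
      by (intro vecs_nth[OF w_vecs]) auto
  qed
  then have t: "?t \<in> vecs (Suc l * n)"
    unfolding vecs_def by auto
  have block: "block n ?t j = w j" if "j \<le> l" for j
  proof (rule nth_equalityI)
    show "length (block n ?t j) = length (w j)"
      using w_vecs[OF that] unfolding block_def vecs_def by simp
    fix v assume "v < length (block n ?t j)"
    then have v: "v < n"
      unfolding block_def by simp
    then have "j * n + v < Suc l * n"
      using that by (intro block_index_less) auto
    then show "block n ?t j ! v = w j ! v"
      using v by (simp add: block_nth del: mult_Suc)
  qed
  have "walk (block n ?t) l (vector_of \<psi>)"
    using w block unfolding walk_def by (auto simp del: mult_Suc)
  then show "solutions (Suc l * n) (walk_constraints n G p \<phi> \<psi> l) \<noteq> {}"
    using satisfies_walk_constraints[OF t] t unfolding solutions_def by blast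
qed

section \<open>Reached sets and the length of shortest walks\<close>

primrec reached :: "nat \<Rightarrow> 'b list set" where
  "reached 0 = {vector_of \<phi>}"
| "reached (Suc i) = {s \<in> extensions. \<exists>r\<in>reached i. adj r s}"

lemma reached_iff_walk: "s \<in> reached l \<longleftrightarrow> (\<exists>w. walk w l s)"
proof (induction l arbitrary: s)
  case 0
  then show ?case
    using vector_of_extensions[OF \<phi>] unfolding walk_def by (auto intro: exI[of _ "\<lambda>_. s"])
next
  case (Suc l)
  show ?case
  proof
    assume "s \<in> reached (Suc l)"
    then obtain r where r: "r \<in> reached l" "adj r s" and s: "s \<in> extensions"
      by auto
    then obtain w where w: "walk w l r"
      using Suc.IH by blast
    have "walk (w(Suc l := s)) (Suc l) s"
      using w r(2) s unfolding walk_def by (auto simp: le_Suc_eq less_Suc_eq)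
    then show "\<exists>w. walk w (Suc l) s"
      by blast
  next
    assume "\<exists>w. walk w (Suc l) s"
    then obtain w where w: "walk w (Suc l) s" ..
    then have "walk w l (w l)"
      unfolding walk_def by simp
    then have "w l \<in> reached l"
      using Suc.IH by blast
    then show "s \<in> reached (Suc l)"
      using w unfolding walk_def by auto
  qed
qed

lemma reached_extensions: "reached i \<subseteq> extensions"
  using vector_of_extensions[OF \<phi>] by (cases i) auto

text \<open>A homomorphism is adjacent to itself, so a walk may wait at its end; being reached in
  exactly \<open>i\<close> steps and in at most \<open>i\<close> steps is therefore the
  same.\<close>

lemma reached_mono: "i \<le> j \<Longrightarrow> reached i \<subseteq> reached j"
proof (rule lift_Suc_mono_le[of reached])
  show "reached i \<subseteq> reached (Suc i)" for i
  proof
    fix s assume "s \<in> reached i"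
    moreover from this have "s \<in> extensions"
      using reached_extensions by blast
    moreover from this have "adj s s"
      unfolding extensions_def by blast
    ultimately show "s \<in> reached (Suc i)"
      by auto
  qed
qed

lemma adj_pointwise:
  assumes "length rs = k" "length ss = k" "set rs \<subseteq> vecs n" "set ss \<subseteq> vecs n"
    and "\<And>i. i < k \<Longrightarrow> adj (rs ! i) (ss ! i)"
  shows "adj (pointwise n rs) (pointwise n ss)"
proof -
  have "(f (map (\<lambda>r. r ! u) rs), f (map (\<lambda>s. s ! v) ss)) \<in> parcs H" if "(u, v) \<in> parcs G" for u v
  proof -
    have "(rs ! i ! u, ss ! i ! v) \<in> parcs H" if "i < k" for i
      using assms(5)[OF that] \<open>(u, v) \<in> parcs G\<close> unfolding adj_def by blast
    then show ?thesis
      using assms(1,2) arcs_less[OF that]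
      by (intro preserves map_nth_vecs[OF assms(3)] map_nth_vecs[OF assms(4)]) simp_all
  qed
  then have "(pointwise n rs ! u, pointwise n ss ! v) \<in> parcs H" if "(u, v) \<in> parcs G" for u v
    using that arcs_less[OF that] by simp
  then show ?thesis
    unfolding adj_def by blast
qed

lemma closed_extensions: "closed n extensions"
  unfolding closed_def
proof (intro conjI allI impI)
  fix ts assume "length ts = k \<and> set ts \<subseteq> extensions"
  then have ts: "length ts = k" "set ts \<subseteq> extensions" "set ts \<subseteq> vecs n"
    unfolding extensions_def by auto
  have "adj (ts ! i) (ts ! i)" if "i < k" for i
    using that ts(1) nth_mem[of i ts] ts(2) unfolding extensions_def by blast
  then have "adj (pointwise n ts) (pointwise n ts)"
    using ts by (intro adj_pointwise)
  moreover have "pointwise n ts ! v = a" if "p v = Some a" for v a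
  proof -
    have "v < n"
      using dom_p that by auto
    have eq: "t ! v = a" if "t \<in> set ts" for t
      using ts(2) that \<open>p v = Some a\<close> unfolding extensions_def by auto
    \<comment> \<open>That the colours prescribed by \<open>p\<close> are vertices of
      \<open>H\<close> is read off from \<open>\<phi>\<close>, which extends
      \<open>p\<close>.\<close>
    have "vector_of \<phi> ! v = a"
      using vector_of_extensions[OF \<phi>] that unfolding extensions_def by blast
    moreover have "vector_of \<phi> \<in> vecs n"
      using vector_of_extensions[OF \<phi>] unfolding extensions_def by blast
    ultimately have "a \<in> pverts H"
      using vecs_nth[OF _ \<open>v < n\<close>] by blast
    then have "f (map (\<lambda>t. t ! v) ts) = a"
      using ts eq k map_nth_vecs[OF ts(3) \<open>v < n\<close>] by (intro near_unanimous[where j = 0]) auto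
    then show ?thesis
      using \<open>v < n\<close> by simp
  qed
  ultimately show "pointwise n ts \<in> extensions"
    using pointwise_vecs ts unfolding extensions_def by auto
qed (auto simp: extensions_def)

text \<open>The relation is defined from \<open>extensions\<close> and \<open>adj\<close> by an
  existential quantifier, and such definitions preserve closure: \<open>f\<close> applied to
  predecessors of \<open>k\<close> vectors is a predecessor of \<open>f\<close> applied to these
  vectors. The singleton at the start is closed by idempotence.\<close>

lemma closed_reached: "closed n (reached i)"
proof (induction i)
  case 0
  have \<phi>_vecs: "vector_of \<phi> \<in> vecs n"
    using vector_of_extensions[OF \<phi>] unfolding extensions_def by simp
  have "pointwise n ts = vector_of \<phi>" if ts: "length ts = k" "set ts \<subseteq> {vector_of \<phi>}" for ts
  proof (rule nth_equalityI)
    show "length (pointwise n ts) = length (vector_of \<phi>)"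
      unfolding pointwise_def vector_of_def by simp
    fix v assume "v < length (pointwise n ts)"
    then have v: "v < n"
      unfolding pointwise_def by simp
    have "ts = replicate k (vector_of \<phi>)"
      using ts by (intro replicate_eqI) auto
    then have "f (map (\<lambda>t. t ! v) ts) = vector_of \<phi> ! v"
      using k vecs_nth[OF \<phi>_vecs v] by (intro near_unanimous[where j = 0]) auto
    then show "pointwise n ts ! v = vector_of \<phi> ! v"
      using v by simp
  qed
  then show ?case
    unfolding closed_def using \<phi>_vecs by auto
next
  case (Suc i)
  show ?case
    unfolding closed_def
  proof (intro conjI allI impI)
    fix ts assume "length ts = k \<and> set ts \<subseteq> reached (Suc i)"
    then have ts: "length ts = k" "set ts \<subseteq> reached (Suc i)"
      by auto
    have "\<exists>r\<in>reached i. adj r (ts ! a)" if "a < k" for a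
    proof -
      have "ts ! a \<in> reached (Suc i)"
        using that ts nth_mem[of a ts] by blast
      then show ?thesis
        by simp
    qed
    then obtain r where r: "\<And>a. a < k \<Longrightarrow> r a \<in> reached i" "\<And>a. a < k \<Longrightarrow> adj (r a) (ts ! a)"
      by metis
    let ?rs = "map r [0..<k]"
    have rs: "length ?rs = k" "set ?rs \<subseteq> reached i"
      using r(1) by auto
    then have "pointwise n ?rs \<in> reached i"
      using Suc.IH unfolding closed_def by blast
    moreover have vecs: "set ?rs \<subseteq> vecs n" "set ts \<subseteq> vecs n"
      using rs(2) ts(2) reached_extensions[of i] reached_extensions[of "Suc i"]
      unfolding extensions_def by blast+
    have "adj (pointwise n ?rs) (pointwise n ts)"
      using r(2) by (intro adj_pointwise rs(1) ts(1) vecs) simp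
    moreover have "pointwise n ts \<in> extensions"
      using closed_extensions ts reached_extensions[of "Suc i"] unfolding closed_def by blast
    ultimately show "pointwise n ts \<in> reached (Suc i)"
      by auto
  next
    show "reached (Suc i) \<subseteq> vecs n"
      using reached_extensions[of "Suc i"] unfolding extensions_def by blast
  qed
qed

text \<open>The set reached in \<open>i\<close> steps is determined by its \<open>k - 1\<close>-ary projections, of which there are only
  polynomially many; hence the growing chain of these sets is soon constant.\<close>

lemma reached_bound: "reached i \<subseteq> reached (n ^ (k - 1) * card (pverts H) ^ (k - 1))"
proof -
  let ?S = "keys n (vecs n)" and ?g = "\<lambda>i. keys n (reached i)"
  have sub: "?g i \<subseteq> ?S" for i
    using closed_reached[of i] unfolding closed_def keys_def by blast
  have nonempty: "reached i \<noteq> {}" for i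
    using reached_mono[of 0 i] by auto
  \<comment> \<open>Here the Baker-Pixley theorem enters: once the keys agree, the nested closed
    sets agree.\<close>
  have eqI: "reached i = reached j" if "i \<le> j" "?g j \<subseteq> ?g i" for i j
    using closed_eq_if_keys[OF closed_reached closed_reached reached_mono[OF that(1)] nonempty that(2)] .
  have mono: "mono ?g"
  proof (rule monoI)
    fix i j :: nat assume "i \<le> j"
    from reached_mono[OF this] show "?g i \<subseteq> ?g j"
      unfolding keys_def by blast
  qed
  have fin: "finite ?S"
    by (rule finite_keys) simp
  \<comment> \<open>If a step adds no key, the two reached sets are equal, and each reached set
    determines the next one. So the keys grow strictly until they are constant for good, which
    happens after at most \<open>card ?S\<close> steps.\<close>
  have "\<exists>N. (\<forall>n\<le>N. \<forall>m\<le>N. m < n \<longrightarrow> ?g m < ?g n) \<and> (\<forall>n\<ge>N. ?g N = ?g n)"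
  proof (rule finite_mono_remains_stable_implies_strict_prefix[OF _ mono])
    have "range ?g \<subseteq> Pow ?S"
      using sub by blast
    then show "finite (range ?g)"
      using fin finite_subset by blast
    show "\<forall>i. ?g i = ?g (Suc i) \<longrightarrow> ?g (Suc i) = ?g (Suc (Suc i))"
    proof (intro allI impI)
      fix i assume "?g i = ?g (Suc i)"
      then have "reached i = reached (Suc i)"
        by (intro eqI) auto
      then show "?g (Suc i) = ?g (Suc (Suc i))"
        by simp
    qed
  qed
  from finite_mono_strict_prefix_implies_finite_fixpoint[OF sub fin this]
  have "?g (card ?S) = (\<Union>i. ?g i)" .
  then have "?g (max i (card ?S)) \<subseteq> ?g (card ?S)"
    by blast
  then have "reached (card ?S) = reached (max i (card ?S))"
    by (intro eqI) auto
  then have "reached i \<subseteq> reached (card ?S)"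
    using reached_mono[of i "max i (card ?S)"] by simp
  also have "\<dots> \<subseteq> reached (n ^ (k - 1) * card (pverts H) ^ (k - 1))"
    by (intro reached_mono card_keys) simp
  finally show ?thesis .
qed

definition decode :: "nat \<Rightarrow> 'b list \<Rightarrow> (nat \<Rightarrow> 'b) list" where
  "decode l t = map (\<lambda>j. hom_of (block n t j)) [0..<Suc l]"

definition solutions_of_length :: "'b list \<Rightarrow> nat \<Rightarrow> 'b list list" where
  "solutions_of_length hs l = solve hs (Suc l * n) (walk_constraints n G p \<phi> \<psi> l)"

text \<open>\<open>L\<close> lies above the bound for the chain of reached sets, so an empty
  \<open>ys\<close> proves that there is no walk at all. Otherwise the head of \<open>ys\<close>
  comes from the least solvable length and is a walk of minimal length.\<close>

lemma shortest_path_answer: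
  assumes hs: "set hs = pverts H" and L: "n ^ (k - 1) * card (pverts H) ^ (k - 1) < L"
  defines "ys \<equiv> concat (map (\<lambda>l. map (decode l) (solutions_of_length hs l)) [0..<L])"
  shows "(case ys of [] \<Rightarrow> None | y # _ \<Rightarrow> Some y) \<in> shortest_path_answers H (G, p, \<phi>, \<psi>)"
proof -
  let ?K = "Hom_ext G H p"
  note solve = represents_solve[OF hs walk_constraints_index]
  have nonempty: "solutions_of_length hs l \<noteq> [] \<longleftrightarrow>
      (\<exists>xs. vwalk xs ?K \<and> hd xs = \<phi> \<and> last xs = \<psi> \<and> length xs = Suc l)" for l
    unfolding solutions_of_length_def walk_iff_vwalk[symmetric] solutions_nonempty_iff[symmetric]
      solve_Nil_iff[OF hs walk_constraints_index] ..
  have walk_len: "\<exists>l. vwalk xs ?K \<and> hd xs = \<phi> \<and> last xs = \<psi> \<and> length xs = Suc l"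
    if "path_between ?K \<phi> \<psi> xs" for xs
    using that unfolding path_between_def vpath_def vwalk_def by (cases xs) auto
  show ?thesis
  proof (cases ys)
    case Nil
    have "\<not> path_between ?K \<phi> \<psi> xs" for xs
    proof
      assume "path_between ?K \<phi> \<psi> xs"
      then obtain l where "\<exists>w. walk w l (vector_of \<psi>)"
        using walk_len walk_iff_vwalk by blast
      \<comment> \<open>A walk of any length, longer or shorter, yields one of exactly this length,
        which is among those tried.\<close>
      then have "vector_of \<psi> \<in> reached (n ^ (k - 1) * card (pverts H) ^ (k - 1))"
        using reached_bound reached_iff_walk by blast
      then have "solutions_of_length hs (n ^ (k - 1) * card (pverts H) ^ (k - 1)) \<noteq> []"
        unfolding nonempty walk_iff_vwalk[symmetric] reached_iff_walk .
      then show False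
        using Nil L unfolding ys_def by auto
    qed
    then show ?thesis
      using Nil by simp
  next
    case (Cons y ys')
    then have "ys \<noteq> []" by simp
    then obtain l where l: "l < L" "map (decode l) (solutions_of_length hs l) \<noteq> []"
      "\<And>j. j < l \<Longrightarrow> map (decode j) (solutions_of_length hs j) = []"
      "hd ys = hd (map (decode l) (solutions_of_length hs l))"
      unfolding ys_def by (rule hd_concat_map) blast
    have min: "l \<le> j" if "solutions_of_length hs j \<noteq> []" for j
      using that l(3)[of j] by (cases "j < l") auto
    let ?t = "hd (solutions_of_length hs l)"
    have y: "y = decode l ?t"
      using l(2,4) Cons by (simp add: hd_map)
    have "?t \<in> set (solutions_of_length hs l)"
      using l(2) by auto
    then have "?t \<in> solutions (Suc l * n) (walk_constraints n G p \<phi> \<psi> l)"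
      using solve_subset[OF hs walk_constraints_index] unfolding solutions_of_length_def by blast
    then have walk: "walk (block n ?t) l (vector_of \<psi>)"
      using satisfies_walk_constraints unfolding solutions_def by blast
    have "vwalk y ?K \<and> hd y = \<phi> \<and> last y = \<psi>"
      unfolding y decode_def using walk by (rule walk_vwalk)
    then have vw: "vwalk y ?K" "hd y = \<phi>" "last y = \<psi>"
      by auto
    have len: "length y = Suc l"
      unfolding y decode_def by simp
    have shortest: "Suc l \<le> length xs" if path: "path_between ?K \<phi> \<psi> xs" for xs
    proof -
      obtain j where "vwalk xs ?K \<and> hd xs = \<phi> \<and> last xs = \<psi> \<and> length xs = Suc j"
        using walk_len[OF path] by blast
      then show ?thesis
        using min[of j] nonempty[of j] by auto
    qed
    \<comment> \<open>By minimality of \<open>l\<close> this path is as long as \<open>y\<close>;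
      hence nothing was cut out and \<open>y\<close> is distinct.\<close>
    let ?q = "vwalk_to_vpath y"
    have "path_between ?K \<phi> \<psi> ?q"
      unfolding path_between_def using vw
      by (simp add: vwalk_to_vpath_vpath vwalk_to_vpath_hd vwalk_to_vpath_last)
    then have "length ?q = length y"
      using shortest len length_vwalk_to_vpath[of y] by force
    then have "path_between ?K \<phi> \<psi> y"
      unfolding path_between_def vpath_def using vw length_vwalk_to_vpath_eq by blast
    then have "shortest_path ?K \<phi> \<psi> y"
      unfolding shortest_path_def using shortest len by fastforce
    then show ?thesis
      using Cons by simp
  qed
qed

end

section \<open>Solving constraints in polynomial time\<close>

lemma fst_mem: "z \<in> {(x, a). x \<in> X \<and> P x a} \<Longrightarrow> fst z \<in> X"
  by auto

lemma pbounded_upt: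
  assumes "pbounded X N n"
  shows "pbounded {(x, i). x \<in> X \<and> i < n x} (\<lambda>z. N (fst z)) (\<lambda>z. snd z)"
proof -
  have "pbounded {(x, i). x \<in> X \<and> i < n x} (\<lambda>z. N (fst z)) (\<lambda>z. n (fst z))"
    using assms by (rule pbounded_fst) auto
  then show ?thesis
    by (rule pbounded_le) auto
qed

lemma ptime_tabulate:
  assumes "ptime X N E (\<lambda>x. enc_nat (n x))" "pbounded X N n"
    and "ptime {(x, i). x \<in> X \<and> i < n x} (\<lambda>z. N (fst z)) (with_input E enc_nat)
      (\<lambda>z. eb (h (fst z) (snd z)))"
  shows "ptime X N E (\<lambda>x. enc_list eb (map (h x) [0..<n x]))"
  by (rule ptime_map[OF ptime_upt[OF assms(1,2)]]) (use assms(2,3) in simp_all)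

lemma ptime_concat_tabulate:
  assumes "ptime X N E (\<lambda>x. enc_nat (n x))" "pbounded X N n"
    and "ptime {(x, i). x \<in> X \<and> i < n x} (\<lambda>z. N (fst z)) (with_input E enc_nat)
      (\<lambda>z. enc_list eb (h (fst z) (snd z)))"
    and "pbounded {(x, i). x \<in> X \<and> i < n x} (\<lambda>z. N (fst z)) (\<lambda>z. length (h (fst z) (snd z)))"
  shows "ptime X N E (\<lambda>x. enc_list eb (concat (map (h x) [0..<n x])))"
  by (rule ptime_concat_map[OF ptime_upt[OF assms(1,2)]]) (use assms(2-4) in simp_all)

lemma ptime_map_nth:
  assumes "ptime X N E (\<lambda>x. enc_list ea (t x))"
    and "ptime X N E (\<lambda>x. enc_list enc_nat (js x))" "pbounded X N (\<lambda>x. length (js x))"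
    and "pbounded X N m" "\<And>x j. x \<in> X \<Longrightarrow> j \<in> set (js x) \<Longrightarrow> j < m x"
    and "\<And>x. x \<in> X \<Longrightarrow> length (t x) = m x"
  shows "ptime X N E (\<lambda>x. enc_list ea (map ((!) (t x)) (js x)))"
proof (rule ptime_map[OF assms(2,3)])
  let ?Z = "{(x, j). x \<in> X \<and> j \<in> set (js x)}"
  have "pbounded ?Z (\<lambda>z. N (fst z)) (\<lambda>z. m (fst z))"
    using assms(4) by (rule pbounded_fst) auto
  then have "pbounded ?Z (\<lambda>z. N (fst z)) (\<lambda>z. snd z)"
    by (rule pbounded_le) (use assms(5) in \<open>auto intro: less_imp_le\<close>)
  note * = ptime_nth[OF ptime_weaken[OF assms(1)] ptime_snd this]
  show "ptime ?Z (\<lambda>z. N (fst z)) (with_input E enc_nat) (\<lambda>z. ea (t (fst z) ! snd z))"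
    by (rule *) (use assms(5,6) in auto)
qed

text \<open>The machine has no equality test on trees, but two values from a fixed finite set can be
  compared through the table of \<open>ptime_finite\<close>. Pruning needs this for
  \<open>(k - 1)\<close>-tuples over \<open>V\<close>.\<close>

lemma ptime_eq:
  assumes "ptime X N E (\<lambda>x. ea (a x))" "\<And>x. x \<in> X \<Longrightarrow> a x \<in> S"
    and "ptime X N E (\<lambda>x. ea (b x))" "\<And>x. x \<in> X \<Longrightarrow> b x \<in> S"
    and "finite S" "inj_on ea S"
  shows "ptime X N E (\<lambda>x. enc_bool (a x = b x))"
  by (rule ptime_finite[where ea = "\<lambda>(u, v). Node (ea u) (ea v)" and v = "\<lambda>x. (a x, b x)"
        and A = "S \<times> S" and g = "\<lambda>(u, v). enc_bool (u = v)", simplified])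
    (use assms in \<open>auto intro: ptime_Node simp: inj_on_def\<close>)

lemma inj_enc_nat: "inj enc_nat"
proof (rule injI)
  show "enc_nat m = enc_nat n \<Longrightarrow> m = n" for m n
  proof (induction m arbitrary: n)
    case 0
    then show ?case by (cases n) auto
  next
    case (Suc m)
    then show ?case by (cases n) auto
  qed
qed

lemma inj_on_enc_list:
  assumes "inj_on ea S"
  shows "inj_on (enc_list ea) {xs. set xs \<subseteq> S}"
proof (rule inj_onI)
  fix xs ys assume "xs \<in> {xs. set xs \<subseteq> S}" "ys \<in> {xs. set xs \<subseteq> S}" "enc_list ea xs = enc_list ea ys"
  then show "xs = ys"
  proof (induction xs arbitrary: ys)
    case Nil
    then show ?case by (cases ys) auto
  next
    case (Cons x xs)
    then show ?case using assms by (cases ys) (auto dest: inj_onD)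
  qed
qed

lemma inj_on_enc_option:
  assumes "inj_on ea S"
  shows "inj_on (enc_option ea) (insert None (Some ` S))"
  using assms by (auto simp: inj_on_def)

text \<open>\<open>c\<close> names the elements of \<open>V\<close> in unary; \<open>hs\<close> is
  an enumeration of \<open>V\<close> that is built into the program as a constant.\<close>

locale encoded_nu_polymorphism = nu_polymorphism +
  fixes c :: "'a \<Rightarrow> nat" and hs :: "'a list"
  assumes inj_c: "inj_on c V" and set_hs: "set hs = V"
begin

abbreviation enc_val :: "'a \<Rightarrow> tree" where
  "enc_val a \<equiv> enc_nat (c a)"

abbreviation enc_vec :: "'a list \<Rightarrow> tree" where
  "enc_vec \<equiv> enc_list enc_val"

abbreviation enc_tag :: "'a option option \<Rightarrow> tree" where
  "enc_tag \<equiv> enc_option (enc_option enc_val)"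

definition enc_con :: "nat \<times> nat \<times> 'a option option \<Rightarrow> tree" where
  "enc_con con = Node (enc_nat (fst con)) (Node (enc_nat (fst (snd con))) (enc_tag (snd (snd con))))"

text \<open>The third components that occur in constraints. They form a finite set because fixed
  values lie in \<open>V\<close>, so whether a constraint holds can be decided by table
  lookup.\<close>

definition tags :: "'a option option set" where
  "tags = insert None (Some ` insert None (Some ` V))"

definition constraints :: "nat \<Rightarrow> (nat \<times> nat \<times> 'a option option) set" where
  "constraints m = {..<m} \<times> {..<m} \<times> tags"

lemma inj_enc_val: "inj_on enc_val V"
  using inj_c inj_enc_nat by (auto simp: inj_on_def)

lemma inj_enc_vec: "inj_on enc_vec {xs. set xs \<subseteq> V \<and> length xs = d}"
  by (rule inj_on_subset[OF inj_on_enc_list[OF inj_enc_val]]) auto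

lemma inj_enc_tag: "inj_on enc_tag tags"
  unfolding tags_def by (intro inj_on_enc_option inj_enc_val)

lemma finite_tags: "finite tags"
  unfolding tags_def using finite_V by simp

text \<open>At each coordinate \<open>f\<close> receives a \<open>k\<close>-tuple over
  \<open>V\<close>, one of finitely many arguments, so \<open>ptime_finite\<close> applies.\<close>

lemma ptime_pointwise:
  assumes "ptime X N E (\<lambda>x. enc_nat (m x))" "pbounded X N m"
    and ts: "ptime X N E (\<lambda>x. enc_list enc_vec (ts x))"
    and X: "\<And>x. x \<in> X \<Longrightarrow> length (ts x) = k" "\<And>x. x \<in> X \<Longrightarrow> set (ts x) \<subseteq> vecs (m x)"
  shows "ptime X N E (\<lambda>x. enc_vec (pointwise (m x) (ts x)))"
  unfolding pointwise_def
proof (rule ptime_tabulate[OF assms(1,2)])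
  let ?Z = "{(x, i). x \<in> X \<and> i < m x}"
  have "ptime ?Z (\<lambda>z. N (fst z)) (with_input E enc_nat)
      (\<lambda>z. enc_vec (map (\<lambda>t. t ! snd z) (ts (fst z))))"
  proof (rule ptime_map)
    let ?Z' = "{(z, t). z \<in> ?Z \<and> t \<in> set (ts (fst z))}"
    show "ptime ?Z (\<lambda>z. N (fst z)) (with_input E enc_nat) (\<lambda>z. enc_list enc_vec (ts (fst z)))"
      by (rule ptime_weaken[OF ts]) auto
    show "pbounded ?Z (\<lambda>z. N (fst z)) (\<lambda>z. length (ts (fst z)))"
      by (rule pbounded_le[OF pbounded_const[where c = k]]) (use X(1) in auto)
    have "pbounded ?Z' (\<lambda>z. N (fst (fst z))) (\<lambda>z. snd (fst z))"
      by (rule pbounded_fst[OF pbounded_upt[OF assms(2)]]) auto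
    moreover have "length t = m x" if "x \<in> X" "t \<in> set (ts x)" for x t
      using X(2)[OF that(1)] that(2) unfolding vecs_def by blast
    ultimately show "ptime ?Z' (\<lambda>z. N (fst (fst z))) (with_input (with_input E enc_nat) enc_vec)
        (\<lambda>z. enc_val (snd z ! snd (fst z)))"
      by (intro ptime_nth[OF ptime_snd ptime_weaken_snd]) auto
  qed
  moreover have "map (\<lambda>t. t ! snd z) (ts (fst z)) \<in> {xs. set xs \<subseteq> V \<and> length xs = k}" if "z \<in> ?Z" for z
  proof -
    have "fst z \<in> X" "snd z < m (fst z)"
      using that by auto
    then show ?thesis
      using X(1) map_nth_vecs[OF X(2)] by simp
  qed
  ultimately show "ptime ?Z (\<lambda>z. N (fst z)) (with_input E enc_nat)
      (\<lambda>z. enc_val (f (map (\<lambda>t. t ! snd z) (ts (fst z)))))"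
    by (rule ptime_finite[OF _ _ finite_lists_length_eq[OF finite_V] inj_enc_vec])
qed

lemma length_combinations: "length (combinations m T) = length T ^ k"
  unfolding combinations_def by (simp add: length_n_lists)

lemma ptime_combinations:
  assumes m: "ptime X N E (\<lambda>x. enc_nat (m x))" "pbounded X N m"
    and T: "ptime X N E (\<lambda>x. enc_list enc_vec (T x))" "pbounded X N (\<lambda>x. length (T x))"
    and X: "\<And>x. x \<in> X \<Longrightarrow> set (T x) \<subseteq> vecs (m x)"
  shows "ptime X N E (\<lambda>x. enc_list enc_vec (combinations (m x) (T x)))"
  unfolding combinations_def
proof (rule ptime_map[OF ptime_n_lists[OF T]])
  show "pbounded X N (\<lambda>x. length (List.n_lists k (T x)))"
    using T(2) by (simp add: length_n_lists pbounded_power)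
  let ?Z = "{(x, ts). x \<in> X \<and> ts \<in> set (List.n_lists k (T x))}"
  have Z: "fst z \<in> X" "length (snd z) = k" "set (snd z) \<subseteq> vecs (m (fst z))" if "z \<in> ?Z" for z
  proof -
    have "fst z \<in> X" "length (snd z) = k" "set (snd z) \<subseteq> set (T (fst z))"
      using that by (auto simp: set_n_lists)
    then show "fst z \<in> X" "length (snd z) = k" "set (snd z) \<subseteq> vecs (m (fst z))"
      using X by blast+
  qed
  show "ptime ?Z (\<lambda>z. N (fst z)) (with_input E (enc_list enc_vec))
      (\<lambda>z. enc_vec (pointwise (m (fst z)) (snd z)))"
    by (rule ptime_pointwise[OF ptime_weaken[OF m(1)] pbounded_fst[OF m(2)] ptime_snd]) (rule Z, assumption)+
qed

text \<open>For fixed \<open>k\<close> there are only \<open>m ^ (k - 1)\<close> lists of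
  coordinates to try, and the projections to be compared range over a finite set.\<close>

lemma ptime_fresh:
  assumes m: "ptime X N E (\<lambda>x. enc_nat (m x))" "pbounded X N m"
    and T: "ptime X N E (\<lambda>x. enc_list enc_vec (T x))" "pbounded X N (\<lambda>x. length (T x))"
    and t: "ptime X N E (\<lambda>x. enc_vec (t x))"
    and X: "\<And>x. x \<in> X \<Longrightarrow> set (T x) \<subseteq> vecs (m x)" "\<And>x. x \<in> X \<Longrightarrow> t x \<in> vecs (m x)"
  shows "ptime X N E (\<lambda>x. enc_bool (fresh (m x) (T x) (t x)))"
  unfolding fresh_def
proof (intro ptime_not ptime_conj ptime_null[OF T(1)])
  let ?js = "\<lambda>x. List.n_lists (k - 1) [0..<m x]"
  show "ptime X N E (\<lambda>x. enc_bool (\<forall>js\<in>set (?js x).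
      \<exists>t'\<in>set (T x). map ((!) t') js = map ((!) (t x)) js))"
  proof (rule ptime_Ball)
    have m': "pbounded X N (\<lambda>x. length [0..<m x])"
      using m(2) by simp
    show "ptime X N E (\<lambda>x. enc_list (enc_list enc_nat) (?js x))"
      by (rule ptime_n_lists[OF ptime_upt[OF m] m'])
    show "pbounded X N (\<lambda>x. length (?js x))"
      using m(2) by (simp add: length_n_lists pbounded_power)
    let ?Z = "{(x, js). x \<in> X \<and> js \<in> set (?js x)}"
    let ?E = "with_input E (enc_list enc_nat)"
    show "ptime ?Z (\<lambda>z. N (fst z)) ?E (\<lambda>z. enc_bool (\<exists>t'\<in>set (T (fst z)).
        map ((!) t') (snd z) = map ((!) (t (fst z))) (snd z)))"
    proof (rule ptime_Bex)
      show "ptime ?Z (\<lambda>z. N (fst z)) ?E (\<lambda>z. enc_list enc_vec (T (fst z)))"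
        by (rule ptime_weaken[OF T(1)]) auto
      show "pbounded ?Z (\<lambda>z. N (fst z)) (\<lambda>z. length (T (fst z)))"
        by (rule pbounded_fst[OF T(2)]) auto
      let ?Z' = "{(z, t'). z \<in> ?Z \<and> t' \<in> set (T (fst z))}"
      let ?E' = "with_input ?E enc_vec"
      have js: "ptime ?Z' (\<lambda>z. N (fst (fst z))) ?E' (\<lambda>z. enc_list enc_nat (snd (fst z)))"
        by (rule ptime_weaken_snd)
      have Z': "length (snd (fst z)) = k - 1" "set (snd (fst z)) \<subseteq> {..<m (fst (fst z))}"
        "snd z \<in> vecs (m (fst (fst z)))" "t (fst (fst z)) \<in> vecs (m (fst (fst z)))" if "z \<in> ?Z'" for z
        using that X(2) by (auto simp: set_n_lists dest: subsetD[OF X(1)])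
      have len: "pbounded ?Z' (\<lambda>z. N (fst (fst z))) (\<lambda>z. length (snd (fst z)))"
        by (rule pbounded_le[OF pbounded_const[where c = "k - 1"]]) (simp only: Z' le_refl)
      have m': "pbounded ?Z' (\<lambda>z. N (fst (fst z))) (\<lambda>z. m (fst (fst z)))"
        by (rule pbounded_fst2[OF m(2)]) auto
      have less: "j < m (fst (fst z))" if "z \<in> ?Z'" "j \<in> set (snd (fst z))" for z j
        using Z'(2)[OF that(1)] that(2) by auto
      have in_V: "map ((!) s) (snd (fst z)) \<in> {xs. set xs \<subseteq> V \<and> length xs = k - 1}"
        if "z \<in> ?Z'" "s \<in> vecs (m (fst (fst z)))" for z s
        using Z'(1)[OF that(1)] less[OF that(1)] vecs_nth[OF that(2)] by auto
      have t': "ptime ?Z' (\<lambda>z. N (fst (fst z))) ?E' (\<lambda>z. enc_vec (t (fst (fst z))))"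
        by (rule ptime_weaken2[OF t]) auto
      have t'_js: "ptime ?Z' (\<lambda>z. N (fst (fst z))) ?E'
          (\<lambda>z. enc_vec (map ((!) (snd z)) (snd (fst z))))"
        by (rule ptime_map_nth[OF ptime_snd js len m' less])
          (use Z'(3) in \<open>auto simp: vecs_def\<close>)
      have t_js: "ptime ?Z' (\<lambda>z. N (fst (fst z))) ?E'
          (\<lambda>z. enc_vec (map ((!) (t (fst (fst z)))) (snd (fst z))))"
        by (rule ptime_map_nth[OF t' js len m' less]) (use Z'(4) in \<open>auto simp: vecs_def\<close>)
      show "ptime ?Z' (\<lambda>z. N (fst (fst z))) ?E'
          (\<lambda>z. enc_bool (map ((!) (snd z)) (snd (fst z)) = map ((!) (t (fst (fst z)))) (snd (fst z))))"
        by (rule ptime_eq[OF t'_js in_V t_js in_V finite_lists_length_eq[OF finite_V] inj_enc_vec])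
          (use Z'(3,4) in blast)+
    qed
  qed
qed

lemma size_bound_mono: "i \<le> j \<Longrightarrow> size_bound i \<le> size_bound j"
  unfolding size_bound_def by (simp add: power_mono)

lemma pbounded_size_bound: "pbounded X N m \<Longrightarrow> pbounded X N (\<lambda>x. size_bound (m x))"
  unfolding size_bound_def by (intro pbounded_intros)

lemma ptime_prune:
  assumes m: "ptime X N E (\<lambda>x. enc_nat (m x))" "pbounded X N m"
    and U: "ptime X N E (\<lambda>x. enc_list enc_vec (U x))" "pbounded X N (\<lambda>x. length (U x))"
    and X: "\<And>x. x \<in> X \<Longrightarrow> set (U x) \<subseteq> vecs (m x)"
  shows "ptime X N E (\<lambda>x. enc_list enc_vec (prune (m x) (U x)))"
  unfolding prune_def
proof (rule ptime_fold[OF U(1) ptime_const U(2)])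
  let ?Z = "{((x, a), r). x \<in> X \<and> (\<exists>i<length (U x). a = U x ! i \<and>
    r = fold (\<lambda>t T. if fresh (m x) T t then t # T else T) (take i (U x)) [])}"
  let ?E = "with_input (with_input E enc_vec) (enc_list enc_vec)"
  have Z: "set (snd z) \<subseteq> vecs (m (fst (fst z)))" "snd (fst z) \<in> vecs (m (fst (fst z)))"
    "length (snd z) \<le> size_bound (m (fst (fst z)))" "fst (fst z) \<in> X" if z: "z \<in> ?Z" for z
  proof -
    \<comment> \<open>Each accumulator is itself the pruning of a prefix of \<open>U x\<close>, so
      \<open>length_prune\<close> bounds it.\<close>
    obtain x a r i where z: "z = ((x, a), r)" "x \<in> X" "i < length (U x)" "a = U x ! i"
      "r = prune (m x) (take i (U x))"
      using z unfolding prune_def by blast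
    have sub: "set (take i (U x)) \<subseteq> vecs (m x)"
      using X[OF z(2)] set_take_subset[of i "U x"] by blast
    have "a \<in> vecs (m x)"
      using z(3,4) X[OF z(2)] nth_mem by blast
    then show "set (snd z) \<subseteq> vecs (m (fst (fst z)))" "snd (fst z) \<in> vecs (m (fst (fst z)))"
      "length (snd z) \<le> size_bound (m (fst (fst z)))" "fst (fst z) \<in> X"
      using z sub order_trans[OF prune_subset sub] length_prune[OF sub] by simp_all
  qed
  have m': "pbounded ?Z (\<lambda>z. N (fst (fst z))) (\<lambda>z. m (fst (fst z)))"
    by (rule pbounded_fst2[OF m(2)]) (rule Z)
  have len: "pbounded ?Z (\<lambda>z. N (fst (fst z))) (\<lambda>z. length (snd z))"
    by (rule pbounded_le[OF pbounded_size_bound[OF m']]) (rule Z)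
  have m'': "ptime ?Z (\<lambda>z. N (fst (fst z))) ?E (\<lambda>z. enc_nat (m (fst (fst z))))"
    by (rule ptime_weaken2[OF m(1)]) (rule Z)
  show "ptime ?Z (\<lambda>z. N (fst (fst z))) ?E
    (\<lambda>z. enc_list enc_vec (if fresh (m (fst (fst z))) (snd z) (snd (fst z))
       then snd (fst z) # snd z else snd z))"
    by (rule ptime_if[OF ptime_fresh[OF m'' m' ptime_snd len ptime_weaken_snd]],
        (rule Z, assumption)+, rule ptime_Cons, rule ptime_weaken_snd, rule ptime_snd, rule ptime_snd)
qed

text \<open>Only two entries of the vector matter. Moved to fixed positions, they leave a test with
  finitely many possible arguments, independent of \<open>m\<close>.\<close>

lemma satisfies_pair: "satisfies A t (i, j, r) \<longleftrightarrow> satisfies A [t ! i, t ! j] (0, 1, r)"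
  by (cases r; cases "the r") auto

lemma ptime_add_constraint:
  assumes m: "ptime X N E (\<lambda>x. enc_nat (m x))" "pbounded X N m"
    and T: "ptime X N E (\<lambda>x. enc_list enc_vec (T x))" "pbounded X N (\<lambda>x. length (T x))"
    and con: "ptime X N E (\<lambda>x. enc_con (con x))"
    and X: "\<And>x. x \<in> X \<Longrightarrow> set (T x) \<subseteq> vecs (m x)" "\<And>x. x \<in> X \<Longrightarrow> con x \<in> constraints (m x)"
  shows "ptime X N E (\<lambda>x. enc_list enc_vec (add_constraint (m x) (con x) (T x)))"
  unfolding add_constraint_def
proof (rule ptime_prune[OF m])
  let ?U = "\<lambda>x. combinations (m x) (combinations (m x) (T x))"
  have vecs: "set (?U x) \<subseteq> vecs (m x)" if "x \<in> X" for x
    using X(1)[OF that] by (intro combinations_vecs)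
  have len: "pbounded X N (\<lambda>x. length (?U x))"
    unfolding length_combinations by (intro pbounded_power T(2))
  have "pbounded X N (\<lambda>x. length (combinations (m x) (T x)))"
    unfolding length_combinations by (intro pbounded_power T(2))
  note comb = ptime_combinations[OF m ptime_combinations[OF m T X(1)] this]
  have U: "ptime X N E (\<lambda>x. enc_list enc_vec (?U x))"
    by (rule comb) (use X(1) combinations_vecs in blast)+
  show "pbounded X N (\<lambda>x. length (filter (\<lambda>t. satisfies A t (con x)) (?U x)))"
    by (rule pbounded_le[OF len]) simp
  show "set (filter (\<lambda>t. satisfies A t (con x)) (?U x)) \<subseteq> vecs (m x)" if "x \<in> X" for x
    using vecs[OF that] by auto
  show "ptime X N E (\<lambda>x. enc_list enc_vec (filter (\<lambda>t. satisfies A t (con x)) (?U x)))"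
  proof (rule ptime_filter[OF U len])
    let ?Z = "{(x, t). x \<in> X \<and> t \<in> set (?U x)}" and ?E = "with_input E enc_vec"
    let ?N = "\<lambda>z. N (fst z)"
    have Z: "fst z \<in> X" "snd z \<in> vecs (m (fst z))" "con (fst z) \<in> constraints (m (fst z))"
      if "z \<in> ?Z" for z
      using that X(2) by (auto dest: subsetD[OF vecs])
    have con': "ptime ?Z ?N ?E (\<lambda>z. enc_con (con (fst z)))"
      by (rule ptime_weaken[OF con]) (rule Z)
    have i: "ptime ?Z ?N ?E (\<lambda>z. enc_nat (fst (con (fst z))))"
      and j: "ptime ?Z ?N ?E (\<lambda>z. enc_nat (fst (snd (con (fst z)))))"
      and r: "ptime ?Z ?N ?E (\<lambda>z. enc_tag (snd (snd (con (fst z)))))"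
      using ptime_left[OF con'] ptime_left[OF ptime_right[OF con']] ptime_right[OF ptime_right[OF con']]
      unfolding enc_con_def by simp_all
    have m': "pbounded ?Z ?N (\<lambda>z. m (fst z))"
      by (rule pbounded_fst[OF m(2)]) (rule Z)
    have ij: "fst (con (fst z)) < m (fst z)" "fst (snd (con (fst z))) < m (fst z)"
      "snd (snd (con (fst z))) \<in> tags" "length (snd z) = m (fst z)" if "z \<in> ?Z" for z
      using Z(2,3)[OF that] unfolding constraints_def vecs_def by auto
    have "pbounded ?Z ?N (\<lambda>z. fst (con (fst z)))"
      by (rule pbounded_le[OF m']) (use ij in \<open>auto intro: less_imp_le\<close>)
    then have ti: "ptime ?Z ?N ?E (\<lambda>z. enc_val (snd z ! fst (con (fst z))))"
      by (rule ptime_nth[OF ptime_snd i]) (use ij in simp)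
    have "pbounded ?Z ?N (\<lambda>z. fst (snd (con (fst z))))"
      by (rule pbounded_le[OF m']) (use ij in \<open>auto intro: less_imp_le\<close>)
    then have tj: "ptime ?Z ?N ?E (\<lambda>z. enc_val (snd z ! fst (snd (con (fst z)))))"
      by (rule ptime_nth[OF ptime_snd j]) (use ij in simp)
    let ?v = "\<lambda>z. (snd (snd (con (fst z))), snd z ! fst (con (fst z)), snd z ! fst (snd (con (fst z))))"
    let ?e = "\<lambda>(r, a, b). Node (enc_tag r) (Node (enc_val a) (enc_val b))"
    have "ptime ?Z ?N ?E (\<lambda>z. ?e (?v z))"
      using ptime_Node[OF r ptime_Node[OF ti tj]] by simp
    moreover have "?v z \<in> tags \<times> V \<times> V" if "z \<in> ?Z" for z
      using ij[OF that] vecs_nth[OF Z(2)[OF that]] by auto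
    moreover have "finite (tags \<times> V \<times> V)"
      using finite_tags finite_V by simp
    moreover have "inj_on ?e (tags \<times> V \<times> V)"
      using inj_onD[OF inj_enc_tag] inj_onD[OF inj_enc_val] by (auto simp: inj_on_def)
    ultimately have "ptime ?Z ?N ?E
        (\<lambda>z. (\<lambda>(r, a, b). enc_bool (satisfies A [a, b] (0, 1, r))) (?v z))"
      by (rule ptime_finite)
    then show "ptime ?Z ?N ?E (\<lambda>z. enc_bool (satisfies A (snd z) (con (fst z))))"
    proof (rule ptime_cong)
      fix z
      show "(\<lambda>(r, a, b). enc_bool (satisfies A [a, b] (0, 1, r))) (?v z) =
          enc_bool (satisfies A (snd z) (con (fst z)))"
        by (cases "con (fst z)") (simp only: satisfies_pair[of "snd z"] fst_conv snd_conv prod.case)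
    qed
  qed
qed

lemma ptime_vector_list:
  assumes m: "ptime X N E (\<lambda>x. enc_nat (m x))" "pbounded X N m"
  shows "ptime X N E (\<lambda>x. enc_list enc_vec (vector_list hs (m x)))"
  unfolding vector_list_def
proof (rule ptime_fold[OF ptime_upt[OF m] ptime_const])
  show "pbounded X N (\<lambda>x. length [0..<m x])"
    using m(2) by simp
  let ?Z = "{((x, a), r). x \<in> X \<and> (\<exists>i<length [0..<m x]. a = [0..<m x] ! i \<and>
    r = fold (\<lambda>j T. prune (Suc j) (concat (map (\<lambda>h. map ((#) h) T) hs))) (take i [0..<m x]) [[]])}"
  let ?E = "with_input (with_input E enc_nat) (enc_list enc_vec)" and ?N = "\<lambda>z. N (fst (fst z))"
  have Z: "fst (fst z) \<in> X" "set (snd z) \<subseteq> vecs (snd (fst z))" "snd (fst z) < m (fst (fst z))"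
    "length (snd z) \<le> size_bound (m (fst (fst z)))" if z: "z \<in> ?Z" for z
  proof -
    \<comment> \<open>The prefix of length \<open>i\<close> of \<open>[0..<m x]\<close> is
      \<open>[0..<i]\<close>, so each accumulator is the representing list for \<open>i\<close>
      coordinates and obeys the bound for \<open>m x\<close> by monotonicity.\<close>
    obtain x r i where z: "z = ((x, i), r)" "x \<in> X" "i < m x" "r = vector_list hs i"
      using z unfolding vector_list_def by auto
    have "length r \<le> size_bound (m x)"
      using length_vector_list[of hs i] set_hs size_bound_mono[of i "m x"] z by simp
    then show "fst (fst z) \<in> X" "set (snd z) \<subseteq> vecs (snd (fst z))" "snd (fst z) < m (fst (fst z))"
      "length (snd z) \<le> size_bound (m (fst (fst z)))"
      using vector_list_subset[of hs i] set_hs z by simp_all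
  qed
  have m': "pbounded ?Z ?N (\<lambda>z. m (fst (fst z)))"
    by (rule pbounded_fst2[OF m(2)]) (rule Z)
  have "pbounded ?Z ?N (\<lambda>z. snd (fst z))"
    by (rule pbounded_le[OF m'], rule less_imp_le) (rule Z)
  then have j: "pbounded ?Z ?N (\<lambda>z. Suc (snd (fst z)))"
    by (rule pbounded_Suc)
  have len: "pbounded ?Z ?N (\<lambda>z. length (snd z))"
    by (rule pbounded_le[OF pbounded_size_bound[OF m']]) (rule Z)
  let ?U = "\<lambda>z. concat (map (\<lambda>h. map ((#) h) (snd z)) hs)"
  have len_U: "length (?U z) = length hs * length (snd z)" for z :: "('c \<times> nat) \<times> 'a list list"
    by (simp add: length_concat o_def sum_list_triv)
  have U: "ptime ?Z ?N ?E (\<lambda>z. enc_list enc_vec (?U z))"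
  proof (rule ptime_concat_map[where l = "\<lambda>_. hs" and ea = enc_val])
    show "ptime ?Z ?N ?E (\<lambda>_. enc_list enc_val hs)"
      by (rule ptime_const)
    show "pbounded ?Z ?N (\<lambda>_. length hs)"
      by (rule pbounded_const)
    let ?Z' = "{(z, h). z \<in> ?Z \<and> h \<in> set hs}"
    have len': "pbounded ?Z' (\<lambda>z. ?N (fst z)) (\<lambda>z. length (snd (fst z)))"
      by (rule pbounded_fst[OF len]) (rule fst_mem)
    then show "pbounded ?Z' (\<lambda>z. ?N (fst z)) (\<lambda>z. length (map ((#) (snd z)) (snd (fst z))))"
      unfolding length_map .
    show "ptime ?Z' (\<lambda>z. ?N (fst z)) (with_input ?E enc_val)
        (\<lambda>z. enc_list enc_vec (map ((#) (snd z)) (snd (fst z))))"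
    proof (rule ptime_map[where ea = enc_vec])
      show "ptime ?Z' (\<lambda>z. ?N (fst z)) (with_input ?E enc_val) (\<lambda>z. enc_list enc_vec (snd (fst z)))"
        by (rule ptime_weaken_snd)
      show "pbounded ?Z' (\<lambda>z. ?N (fst z)) (\<lambda>z. length (snd (fst z)))"
        by (rule len')
      show "ptime {(z, t). z \<in> ?Z' \<and> t \<in> set (snd (fst z))} (\<lambda>z. ?N (fst (fst z)))
          (with_input (with_input ?E enc_val) enc_vec) (\<lambda>z. enc_vec (snd (fst z) # snd z))"
        by (rule ptime_Cons, rule ptime_weaken_snd, rule ptime_snd)
    qed
  qed
  have len_U: "pbounded ?Z ?N (\<lambda>z. length (?U z))"
    unfolding len_U by (rule pbounded_mult[OF pbounded_const len])
  have U_vecs: "set (?U z) \<subseteq> vecs (Suc (snd (fst z)))" if "z \<in> ?Z" for z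
    using Z(2)[OF that] set_hs by (intro extend_vecs) simp_all
  have i: "ptime ?Z ?N ?E (\<lambda>z. enc_nat (Suc (snd (fst z))))"
    by (rule ptime_Suc, rule ptime_weaken_snd)
  show "ptime ?Z ?N ?E (\<lambda>z. enc_list enc_vec (prune (Suc (snd (fst z))) (?U z)))"
    by (rule ptime_prune[OF i j U len_U U_vecs])
qed

text \<open>The states of the fold are the lists solved for a prefix of the constraints;
  \<open>length_solve\<close> bounds them all by the same polynomial, so each
  \<open>add_constraint\<close> starts from a short list.\<close>

lemma ptime_solve:
  assumes m: "ptime X N E (\<lambda>x. enc_nat (m x))" "pbounded X N m"
    and cs: "ptime X N E (\<lambda>x. enc_list enc_con (cs x))" "pbounded X N (\<lambda>x. length (cs x))"
    and X: "\<And>x. x \<in> X \<Longrightarrow> set (cs x) \<subseteq> constraints (m x)"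
  shows "ptime X N E (\<lambda>x. enc_list enc_vec (solve hs (m x) (cs x)))"
  unfolding solve_def
proof (rule ptime_fold[OF cs(1) _ cs(2)], rule ptime_vector_list[OF m])
  let ?Z = "{((x, a), r). x \<in> X \<and> (\<exists>i<length (cs x). a = cs x ! i \<and>
    r = fold (add_constraint (m x)) (take i (cs x)) (vector_list hs (m x)))}"
  let ?E = "with_input (with_input E enc_con) (enc_list enc_vec)" and ?N = "\<lambda>z. N (fst (fst z))"
  have Z: "fst (fst z) \<in> X" "set (snd z) \<subseteq> vecs (m (fst (fst z)))"
    "snd (fst z) \<in> constraints (m (fst (fst z)))"
    "length (snd z) \<le> size_bound (m (fst (fst z)))" if z: "z \<in> ?Z" for z
  proof -
    obtain x a r i where z: "z = ((x, a), r)" "x \<in> X" "i < length (cs x)" "a = cs x ! i"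
      "r = solve hs (m x) (take i (cs x))"
      using z unfolding solve_def by blast
    have "a \<in> constraints (m x)"
      using X[OF z(2)] nth_mem[OF z(3)] z(4) by blast
    then show "fst (fst z) \<in> X" "set (snd z) \<subseteq> vecs (m (fst (fst z)))"
      "snd (fst z) \<in> constraints (m (fst (fst z)))"
      "length (snd z) \<le> size_bound (m (fst (fst z)))"
      using z solve_vecs[of hs "m x"] length_solve[of hs "m x"] set_hs by simp_all
  qed
  have m': "pbounded ?Z ?N (\<lambda>z. m (fst (fst z)))"
    by (rule pbounded_fst2[OF m(2)]) (rule Z)
  have len: "pbounded ?Z ?N (\<lambda>z. length (snd z))"
    by (rule pbounded_le[OF pbounded_size_bound[OF m']]) (rule Z)
  have m'': "ptime ?Z ?N ?E (\<lambda>z. enc_nat (m (fst (fst z))))"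
    by (rule ptime_weaken2[OF m(1)]) (rule Z)
  show "ptime ?Z ?N ?E (\<lambda>z. enc_list enc_vec (add_constraint (m (fst (fst z))) (snd (fst z)) (snd z)))"
    by (rule ptime_add_constraint[OF m'' m' ptime_snd len ptime_weaken_snd]) (rule Z, assumption)+
qed

end

section \<open>Generating the constraints and reading off the walks\<close>

lemma enc_list_map: "enc_list ea (map g xs) = enc_list (\<lambda>x. ea (g x)) xs"
  by (induction xs) auto

lemma enc_list_cong: "(\<And>x. x \<in> set xs \<Longrightarrow> ea x = eb x) \<Longrightarrow> enc_list ea xs = enc_list eb xs"
  by (induction xs) auto

text \<open>The maps and the rows of the adjacency matrix are tables over \<open>[0..<n x]\<close>,
  so evaluating them at a vertex amounts to indexing a list.\<close>

lemma ptime_lookup: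
  assumes "ptime X N E (\<lambda>x. enc_list (\<lambda>v. ea (g x v)) [0..<n x])"
    and v: "ptime X N E (\<lambda>x. enc_nat (v x))"
    and "pbounded X N n" "\<And>x. x \<in> X \<Longrightarrow> v x < n x"
  shows "ptime X N E (\<lambda>x. ea (g x (v x)))"
proof -
  have "pbounded X N v"
    by (rule pbounded_le[OF assms(3)]) (use assms(4) in \<open>auto intro: less_imp_le\<close>)
  then have "ptime X N E (\<lambda>x. ea (map (g x) [0..<n x] ! v x))"
    using assms by (intro ptime_nth) (simp_all add: enc_list_map)
  then show ?thesis
    by (rule ptime_cong) (use assms(4) in simp)
qed

context encoded_nu_polymorphism
begin

lemma ptime_con:
  assumes "ptime X N E (\<lambda>x. enc_nat (i x))" "ptime X N E (\<lambda>x. enc_nat (j x))"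
    and "ptime X N E (\<lambda>x. enc_tag (r x))"
  shows "ptime X N E (\<lambda>x. enc_con (i x, j x, r x))"
  unfolding enc_con_def fst_conv snd_conv by (intro ptime_Node assms)

lemma ptime_offset:
  assumes "ptime X N E (\<lambda>x. enc_nat (a x))" "pbounded X N a" "\<And>z. z \<in> Z \<Longrightarrow> fst z \<in> X"
  shows "ptime Z (\<lambda>z. N (fst z)) (with_input E enc_nat) (\<lambda>z. enc_nat (a (fst z) + snd z))"
  by (rule ptime_add[OF ptime_weaken[OF assms(1)] ptime_snd pbounded_fst[OF assms(2)]]) (rule assms(3), assumption)+

lemma ptime_diagonal_constraints:
  assumes n: "ptime X N E (\<lambda>x. enc_nat (n x))" "pbounded X N n"
    and a: "ptime X N E (\<lambda>x. enc_nat (a x))" "pbounded X N a"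
    and r: "ptime {(x, v). x \<in> X \<and> v < n x} (\<lambda>z. N (fst z)) (with_input E enc_nat)
      (\<lambda>z. enc_tag (r (fst z) (snd z)))"
  shows "ptime X N E (\<lambda>x. enc_list enc_con (map (\<lambda>v. (a x + v, a x + v, r x v)) [0..<n x]))"
  by (rule ptime_tabulate[OF n], rule ptime_con) (rule ptime_offset[OF a], erule fst_mem, rule ptime_offset[OF a], erule fst_mem, rule r)

lemma ptime_enc_tag_adjacency:
  assumes "ptime X N E (\<lambda>x. enc_graph (n x) (G x))" "pbounded X N n"
    and u: "ptime X N E (\<lambda>x. enc_nat (u x))" "\<And>x. x \<in> X \<Longrightarrow> u x < n x"
    and v: "ptime X N E (\<lambda>x. enc_nat (v x))" "\<And>x. x \<in> X \<Longrightarrow> v x < n x"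
  shows "ptime X N E (\<lambda>x. enc_tag (adjacency (G x) (u x) (v x)))"
proof -
  have "ptime X N E (\<lambda>x. enc_list (\<lambda>v. enc_bool ((u x, v) \<in> parcs (G x))) [0..<n x])"
    by (rule ptime_lookup[OF assms(1)[unfolded enc_graph_def] u(1) assms(2) u(2)])
  then have "ptime X N E (\<lambda>x. enc_bool ((u x, v x) \<in> parcs (G x)))"
    by (rule ptime_lookup[OF _ v(1) assms(2) v(2)])
  then show ?thesis
    unfolding adjacency_def by (rule ptime_if) (rule ptime_const)+
qed

lemma ptime_grid_constraints:
  assumes n: "ptime X N E (\<lambda>x. enc_nat (n x))" "pbounded X N n"
    and G: "ptime X N E (\<lambda>x. enc_graph (n x) (G x))"
    and a: "ptime X N E (\<lambda>x. enc_nat (a x))" "pbounded X N a"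
    and b: "ptime X N E (\<lambda>x. enc_nat (b x))" "pbounded X N b"
  shows "ptime X N E (\<lambda>x. enc_list enc_con
    (concat (map (\<lambda>u. map (\<lambda>v. (a x + u, b x + v, adjacency (G x) u v)) [0..<n x]) [0..<n x])))"
proof (rule ptime_concat_tabulate[OF n])
  let ?Z = "{(x, u). x \<in> X \<and> u < n x}" and ?E = "with_input E enc_nat"
  let ?Z' = "{(z, v). z \<in> ?Z \<and> v < n (fst z)}" and ?E' = "with_input (with_input E enc_nat) enc_nat"
  let ?N = "\<lambda>z. N (fst z)" and ?N' = "\<lambda>z. N (fst (fst z))"
  have Z: "fst z \<in> X" "snd z < n (fst z)" if "z \<in> ?Z" for z
    using that by auto
  have Z': "fst z \<in> ?Z" "fst (fst z) \<in> X" "snd (fst z) < n (fst (fst z))" "snd z < n (fst (fst z))"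
    if "z \<in> ?Z'" for z
    using that by auto
  have n': "ptime ?Z ?N ?E (\<lambda>z. enc_nat (n (fst z)))" "pbounded ?Z ?N (\<lambda>z. n (fst z))"
    by (rule ptime_weaken[OF n(1)], rule Z, assumption) (rule pbounded_fst[OF n(2)], rule Z)
  have b': "ptime ?Z ?N ?E (\<lambda>z. enc_nat (b (fst z)))" "pbounded ?Z ?N (\<lambda>z. b (fst z))"
    by (rule ptime_weaken[OF b(1)], rule Z, assumption) (rule pbounded_fst[OF b(2)], rule Z)
  have a': "ptime ?Z ?N ?E (\<lambda>z. enc_nat (a (fst z) + snd z))"
    by (rule ptime_offset[OF a]) (rule Z)
  show "pbounded ?Z ?N (\<lambda>z. length (map (\<lambda>v. (a (fst z) + snd z, b (fst z) + v,
      adjacency (G (fst z)) (snd z) v)) [0..<n (fst z)]))"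
    using n'(2) by simp
  show "ptime ?Z ?N ?E (\<lambda>z. enc_list enc_con (map (\<lambda>v. (a (fst z) + snd z, b (fst z) + v,
      adjacency (G (fst z)) (snd z) v)) [0..<n (fst z)]))"
  proof (rule ptime_tabulate[OF n'], rule ptime_con)
    show "ptime ?Z' ?N' ?E' (\<lambda>z. enc_nat (a (fst (fst z)) + snd (fst z)))"
      by (rule ptime_weaken[OF a']) (rule Z')
    show "ptime ?Z' ?N' ?E' (\<lambda>z. enc_nat (b (fst (fst z)) + snd z))"
      by (rule ptime_offset[OF b']) (rule Z')
    show "ptime ?Z' ?N' ?E' (\<lambda>z. enc_tag (adjacency (G (fst (fst z))) (snd (fst z)) (snd z)))"
      by (rule ptime_enc_tag_adjacency[OF ptime_weaken2[OF G] pbounded_fst2[OF n(2)]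
            ptime_weaken_snd _ ptime_snd]) (rule Z', assumption)+
  qed
qed

lemma ptime_walk_constraints:
  assumes n: "ptime X N E (\<lambda>x. enc_nat (n x))" "pbounded X N n"
    and G: "ptime X N E (\<lambda>x. enc_graph (n x) (G x))"
    and p: "ptime X N E (\<lambda>x. enc_precolouring c (n x) (p x))"
    and \<phi>: "ptime X N E (\<lambda>x. enc_map c (n x) (\<phi> x))"
    and \<psi>: "ptime X N E (\<lambda>x. enc_map c (n x) (\<psi> x))"
    and l: "ptime X N E (\<lambda>x. enc_nat (l x))" "pbounded X N l"
  shows "ptime X N E (\<lambda>x. enc_list enc_con
      (walk_constraints (n x) (G x) (p x) (\<phi> x) (\<psi> x) (l x)))"
    and "pbounded X N (\<lambda>x. length (walk_constraints (n x) (G x) (p x) (\<phi> x) (\<psi> x) (l x)))"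
proof -
  let ?val = "\<lambda>g j x. value_constraints (n x) (g x) (j x)"
  have val: "ptime X N E (\<lambda>x. enc_list enc_con (?val g j x))"
    "pbounded X N (\<lambda>x. length (?val g j x))"
    if g: "ptime X N E (\<lambda>x. enc_map c (n x) (g x))" and j: "ptime X N E (\<lambda>x. enc_nat (j x))" "pbounded X N j"
    for g j
  proof -
    let ?Z = "{(x, v). x \<in> X \<and> v < n x}" and ?E = "with_input E enc_nat" and ?N = "\<lambda>z. N (fst z)"
    have "ptime ?Z ?N ?E (\<lambda>z. enc_list (\<lambda>v. enc_val (g (fst z) v)) [0..<n (fst z)])"
      by (rule ptime_weaken[OF g[unfolded enc_map_def]]) (rule fst_mem)
    then have "ptime ?Z ?N ?E (\<lambda>z. enc_val (g (fst z) (snd z)))"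
      by (rule ptime_lookup[OF _ ptime_snd pbounded_fst[OF n(2)]]) auto
    then have "ptime ?Z ?N ?E (\<lambda>z. enc_tag (Some (Some (g (fst z) (snd z)))))"
      by (intro ptime_Some)
    then show "ptime X N E (\<lambda>x. enc_list enc_con (?val g j x))"
      unfolding value_constraints_def
      by (rule ptime_diagonal_constraints[OF n ptime_mult[OF j n] pbounded_mult[OF j(2) n(2)]])
    show "pbounded X N (\<lambda>x. length (?val g j x))"
      unfolding value_constraints_def using n(2) by simp
  qed
  have val_\<phi>: "ptime X N E (\<lambda>x. enc_list enc_con (value_constraints (n x) (\<phi> x) 0))"
    "pbounded X N (\<lambda>x. length (value_constraints (n x) (\<phi> x) 0))"
    by (rule val[OF \<phi> ptime_const pbounded_const])+
  have Suc_l: "ptime X N E (\<lambda>x. enc_nat (Suc (l x)))" "pbounded X N (\<lambda>x. Suc (l x))"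
    by (rule ptime_Suc[OF l(1)]) (rule pbounded_Suc[OF l(2)])
  let ?ext = "\<lambda>x. concat (map (extension_constraints (n x) (G x) (p x)) [0..<Suc (l x)])"
  have ext: "ptime X N E (\<lambda>x. enc_list enc_con (?ext x))" "pbounded X N (\<lambda>x. length (?ext x))"
  proof -
    let ?Y = "{(x, j). x \<in> X \<and> j < Suc (l x)}" and ?E = "with_input E enc_nat" and ?N = "\<lambda>z. N (fst z)"
    let ?h = "\<lambda>z. extension_constraints (n (fst z)) (G (fst z)) (p (fst z)) (snd z)"
    have n': "ptime ?Y ?N ?E (\<lambda>z. enc_nat (n (fst z)))" "pbounded ?Y ?N (\<lambda>z. n (fst z))"
      by (rule ptime_weaken[OF n(1)], erule fst_mem) (rule pbounded_fst[OF n(2)], erule fst_mem)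
    have G': "ptime ?Y ?N ?E (\<lambda>z. enc_graph (n (fst z)) (G (fst z)))"
      by (rule ptime_weaken[OF G]) (rule fst_mem)
    have p': "ptime ?Y ?N ?E (\<lambda>z. enc_precolouring c (n (fst z)) (p (fst z)))"
      by (rule ptime_weaken[OF p]) (rule fst_mem)
    have a: "ptime ?Y ?N ?E (\<lambda>z. enc_nat (snd z * n (fst z)))" "pbounded ?Y ?N (\<lambda>z. snd z * n (fst z))"
      by (rule ptime_mult[OF ptime_snd pbounded_upt[OF Suc_l(2)] n'])
        (rule pbounded_mult[OF pbounded_upt[OF Suc_l(2)] n'(2)])
    let ?Z = "{(z, v). z \<in> ?Y \<and> v < n (fst z)}"
    let ?E' = "with_input (with_input E enc_nat) enc_nat" and ?N' = "\<lambda>z. N (fst (fst z))"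
    have "ptime ?Z ?N' ?E' (\<lambda>z. enc_list (\<lambda>v. enc_option enc_val (p (fst (fst z)) v)) [0..<n (fst (fst z))])"
      by (rule ptime_weaken[OF p'[unfolded enc_precolouring_def]]) (rule fst_mem)
    then have "ptime ?Z ?N' ?E' (\<lambda>z. enc_option enc_val (p (fst (fst z)) (snd z)))"
      by (rule ptime_lookup[OF _ ptime_snd pbounded_fst[OF n'(2)]]) auto
    then have tag: "ptime ?Z ?N' ?E' (\<lambda>z. enc_tag (Some (p (fst (fst z)) (snd z))))"
      by (rule ptime_Some)
    have h: "ptime ?Y ?N ?E (\<lambda>z. enc_list enc_con (?h z))"
      unfolding extension_constraints_def
    proof (rule ptime_append)
      show "ptime ?Y ?N ?E (\<lambda>z. enc_list enc_con (map (\<lambda>v. (snd z * n (fst z) + v,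
          snd z * n (fst z) + v, Some (p (fst z) v))) [0..<n (fst z)]))"
        by (rule ptime_diagonal_constraints[OF n' a tag])
      show "ptime ?Y ?N ?E (\<lambda>z. enc_list enc_con (concat (map (\<lambda>u. map (\<lambda>v. (snd z * n (fst z) + u,
          snd z * n (fst z) + v, adjacency (G (fst z)) u v)) [0..<n (fst z)]) [0..<n (fst z)])))"
        by (rule ptime_grid_constraints[OF n' G' a a])
      show "pbounded ?Y ?N (\<lambda>z. length (map (\<lambda>v. (snd z * n (fst z) + v,
          snd z * n (fst z) + v, Some (p (fst z) v))) [0..<n (fst z)]))"
        using n'(2) by simp
    qed
    have "pbounded ?Y ?N (\<lambda>z. n (fst z) + n (fst z) * n (fst z))"
      by (intro pbounded_add pbounded_mult n')
    then have len: "pbounded ?Y ?N (\<lambda>z. length (?h z))"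
      by (rule pbounded_le) (simp only: extension_constraints_def length_append length_grid length_map length_upt diff_zero le_refl)
    show "ptime X N E (\<lambda>x. enc_list enc_con (?ext x))"
      by (rule ptime_concat_tabulate[OF Suc_l h len])
    show "pbounded X N (\<lambda>x. length (?ext x))"
      by (rule pbounded_length_concat_map) (use Suc_l(2) len in \<open>simp_all del: upt_Suc\<close>)
  qed
  let ?step = "\<lambda>x. concat (map (step_constraints (n x) (G x)) [0..<l x])"
  have step: "ptime X N E (\<lambda>x. enc_list enc_con (?step x))" "pbounded X N (\<lambda>x. length (?step x))"
  proof -
    let ?Y = "{(x, j). x \<in> X \<and> j < l x}" and ?E = "with_input E enc_nat" and ?N = "\<lambda>z. N (fst z)"
    let ?h = "\<lambda>z. step_constraints (n (fst z)) (G (fst z)) (snd z)"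
    have n': "ptime ?Y ?N ?E (\<lambda>z. enc_nat (n (fst z)))" "pbounded ?Y ?N (\<lambda>z. n (fst z))"
      by (rule ptime_weaken[OF n(1)], erule fst_mem) (rule pbounded_fst[OF n(2)], erule fst_mem)
    have G': "ptime ?Y ?N ?E (\<lambda>z. enc_graph (n (fst z)) (G (fst z)))"
      by (rule ptime_weaken[OF G]) (rule fst_mem)
    have j: "pbounded ?Y ?N (\<lambda>z. snd z)"
      by (rule pbounded_upt[OF l(2)])
    have a: "ptime ?Y ?N ?E (\<lambda>z. enc_nat (snd z * n (fst z)))" "pbounded ?Y ?N (\<lambda>z. snd z * n (fst z))"
      by (rule ptime_mult[OF ptime_snd j n']) (rule pbounded_mult[OF j n'(2)])
    have b: "ptime ?Y ?N ?E (\<lambda>z. enc_nat (Suc (snd z) * n (fst z)))"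
      "pbounded ?Y ?N (\<lambda>z. Suc (snd z) * n (fst z))"
      by (rule ptime_mult[OF ptime_Suc[OF ptime_snd] pbounded_Suc[OF j] n'])
        (rule pbounded_mult[OF pbounded_Suc[OF j] n'(2)])
    have h: "ptime ?Y ?N ?E (\<lambda>z. enc_list enc_con (?h z))"
      unfolding step_constraints_def by (rule ptime_grid_constraints[OF n' G' a b])
    have len: "pbounded ?Y ?N (\<lambda>z. length (?h z))"
      unfolding step_constraints_def length_grid by (intro pbounded_mult n')
    show "ptime X N E (\<lambda>x. enc_list enc_con (?step x))"
      by (rule ptime_concat_tabulate[OF l h len])
    show "pbounded X N (\<lambda>x. length (?step x))"
      by (rule pbounded_length_concat_map) (use l(2) len in simp_all)
  qed
  show "ptime X N E (\<lambda>x. enc_list enc_con (walk_constraints (n x) (G x) (p x) (\<phi> x) (\<psi> x) (l x)))"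
    unfolding walk_constraints_def
    by (rule ptime_append[OF val_\<phi>(1) ptime_append[OF val(1)[OF \<psi> l]
          ptime_append[OF ext(1) step(1) ext(2)] val(2)[OF \<psi> l]] val_\<phi>(2)])
  show "pbounded X N (\<lambda>x. length (walk_constraints (n x) (G x) (p x) (\<phi> x) (\<psi> x) (l x)))"
    unfolding walk_constraints_def length_append
    by (intro pbounded_add val_\<phi>(2) val(2)[OF \<psi> l] ext(2) step(2))
qed

lemma ptime_block:
  assumes n: "ptime X N E (\<lambda>x. enc_nat (n x))" "pbounded X N n"
    and t: "ptime X N E (\<lambda>x. enc_vec (t x))"
    and j: "ptime X N E (\<lambda>x. enc_nat (j x))" "pbounded X N j"
    and len: "\<And>x v. x \<in> X \<Longrightarrow> v < n x \<Longrightarrow> j x * n x + v < length (t x)"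
  shows "ptime X N E (\<lambda>x. enc_vec (block (n x) (t x) (j x)))"
  unfolding block_def
proof (rule ptime_tabulate[OF n])
  let ?Z = "{(x, v). x \<in> X \<and> v < n x}"
  have jn: "pbounded X N (\<lambda>x. j x * n x)"
    by (rule pbounded_mult[OF j(2) n(2)])
  have "pbounded ?Z (\<lambda>z. N (fst z)) (\<lambda>z. j (fst z) * n (fst z) + snd z)"
    by (rule pbounded_add[OF pbounded_fst[OF jn] pbounded_upt[OF n(2)]]) (rule fst_mem)
  note nth = ptime_nth[OF ptime_weaken[OF t] ptime_offset[OF ptime_mult[OF j n] jn] this]
  show "ptime ?Z (\<lambda>z. N (fst z)) (with_input E enc_nat)
      (\<lambda>z. enc_val (t (fst z) ! (j (fst z) * n (fst z) + snd z)))"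
    by (rule nth) (use len in auto)
qed

text \<open>Homomorphisms stay vectors here: the encoding of a vector is the same tree as that of
  the map it describes, so the output needs no conversion.\<close>

definition walks ::
    "nat \<Rightarrow> nat pair_pre_digraph \<Rightarrow> (nat \<rightharpoonup> 'a) \<Rightarrow> (nat \<Rightarrow> 'a) \<Rightarrow> (nat \<Rightarrow> 'a) \<Rightarrow> nat \<Rightarrow> 'a list list list" where
  "walks n G p \<phi> \<psi> l = map (\<lambda>t. map (block n t) [0..<Suc l])
     (solve hs (Suc l * n) (walk_constraints n G p \<phi> \<psi> l))"

lemma ptime_walks:
  assumes n: "ptime X N E (\<lambda>x. enc_nat (n x))" "pbounded X N n"
    and G: "ptime X N E (\<lambda>x. enc_graph (n x) (G x))"
    and p: "ptime X N E (\<lambda>x. enc_precolouring c (n x) (p x))"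
    and \<phi>: "ptime X N E (\<lambda>x. enc_map c (n x) (\<phi> x))"
    and \<psi>: "ptime X N E (\<lambda>x. enc_map c (n x) (\<psi> x))"
    and l: "ptime X N E (\<lambda>x. enc_nat (l x))" "pbounded X N l"
    and X: "\<And>x. x \<in> X \<Longrightarrow> set (walk_constraints (n x) (G x) (p x) (\<phi> x) (\<psi> x) (l x))
      \<subseteq> constraints (Suc (l x) * n x)"
  shows "ptime X N E (\<lambda>x. enc_list (enc_list enc_vec) (walks (n x) (G x) (p x) (\<phi> x) (\<psi> x) (l x)))"
    and "pbounded X N (\<lambda>x. length (walks (n x) (G x) (p x) (\<phi> x) (\<psi> x) (l x)))"
proof -
  let ?m = "\<lambda>x. Suc (l x) * n x"
  let ?T = "\<lambda>x. solve hs (?m x) (walk_constraints (n x) (G x) (p x) (\<phi> x) (\<psi> x) (l x))"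
  have Suc_l: "ptime X N E (\<lambda>x. enc_nat (Suc (l x)))" "pbounded X N (\<lambda>x. Suc (l x))"
    by (rule ptime_Suc[OF l(1)]) (rule pbounded_Suc[OF l(2)])
  have m: "ptime X N E (\<lambda>x. enc_nat (?m x))" "pbounded X N ?m"
    by (rule ptime_mult[OF Suc_l n]) (rule pbounded_mult[OF Suc_l(2) n(2)])
  have T: "ptime X N E (\<lambda>x. enc_list enc_vec (?T x))"
    by (rule ptime_solve[OF m ptime_walk_constraints[OF n G p \<phi> \<psi> l] X])
  have len: "pbounded X N (\<lambda>x. length (?T x))"
    by (rule pbounded_le[OF pbounded_size_bound[OF m(2)]], rule length_solve) (simp add: set_hs)
  then show "pbounded X N (\<lambda>x. length (walks (n x) (G x) (p x) (\<phi> x) (\<psi> x) (l x)))"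
    unfolding walks_def length_map .
  let ?Z = "{(x, t). x \<in> X \<and> t \<in> set (?T x)}" and ?E = "with_input E enc_vec"
  let ?N = "\<lambda>z. N (fst z)"
  have Z: "fst z \<in> X" "length (snd z) = ?m (fst z)" if "z \<in> ?Z" for z
  proof -
    have "fst z \<in> X" "snd z \<in> set (?T (fst z))"
      using that by auto
    then show "fst z \<in> X" "length (snd z) = ?m (fst z)"
      using solve_vecs[of hs "?m (fst z)"] set_hs unfolding vecs_def by blast+
  qed
  show "ptime X N E (\<lambda>x. enc_list (enc_list enc_vec) (walks (n x) (G x) (p x) (\<phi> x) (\<psi> x) (l x)))"
    unfolding walks_def
  proof (rule ptime_map[OF T len], rule ptime_tabulate)
    show "ptime ?Z ?N ?E (\<lambda>z. enc_nat (Suc (l (fst z))))"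
      by (rule ptime_weaken[OF Suc_l(1)]) (rule Z)
    show Suc_l': "pbounded ?Z ?N (\<lambda>z. Suc (l (fst z)))"
      by (rule pbounded_fst[OF Suc_l(2)]) (rule Z)
    let ?Z' = "{(z, j). z \<in> ?Z \<and> j < Suc (l (fst z))}"
    let ?E' = "with_input (with_input E enc_vec) enc_nat" and ?N' = "\<lambda>z. N (fst (fst z))"
    have Z': "fst z \<in> ?Z" "snd z < Suc (l (fst (fst z)))" if "z \<in> ?Z'" for z
      using that by (simp_all add: split_beta)
    have n': "ptime ?Z' ?N' ?E' (\<lambda>z. enc_nat (n (fst (fst z))))" "pbounded ?Z' ?N' (\<lambda>z. n (fst (fst z)))"
      by (rule ptime_weaken2[OF n(1)], rule Z, rule Z', assumption)
        (rule pbounded_fst2[OF n(2)], rule Z, rule Z')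
    show "ptime ?Z' ?N' ?E' (\<lambda>z. enc_vec (block (n (fst (fst z))) (snd (fst z)) (snd z)))"
      by (rule ptime_block[OF n' ptime_weaken_snd ptime_snd pbounded_upt[OF Suc_l']],
          subst Z(2), erule Z', rule block_index_less, erule Z')
  qed
qed

end

section \<open>Assembling the program and the theorem\<close>

lemma poly_time_solvableI:
  assumes "ptime I sz enc F" "\<And>x. x \<in> I \<Longrightarrow> F x \<in> enc_out x ` answers x"
  shows "poly_time_solvable I enc sz answers enc_out"
proof -
  obtain P e t where t: "pbounded I sz t" "\<And>x. x \<in> I \<Longrightarrow> eval P [enc x] e (F x) (t x)"
    using assms(1) unfolding ptime_def runs_def by blast
  \<comment> \<open>Function 0 is the entry point, so the main expression goes in front and all call
    targets move up by one.\<close>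
  define P' where "P' = [shift 1 e] @ map (shift 1) P"
  have "pbounded I sz (\<lambda>x. Suc (Suc 0 + t x))"
    by (intro pbounded_intros t(1))
  then obtain q where q: "\<And>x. x \<in> I \<Longrightarrow> Suc (Suc 0 + t x) \<le> poly q (sz x)"
    unfolding pbounded_def by blast
  have P': "0 < length P'" "P' ! 0 = shift 1 e"
    unfolding P'_def by simp_all
  have run: "eval P' [enc x] (ECall 0 [EVar 0]) (F x) (Suc (Suc 0 + t x))" if "x \<in> I" for x
  proof -
    have "eval P' [enc x] (P' ! 0) (F x) (t x)"
      using eval_append_shift[OF t(2)[OF that], of "[shift 1 e]"] unfolding P'(2) unfolding P'_def by simp
    moreover have "eval P' [enc x] (EVar 0) (enc x) (Suc 0)"
      by (rule eval_Var') simp_all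
    ultimately show ?thesis
      using P'(1) by (intro eval_Call1)
  qed
  show ?thesis
    unfolding poly_time_solvable_def
  proof (intro exI ballI conjI)
    fix x assume x: "x \<in> I"
    show "eval P' [enc x] (ECall 0 [EVar 0]) (F x) (Suc (Suc 0 + t x))"
      by (rule run[OF x])
    show "F x \<in> enc_out x ` answers x"
      by (rule assms(2)[OF x])
    show "Suc (Suc 0 + t x) \<le> poly q (sz x)"
      by (rule q[OF x])
  qed
qed

lemma parcs_subset:
  assumes "pair_pseudo_graph G"
  shows "parcs G \<subseteq> pverts G \<times> pverts G"
proof -
  interpret pair_pseudo_graph G
    by (rule assms)
  show ?thesis
    by (rule subsetI, unfold mem_Times_iff) (intro conjI arc_fst_in_verts arc_snd_in_verts)
qed

text \<open>Entries that agree off one position \<open>j\<close> number at least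
  \<open>k - 1\<close>, which translates the counting form of near-unanimity into the form with an
  exceptional position.\<close>

lemma NU_graph_polymorphism:
  assumes "pair_pseudo_graph H" "NU_graph k H"
  obtains f where "nu_polymorphism (pverts H) (parcs H) k f"
proof -
  obtain f where k: "k \<ge> 3" and f: "f \<in> homs (graph_power H k) H"
    and nu: "\<And>xs x. xs \<in> pverts (graph_power H k) \<Longrightarrow> x \<in> pverts H \<Longrightarrow>
      card {i. i < k \<and> xs ! i = x} \<ge> k - 1 \<Longrightarrow> f xs = x"
    using assms(2) unfolding NU_graph_def by blast
  have verts: "pverts (graph_power H k) = {xs. length xs = k \<and> set xs \<subseteq> pverts H}"
    unfolding graph_power_def by (simp add: Let_def)
  interpret pair_pseudo_graph H
    by (rule assms(1))
  have "nu_polymorphism (pverts H) (parcs H) k f"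
  proof (rule nu_polymorphism.intro)
    show "f xs \<in> pverts H" if "length xs = k" "set xs \<subseteq> pverts H" for xs
      using f that unfolding homs_def verts by auto
    show "f xs = x" if xs: "length xs = k" "set xs \<subseteq> pverts H" "x \<in> pverts H" "j < k"
      "\<And>i. i < k \<Longrightarrow> i \<noteq> j \<Longrightarrow> xs ! i = x" for xs x j
    proof (rule nu)
      have "{..<k} - {j} \<subseteq> {i. i < k \<and> xs ! i = x}"
        using xs(5) by auto
      then have "card ({..<k} - {j}) \<le> card {i. i < k \<and> xs ! i = x}"
        by (intro card_mono) auto
      then show "k - 1 \<le> card {i. i < k \<and> xs ! i = x}"
        using xs(4) by simp
    qed (use xs verts in auto)
    show "(f xs, f ys) \<in> parcs H" if "length xs = k" "set xs \<subseteq> pverts H"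
      "length ys = k" "set ys \<subseteq> pverts H" "\<And>i. i < k \<Longrightarrow> (xs ! i, ys ! i) \<in> parcs H" for xs ys
    proof -
      have "(xs, ys) \<in> parcs (graph_power H k)"
        using that unfolding graph_power_def by (simp add: Let_def)
      then show ?thesis
        using f unfolding homs_def by auto
    qed
  qed (rule pair_finite_verts k)+
  then show ?thesis
    by (rule that)
qed

theorem corollary3p9:
  fixes k :: nat and H :: "'b pair_pre_digraph" and c :: "'b \<Rightarrow> nat"
  assumes "pair_pseudo_graph H" and "NU_graph k H" and "inj_on c (pverts H)"
  shows "poly_time_solvable (Recon_Ext H \<inter> numbered) (enc_inst c) num_verts
           (shortest_path_answers H) (enc_answer c)"
proof -
  obtain f where f: "nu_polymorphism (pverts H) (parcs H) k f"
    using assms(1,2) by (rule NU_graph_polymorphism)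
  then interpret nu_polymorphism "pverts H" "parcs H" k f .
  obtain hs where hs: "set hs = pverts H"
    using finite_list[OF finite_V] by blast
  interpret encoded_nu_polymorphism "pverts H" "parcs H" k f c hs
    by unfold_locales (use assms(3) hs in auto)
  let ?I = "Recon_Ext H \<inter> numbered :: (nat, 'b) recon_inst set"
  let ?n = "num_verts :: (nat, 'b) recon_inst \<Rightarrow> nat"
  define G where "G = (fst :: (nat, 'b) recon_inst \<Rightarrow> _)"
  define p where "p x = fst (snd x)" for x :: "(nat, 'b) recon_inst"
  define \<phi> where "\<phi> x = fst (snd (snd x))" for x :: "(nat, 'b) recon_inst"
  define \<psi> where "\<psi> x = snd (snd (snd x))" for x :: "(nat, 'b) recon_inst"
  have x: "x = (G x, p x, \<phi> x, \<psi> x)" for x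
    unfolding G_def p_def \<phi>_def \<psi>_def by simp
  have n: "?n x = card (pverts (G x))" for x
    by (subst x) (simp only: num_verts.simps)
  have inst: "recon_instance H k f (G x) (p x) (\<phi> x) (\<psi> x) (?n x)" if "x \<in> ?I" for x
  proof -
    have "(G x, p x, \<phi> x, \<psi> x) \<in> Recon_Ext H" "(G x, p x, \<phi> x, \<psi> x) \<in> numbered"
      using that x[of x] by auto
    then have "pair_pseudo_graph (G x)" "dom (p x) \<subseteq> pverts (G x)"
      "\<phi> x \<in> verts (Hom_ext (G x) H (p x))" "\<psi> x \<in> verts (Hom_ext (G x) H (p x))"
      "pverts (G x) = {..<?n x}"
      unfolding Recon_Ext_def numbered_def precolouring_def n by blast+
    moreover from this(1) have "parcs (G x) \<subseteq> pverts (G x) \<times> pverts (G x)"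
      by (rule parcs_subset)
    ultimately show ?thesis
      using f by (intro recon_instance.intro recon_instance_axioms.intro) simp_all
  qed
  \<comment> \<open>The evaluation of constraints by tables requires all fixed values to be vertices
    of \<open>H\<close>; for coloured vertices these are values of \<open>\<phi>\<close>.\<close>
  have tags: "set (walk_constraints (?n x) (G x) (p x) (\<phi> x) (\<psi> x) l) \<subseteq> constraints (Suc l * ?n x)"
    if "x \<in> ?I" for x l
  proof -
    interpret recon_instance H k f "G x" "p x" "\<phi> x" "\<psi> x" "?n x"
      using that by (rule inst)
    have val: "g v \<in> pverts H" if "g \<in> verts (Hom_ext (G x) H (p x))" "v < ?n x" for g v
      using that unfolding verts_Hom_ext homs_def verts_G by auto
    have "Some (p x v) \<in> tags" if "v < ?n x" for v
    proof (cases "p x v")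
      case (Some a)
      then have "a = \<phi> x v"
        using \<phi> unfolding verts_Hom_ext by force
      then show ?thesis
        using Some val[OF \<phi> that] unfolding tags_def by blast
    qed (simp add: tags_def)
    moreover have "Some (Some (g v)) \<in> tags" if "g \<in> verts (Hom_ext (G x) H (p x))" "v < ?n x" for g v
      using val[OF that] unfolding tags_def by blast
    moreover have "adjacency (G x) u v \<in> tags" for u v
      unfolding adjacency_def tags_def by simp
    ultimately have "r \<in> tags"
      if "(i, j, r) \<in> set (walk_constraints (?n x) (G x) (p x) (\<phi> x) (\<psi> x) l)" for i j r
      using that \<phi> \<psi>
      unfolding walk_constraints_def value_constraints_def extension_constraints_def step_constraints_def
      by (auto simp del: upt_Suc)
    then show ?thesis
      using walk_constraints_index[of l] unfolding constraints_def by auto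
  qed
  \<comment> \<open>The successor is needed because \<open>[0..<L n]\<close> must include the
    bounding length itself.\<close>
  define L where "L n = Suc (n ^ (k - 1) * card (pverts H) ^ (k - 1))" for n
  define sols where
    "sols x = concat (map (walks (?n x) (G x) (p x) (\<phi> x) (\<psi> x)) [0..<L (?n x)])" for x
  \<comment> \<open>These are the two shapes of \<open>enc_option\<close>: no walk at all, or the
    first one found.\<close>
  define F where "F x = (if sols x = [] then Leaf else Node (enc_list enc_vec (hd (sols x))) Leaf)" for x
  have enc: "enc_inst c x = Node (enc_graph (?n x) (G x)) (Node (enc_precolouring c (?n x) (p x))
      (Node (enc_map c (?n x) (\<phi> x)) (enc_map c (?n x) (\<psi> x))))" for x
    by (subst x) (simp add: n Let_def)
  have "ptime ?I ?n (enc_inst c) F"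
  proof -
    let ?E = "enc_inst c"
    have E: "ptime ?I ?n ?E (\<lambda>x. enc_graph (?n x) (G x))"
      "ptime ?I ?n ?E (\<lambda>x. enc_precolouring c (?n x) (p x))"
      "ptime ?I ?n ?E (\<lambda>x. enc_map c (?n x) (\<phi> x))" "ptime ?I ?n ?E (\<lambda>x. enc_map c (?n x) (\<psi> x))"
    proof -
      note r = ptime_refl[of ?I ?n ?E]
      show "ptime ?I ?n ?E (\<lambda>x. enc_graph (?n x) (G x))"
        using ptime_left[OF r] by (simp add: enc)
      show "ptime ?I ?n ?E (\<lambda>x. enc_precolouring c (?n x) (p x))"
        using ptime_left[OF ptime_right[OF r]] by (simp add: enc)
      show "ptime ?I ?n ?E (\<lambda>x. enc_map c (?n x) (\<phi> x))"
        using ptime_left[OF ptime_right[OF ptime_right[OF r]]] by (simp add: enc)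
      show "ptime ?I ?n ?E (\<lambda>x. enc_map c (?n x) (\<psi> x))"
        using ptime_right[OF ptime_right[OF ptime_right[OF r]]] by (simp add: enc)
    qed
    \<comment> \<open>The number of vertices is not part of the input; it is obtained by counting
      the rows of the adjacency matrix, each row being treated as an opaque tree.\<close>
    have "ptime ?I ?n ?E (\<lambda>x. enc_list (\<lambda>r. r)
        (map (\<lambda>u. enc_list (\<lambda>v. enc_bool ((u, v) \<in> parcs (G x))) [0..<?n x]) [0..<?n x]))"
      using E(1) unfolding enc_graph_def enc_list_map .
    from ptime_length[OF this] have num: "ptime ?I ?n ?E (\<lambda>x. enc_nat (?n x))"
      by (simp add: pbounded_size)
    \<comment> \<open>The length bound as a polynomial in \<open>n\<close>, with coefficients
      depending on \<open>H\<close> and \<open>k\<close> only; the program evaluates it in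
      unary.\<close>
    let ?q = "1 + monom (card (pverts H) ^ (k - 1)) (k - 1)"
    have "poly ?q m = L m" for m
      unfolding L_def by (simp add: poly_monom)
    then have L: "ptime ?I ?n ?E (\<lambda>x. enc_nat (L (?n x)))" "pbounded ?I ?n (\<lambda>x. L (?n x))"
      using ptime_poly[OF num pbounded_size, of ?q] pbounded_poly[of ?I ?n ?q] by simp_all
    let ?Z = "{(x, l). x \<in> ?I \<and> l < L (?n x)}"
    have walks: "ptime ?Z (\<lambda>z. ?n (fst z)) (with_input ?E enc_nat) (\<lambda>z. enc_list (enc_list enc_vec)
        (walks (?n (fst z)) (G (fst z)) (p (fst z)) (\<phi> (fst z)) (\<psi> (fst z)) (snd z)))"
      "pbounded ?Z (\<lambda>z. ?n (fst z))
        (\<lambda>z. length (walks (?n (fst z)) (G (fst z)) (p (fst z)) (\<phi> (fst z)) (\<psi> (fst z)) (snd z)))"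
      by (rule ptime_walks[OF ptime_weaken[OF num] pbounded_size ptime_weaken[OF E(1)]
          ptime_weaken[OF E(2)] ptime_weaken[OF E(3)] ptime_weaken[OF E(4)] ptime_snd
          pbounded_upt[OF L(2)] tags]; erule fst_mem)+
    have sols: "ptime ?I ?n ?E (\<lambda>x. enc_list (enc_list enc_vec) (sols x))"
      unfolding sols_def by (rule ptime_concat_tabulate[OF L walks])
    \<comment> \<open>The left subtree of the encoding of a nonempty list is the encoding of its
      head.\<close>
    then have "ptime ?I ?n ?E (\<lambda>x. Node (left (enc_list (enc_list enc_vec) (sols x))) Leaf)"
      by (intro ptime_Node ptime_left ptime_Leaf)
    then have "ptime {x \<in> ?I. sols x \<noteq> []} ?n ?E (\<lambda>x. Node (enc_list enc_vec (hd (sols x))) Leaf)"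
      by (rule ptime_cong[OF ptime_mono]) (auto simp: neq_Nil_conv)
    then show ?thesis
      unfolding F_def
      by (intro ptime_if[where ea = "\<lambda>t. t", OF ptime_null[OF sols]] ptime_Leaf)
  qed
  then show ?thesis
  proof (rule poly_time_solvableI)
    fix x assume "x \<in> ?I"
    then interpret recon_instance H k f "G x" "p x" "\<phi> x" "\<psi> x" "?n x"
      by (rule inst)
    define ys where "ys = concat (map (\<lambda>l. map (decode l) (solutions_of_length hs l)) [0..<L (?n x)])"
    have "(case ys of [] \<Rightarrow> None | y # _ \<Rightarrow> Some y) \<in> shortest_path_answers H (G x, p x, \<phi> x, \<psi> x)"
      unfolding ys_def by (rule shortest_path_answer[OF hs]) (simp add: L_def)
    then have answer: "(case ys of [] \<Rightarrow> None | y # _ \<Rightarrow> Some y) \<in> shortest_path_answers H x"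
      unfolding x[symmetric] .
    have ys: "ys = map (map hom_of) (sols x)"
      unfolding ys_def sols_def walks_def solutions_of_length_def decode_def
      by (simp add: map_concat o_def del: upt_Suc)
    have "enc_answer c x (case map (map hom_of) (sols x) of [] \<Rightarrow> None | y # _ \<Rightarrow> Some y) = F x"
    proof (cases "sols x")
      case Nil
      then show ?thesis
        unfolding F_def enc_answer_def by simp
    next
      case (Cons y ys)
      \<comment> \<open>The blocks have length \<open>n\<close>, so listing the values of
        \<open>hom_of s\<close> on \<open>[0..<n]\<close> gives back \<open>s\<close>; the vectors
        computed are thus already the encoded homomorphisms.\<close>
      have "enc_map c (?n x) (hom_of s) = enc_vec s" if "s \<in> set y" for s
      proof -
        have "y \<in> set (sols x)"
          using Cons by simp
        with that have "length s = ?n x"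
          unfolding sols_def walks_def block_def by (auto simp del: upt_Suc)
        then have "enc_vec s = enc_vec (map ((!) s) [0..<?n x])"
          using map_nth[of s] by simp
        also have "\<dots> = enc_map c (?n x) (hom_of s)"
          unfolding enc_map_def enc_list_map hom_of_def by (rule enc_list_cong) simp
        finally show ?thesis ..
      qed
      then have "enc_list (enc_map c (?n x)) (map hom_of y) = enc_list enc_vec y"
        unfolding enc_list_map by (rule enc_list_cong)
      then show ?thesis
        unfolding F_def enc_answer_def Cons by simp
    qed
    then have "enc_answer c x (case ys of [] \<Rightarrow> None | y # _ \<Rightarrow> Some y) = F x"
      unfolding ys .
    with imageI[OF answer, of "enc_answer c x"] show "F x \<in> enc_answer c x ` shortest_path_answers H x"
      by simp
  qed
qed

end
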